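(* For every real $\alpha >0$ there exists a positive integer $c$ such that, whenever $A$ and $B$ are finite non-empty subsets of $\mathbb{Z}$ with $|A| \geq \alpha |B|$, there exist elements $b_1, b_2, \dots, b_c \in B$ such that $$|A+\{b_1, \dots, b_c\}| \ge |A|+|B|-1.$$
   Context: For subsets $X,Y$ of an abelian group, $X+Y=\{x+y : x\in X, y\in Y\}$. The elements $b_1,\dots,b_c$ are not required to be distinct. *)

theory Defs
  imports Complex_Main "HOL-Library.Set_Algebras"
begin

end

(*
Write n = |B| - 1 and m = max B - min B. If F contains both ends of B, then |A + F| is at least |A|
plus the number of residues mod m met by A + F, while B occupies n residues; averaging over B then
yields |A| + (1 - eps) n with boundedly many elements, and |A| + n with three elements when |A| >= n.
Cutting A and B into a lower and an upper part reduces the range |B|/2 < |A| < n to |A| <= |B|/2.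

For |A| <= |B|/2 either two ends of A already give enough, or A lies almost inside a window of
length m. Choosing k random elements of B covers n residues mod m unless the number R(r) of
representations of a residue r in A + B is almost always near 0 or |A|. In that case most differences
of A almost preserve B mod m, and the near-periods of B mod m contain a subgroup dZ, so that A lies
mostly in one class mod d. If B meets two classes mod d, their contributions add up; if B lies in one
class, it nearly fills it, and dividing by d reduces to a B that is nearly an interval. Then A is
nearly an interval too, and a random choice of one element from each of boundedly many cells of B
fills A + B up to as many holes as A and B have.
*)
theory Submission
  imports Defs
begin

text \<open>Averaging loses a factor \<open>1 - \<epsilon>\<close>, so every exact bound must be
  paid for by a surplus. Separated ends of \<open>A\<close> collect n twice, two classes of
  \<open>B\<close> collect \<open>card A\<close> twice. For |A| <= |B|/2 the target |A| + n is at
  most about 3n/2, which two approximate copies of n exceed. When neither surplus exists, sums are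
  counted mod m. The -1 comes from here: the two ends of \<open>B\<close> share a residue, so
  \<open>B\<close> has n residues, not n + 1. A window of length m makes the residues of A distinct.
  A random choice may miss m - n residues. If R takes only the values 0 and |A|, exactly n residues
  are reachable and the estimate for the misses exceeds m - n by a little; intermediate values of R
  give a convexity gain proportional to the sum of R(r)(|A| - R(r)). A small value of this energy
  means that typical differences of A are near-periods of \<open>B\<close>. For near-intervals there
  is no first-order surplus at all: a second-order gain at the two ends of A + B is played against a
  third-order loss in the interior.\<close>

section \<open>Bounded subsets of B and the averaging bound\<close>

text \<open>A set of at most \<open>c\<close> elements replaces the list of \<open>c\<close>
  elements, so that choices made for different parts can be united while the bounds \<open>c\<close>
  add up. The target \<open>t\<close> is real because the intermediate bounds carry factors
  \<open>1 - \<epsilon>\<close>.\<close>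

definition attains :: "nat \<Rightarrow> int set \<Rightarrow> int set \<Rightarrow> real \<Rightarrow> bool" where
  "attains c A B t \<longleftrightarrow> (\<exists>F. F \<subseteq> B \<and> card F \<le> c \<and> t \<le> real (card (A + F)))"

lemma attainsI:
  assumes "F \<subseteq> B" "card F \<le> c" "t \<le> real (card (A + F))"
  shows "attains c A B t"
  using assms unfolding attains_def by blast

lemma finite_set_add: "finite A \<Longrightarrow> finite F \<Longrightarrow> finite (A + F :: int set)"
  by (rule finite_set_plus)

lemma card_set_add_mono:
  fixes A F :: "int set"
  assumes "finite A" "finite F" "A' \<subseteq> A" "F' \<subseteq> F"
  shows "card (A' + F') \<le> card (A + F)"
  by (rule card_mono[OF finite_set_add[OF assms(1,2)] set_plus_mono2[OF assms(3,4)]])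

lemma attains_mono:
  assumes "attains c A B t" "c \<le> c'" "t' \<le> t" "A \<subseteq> A'" "B \<subseteq> B'" "finite A'" "finite B'"
  shows "attains c' A' B' t'"
proof -
  obtain F where F: "F \<subseteq> B" "card F \<le> c" "t \<le> real (card (A + F))"
    using assms(1) unfolding attains_def by blast
  have fF: "finite F" using F(1) assms(5,7) by (meson finite_subset)
  have "card (A + F) \<le> card (A' + F)"
    by (rule card_set_add_mono) (use assms fF in auto)
  with F assms show ?thesis by (intro attainsI[of F]) auto
qed

text \<open>Used with parts separated by order or by residue class; \<open>B1\<close> and
  \<open>B2\<close> may overlap or coincide, since only the sumsets have to be disjoint.\<close>

lemma attains_union:
  assumes "attains c1 A B1 t1" "attains c2 A' B2 t2" "A \<subseteq> A0" "A' \<subseteq> A0" "B1 \<subseteq> B" "B2 \<subseteq> B"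
    "finite A0" "finite B"
    and disj: "\<And>a a' b b'. a \<in> A \<Longrightarrow> a' \<in> A' \<Longrightarrow> b \<in> B1 \<Longrightarrow> b' \<in> B2 \<Longrightarrow> a + b \<noteq> a' + b'"
  shows "attains (c1 + c2) A0 B (t1 + t2)"
proof -
  obtain F where F: "F \<subseteq> B1" "card F \<le> c1" "t1 \<le> real (card (A + F))"
    using assms(1) unfolding attains_def by blast
  obtain G where G: "G \<subseteq> B2" "card G \<le> c2" "t2 \<le> real (card (A' + G))"
    using assms(2) unfolding attains_def by blast
  have fin: "finite F" "finite G" "finite A" "finite A'"
    using F(1) G(1) assms(3-8) by (meson finite_subset order_trans)+
  have "(A + F) \<inter> (A' + G) = {}"
    using disj F(1) G(1) unfolding set_plus_def by blast
  then have "card (A + F) + card (A' + G) = card ((A + F) \<union> (A' + G))"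
    using fin by (subst card_Un_disjoint) (auto intro: finite_set_add)
  also have "\<dots> \<le> card (A0 + (F \<union> G))"
    using fin assms(3-8)
    by (intro card_mono finite_set_add Un_least set_plus_mono2) auto
  finally show ?thesis using F G assms card_Un_le[of F G] by (intro attainsI[of "F \<union> G"]) auto
qed

lemma card_set_add_singleton: "card (A + {b :: int}) = card A"
proof -
  have "A + {b} = (\<lambda>a. a + b) ` A" by (auto simp: set_plus_def)
  then show ?thesis by (simp add: card_image)
qed

lemma exists_ge_average:
  fixes f :: "'a \<Rightarrow> real"
  assumes "finite B" "B \<noteq> {}"
  shows "\<exists>b\<in>B. sum f B \<le> real (card B) * f b"
proof (rule ccontr)
  assume "\<not> ?thesis"
  then have lt: "\<And>b. b \<in> B \<Longrightarrow> f b < sum f B / real (card B)"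
    using assms by (auto simp: not_le field_simps card_gt_0_iff)
  have "sum f B < real (card B) * (sum f B / real (card B))"
    using sum_strict_mono[OF assms lt] by simp
  then show False using assms by (simp add: card_gt_0_iff)
qed

lemma exists_le_average:
  fixes f :: "'a \<Rightarrow> real"
  assumes "finite B" "B \<noteq> {}"
  shows "\<exists>b\<in>B. real (card B) * f b \<le> sum f B"
  using exists_ge_average[OF assms, of "\<lambda>x. - f x"] by (auto simp: sum_negf)

text \<open>Besides the translate \<open>A + lo\<close>, the sumset contains the largest element of
  each residue class that it meets. Such a maximum is never of the form \<open>a + lo\<close>,
  because \<open>a + hi\<close> is larger and lies in the same class.\<close>

lemma card_add_residues:
  fixes A F :: "int set"
  assumes "finite A" "finite F" "lo \<in> F" "hi \<in> F" "lo < hi"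
  shows "card A + card ((\<lambda>x. x mod (hi - lo)) ` (A + F)) \<le> card (A + F)"
proof -
  define S where "S = A + F"
  define m where "m = hi - lo"
  define R where "R = (\<lambda>x. x mod m) ` S"
  define g where "g r = Max {x \<in> S. x mod m = r}" for r
  have fS: "finite S" unfolding S_def by (rule finite_set_add) fact+
  have g: "g r \<in> {x \<in> S. x mod m = r}" if "r \<in> R" for r
    unfolding g_def by (rule Max_in) (use that fS in \<open>auto simp: R_def\<close>)
  have gmax: "x \<le> g r" if "x \<in> S" "x mod m = r" for x r
    unfolding g_def by (rule Max_ge) (use that fS in auto)
  have inj: "inj_on g R"
  proof (rule inj_onI)
    fix x y assume "x \<in> R" "y \<in> R" "g x = g y"
    then show "x = y" using g[of x] g[of y] by auto
  qed
  have disj: "(\<lambda>a. a + lo) ` A \<inter> g ` R = {}"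
  proof (rule ccontr)
    assume "\<not> ?thesis"
    then obtain a r where ar: "a \<in> A" "r \<in> R" "a + lo = g r" by auto
    have "a + hi \<in> S" using ar assms by (auto simp: S_def set_plus_def)
    moreover have "(a + hi) mod m = r"
    proof -
      have "a + hi = (a + lo) + m" by (simp add: m_def)
      then have "(a + hi) mod m = (a + lo) mod m" by (metis mod_add_self2)
      then show ?thesis using g[OF ar(2)] ar(3) by simp
    qed
    ultimately have "a + hi \<le> g r" by (rule gmax)
    then show False using ar assms by simp
  qed
  have "card ((\<lambda>a. a + lo) ` A \<union> g ` R) = card A + card R"
    using disj inj assms fS by (subst card_Un_disjoint) (auto simp: card_image R_def)
  moreover have "(\<lambda>a. a + lo) ` A \<union> g ` R \<subseteq> S"
    using g assms by (auto simp: S_def set_plus_def)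
  ultimately show ?thesis unfolding S_def[symmetric] m_def[symmetric] R_def[symmetric]
    using card_mono[OF fS] by metis
qed

lemma inj_on_mod_atLeastLessThan:
  fixes m lo :: int
  assumes "X \<subseteq> {lo..<lo + m}"
  shows "inj_on (\<lambda>x. (a + x) mod m) X"
proof (rule inj_onI)
  fix x y assume "x \<in> X" "y \<in> X" and eq: "(a + x) mod m = (a + y) mod m"
  then have *: "lo \<le> x" "x < lo + m" "lo \<le> y" "y < lo + m" using assms by auto
  from eq have "m dvd (a + x) - (a + y)" by (simp add: mod_eq_dvd_iff)
  then have "m dvd x - y" by simp
  then have "\<bar>m\<bar> \<le> \<bar>x - y\<bar>" if "x \<noteq> y" using dvd_imp_le_int[of "x - y" m] that by simp
  then show "x = y" using * by force
qed

text \<open>For fixed \<open>a\<close>, the sums \<open>a + b\<close> with \<open>b\<close> in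
  \<open>B - {Max B}\<close> have n distinct residues mod m, while A + F meets at most |A + F| - |A|
  residues. So at least n + |A| - |A + F| choices of \<open>b\<close> give a new sum with
  \<open>a\<close>; sum over \<open>a\<close> and take the best \<open>b\<close>. Both sides are
  multiplied by n to avoid a division.\<close>

lemma add_one_step:
  fixes A B F :: "int set"
  assumes fin: "finite A" "finite B" and F: "F \<subseteq> B" "Min B \<in> F" "Max B \<in> F"
    and lt: "Min B < Max B"
  shows "\<exists>b\<in>B. (real (card B) - 1) * real (card (A + insert b F))
     \<ge> (real (card B) - 1) * real (card (A + F))
        + real (card A) * (real (card B) - 1 + real (card A) - real (card (A + F)))"
proof -
  define B' where "B' = B - {Max B}"
  define S where "S = A + F"
  define m where "m = Max B - Min B"
  define n where "n = real (card B) - 1"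
  have fF: "finite F" using F fin finite_subset by blast
  have fS: "finite S" unfolding S_def by (rule finite_set_add) fact+
  have MB: "Max B \<in> B" "Min B \<in> B" using F by auto
  have cB': "real (card B') = n" unfolding B'_def n_def using fin MB card_Suc_Diff1[of B "Max B"]
    by linarith
  have "Min B \<in> B'" using MB lt by (auto simp: B'_def)
  then have B'ne: "B' \<noteq> {}" "finite B'" using fin by (auto simp: B'_def)
  have B'sub: "B' \<subseteq> {Min B..<Min B + m}"
  proof
    fix x assume "x \<in> B'"
    then have "x \<in> B" "x \<noteq> Max B" by (auto simp: B'_def)
    then show "x \<in> {Min B..<Min B + m}" using Min_le[OF fin(2), of x] Max_ge[OF fin(2), of x]
      by (auto simp: m_def)
  qed
  have res: "card A + card ((\<lambda>x. x mod m) ` S) \<le> card S"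
    unfolding m_def S_def by (rule card_add_residues) (use fin fF F lt in auto)
  have miss: "real (card {b \<in> B'. a + b \<notin> S}) \<ge> n + real (card A) - real (card S)" for a
  proof -
    have "card {b \<in> B'. a + b \<in> S} \<le> card ((\<lambda>x. x mod m) ` S)"
    proof (rule card_inj_on_le[where f = "\<lambda>b. (a + b) mod m"])
      show "inj_on (\<lambda>b. (a + b) mod m) {b \<in> B'. a + b \<in> S}"
        by (rule inj_on_mod_atLeastLessThan) (use B'sub in auto)
    qed (use fS in auto)
    moreover have "card {b \<in> B'. a + b \<in> S} + card {b \<in> B'. a + b \<notin> S} = card B'"
      using B'ne by (subst card_Un_disjoint[symmetric]) (auto intro: arg_cong[where f = card])
    ultimately show ?thesis using res cB' by linarith
  qed
  have "(\<Sum>b\<in>B'. real (card {a \<in> A. a + b \<notin> S})) = (\<Sum>a\<in>A. real (card {b \<in> B'. a + b \<notin> S}))"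
    using sum.swap_restrict[of B' A "\<lambda>_ _. 1::real" "\<lambda>b a. a + b \<notin> S"] B'ne fin by simp
  also have "\<dots> \<ge> (\<Sum>a\<in>A. n + real (card A) - real (card S))"
    by (rule sum_mono) (rule miss)
  finally have tot: "(\<Sum>b\<in>B'. real (card {a \<in> A. a + b \<notin> S})) \<ge> real (card A) * (n + real (card A) - real (card S))"
    by simp
  obtain b where b: "b \<in> B'" "(\<Sum>b\<in>B'. real (card {a \<in> A. a + b \<notin> S})) \<le> n * real (card {a \<in> A. a + b \<notin> S})"
    using exists_ge_average[OF B'ne(2,1), of "\<lambda>b. real (card {a \<in> A. a + b \<notin> S})"] cB' by auto
  have "A + insert b F = S \<union> (\<lambda>a. a + b) ` {a \<in> A. a + b \<notin> S}"
  proof -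
    have "A + insert b F = S \<union> (\<lambda>a. a + b) ` A" by (auto simp: S_def set_plus_def)
    then show ?thesis by auto
  qed
  then have "card (A + insert b F) = card S + card ((\<lambda>a. a + b) ` {a \<in> A. a + b \<notin> S})"
    using fS fin by (simp only:) (subst card_Un_disjoint, auto)
  then have "card (A + insert b F) = card S + card {a \<in> A. a + b \<notin> S}"
    by (simp add: card_image)
  then have "n * real (card (A + insert b F)) = n * real (card S) + n * real (card {a \<in> A. a + b \<notin> S})"
    by (simp add: algebra_simps)
  then show ?thesis using b tot unfolding n_def S_def B'_def by (intro bexI[of _ b]) auto
qed

lemma Min_less_Max:
  assumes "finite (B :: int set)" "card B \<ge> 2"
  shows "Min B < Max B"
proof -
  have "B \<noteq> {}" using assms by auto
  moreover have "\<not> (Max B \<le> Min B)"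
  proof
    assume le: "Max B \<le> Min B"
    have "B \<subseteq> {Min B}"
    proof
      fix x assume "x \<in> B"
      then show "x \<in> {Min B}" using Min_le[OF assms(1), of x] Max_ge[OF assms(1), of x] le by auto
    qed
    then have "card B \<le> card {Min B}" by (rule card_mono[rotated]) simp
    then show False using assms by simp
  qed
  ultimately show ?thesis by linarith
qed

text \<open>One averaging step from the two ends of \<open>B\<close> closes at least the fraction
  |A|/n of the gap to |A| + n, and here this fraction is at least 1.\<close>

lemma attains_three:
  fixes A B :: "int set"
  assumes fin: "finite A" "finite B" and ne: "B \<noteq> {}"
    and ge: "real (card A) \<ge> real (card B) - 1"
  shows "attains 3 A B (real (card A) + real (card B) - 1)"
proof (cases "card B \<ge> 2")
  case False
  then have "card B = 1" using ne fin by (cases "card B") auto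
  then show ?thesis by (auto simp: card_set_add_singleton card_1_singleton_iff intro!: attainsI[of B])
next
  case True
  note lt = Min_less_Max[OF fin(2) True]
  define F where "F = {Min B, Max B}"
  have FB: "F \<subseteq> B" using fin ne by (auto simp: F_def)
  have cF: "card F \<le> 2" unfolding F_def by (simp add: card_insert_if)
  obtain b where b: "b \<in> B" "(real (card B) - 1) * real (card (A + insert b F))
     \<ge> (real (card B) - 1) * real (card (A + F))
        + real (card A) * (real (card B) - 1 + real (card A) - real (card (A + F)))"
    using add_one_step[OF fin FB _ _ lt] by (auto simp: F_def)
  show ?thesis
  proof (cases "real (card A) + real (card B) - 1 \<le> real (card (A + F))")
    case True
    then show ?thesis using FB cF by (intro attainsI[of F]) auto
  next
    case False
    then have "real (card A) * (real (card B) - 1 + real (card A) - real (card (A + F))) \<ge>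
       (real (card B) - 1) * (real (card B) - 1 + real (card A) - real (card (A + F)))"
      using ge by (intro mult_right_mono) auto
    then have "(real (card B) - 1) * real (card (A + insert b F)) \<ge> (real (card B) - 1) * (real (card A) + real (card B) - 1)"
      using b(2) by (simp add: algebra_simps)
    moreover have "real (card B) - 1 > 0" using True by simp
    ultimately have "real (card (A + insert b F)) \<ge> real (card A) + real (card B) - 1"
      by (simp add: mult_le_cancel_left_pos)
    then show ?thesis using FB cF b(1) card_insert_le_m1[of 3 F b] by (intro attainsI[of "insert b F"]) auto
  qed
qed

text \<open>With |A| >= \<beta> n every averaging step shrinks the gap n + |A| - |A + F| by the
  factor 1 - \<beta>. It is at most n for the two ends of \<open>B\<close>, so a number of steps
  depending on \<alpha> and \<epsilon> only brings it below \<epsilon> n.\<close>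

lemma attains_approx:
  fixes \<alpha> \<epsilon> :: real
  assumes "\<alpha> > 0" "\<epsilon> > 0"
  obtains c where "\<And>A B :: int set. finite A \<Longrightarrow> finite B \<Longrightarrow> B \<noteq> {} \<Longrightarrow>
    real (card A) \<ge> \<alpha> * (real (card B) - 1) \<Longrightarrow>
    attains c A B (real (card A) + (1 - \<epsilon>) * (real (card B) - 1))"
proof -
  define \<beta> where "\<beta> = min \<alpha> 1"
  have \<beta>: "0 < \<beta>" "\<beta> \<le> 1" "\<beta> \<le> \<alpha>" using assms by (auto simp: \<beta>_def)
  obtain k where k: "(1 - \<beta>) ^ k < \<epsilon>"
    using real_arch_pow_inv[OF assms(2), of "1 - \<beta>"] \<beta> by auto
  show thesis
  proof (rule that[of "k + 2"])
    fix A B :: "int set"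
    assume fin: "finite A" "finite B" and ne: "B \<noteq> {}"
      and ge: "real (card A) \<ge> \<alpha> * (real (card B) - 1)"
    define n where "n = real (card B) - 1"
    show "attains (k + 2) A B (real (card A) + (1 - \<epsilon>) * (real (card B) - 1))"
    proof (cases "card B \<ge> 2")
      case False
      then have "card B = 1" using ne fin by (cases "card B") auto
      then show ?thesis by (auto simp: card_set_add_singleton card_1_singleton_iff intro!: attainsI[of B])
    next
      case True
      note lt = Min_less_Max[OF fin(2) True]
      have n: "n > 0" using True by (simp add: n_def)
      have geA: "real (card A) \<ge> \<beta> * n"
        using ge mult_right_mono[OF \<beta>(3), of n] n unfolding n_def[symmetric] by linarith
      have "\<exists>F. F \<subseteq> B \<and> Min B \<in> F \<and> Max B \<in> F \<and> card F \<le> j + 2 \<and>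
          n + real (card A) - real (card (A + F)) \<le> n * (1 - \<beta>) ^ j" for j
      proof (induction j)
        case 0
        have "card A \<le> card (A + {Min B, Max B})"
          using card_set_add_mono[of A "{Min B, Max B}" A "{Min B}"] fin by (simp add: card_set_add_singleton)
        then show ?case using fin ne by (intro exI[of _ "{Min B, Max B}"]) (auto simp: card_insert_if)
      next
        case (Suc j)
        then obtain F where F: "F \<subseteq> B" "Min B \<in> F" "Max B \<in> F" "card F \<le> j + 2"
          "n + real (card A) - real (card (A + F)) \<le> n * (1 - \<beta>) ^ j" by blast
        define g where "g = n + real (card A) - real (card (A + F))"
        obtain b where b: "b \<in> B" "n * real (card (A + insert b F))
             \<ge> n * real (card (A + F)) + real (card A) * g"
          using add_one_step[OF fin F(1-3) lt] by (auto simp: n_def g_def)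
        show ?case
        proof (cases "g \<le> 0")
          case True
          then show ?thesis using F \<beta> n unfolding g_def
            by (intro exI[of _ F]) (auto intro: order_trans[of _ 0])
        next
          case False
          have "real (card A) * g \<ge> \<beta> * n * g" using geA False by (intro mult_right_mono) auto
          then have "n * real (card (A + insert b F)) \<ge> n * (real (card (A + F)) + \<beta> * g)"
            using b(2) by (simp add: algebra_simps)
          then have "real (card (A + insert b F)) \<ge> real (card (A + F)) + \<beta> * g"
            using n by (simp add: mult_le_cancel_left_pos)
          then have "n + real (card A) - real (card (A + insert b F)) \<le> (1 - \<beta>) * g"
            by (simp add: g_def algebra_simps)
          also have "\<dots> \<le> (1 - \<beta>) * (n * (1 - \<beta>) ^ j)"
            using F(5) \<beta> unfolding g_def by (intro mult_left_mono) auto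
          finally show ?thesis using F b card_insert_le_m1[of "Suc j + 2" F b]
            by (intro exI[of _ "insert b F"]) (auto simp: algebra_simps)
        qed
      qed
      from this[of k] obtain F where F: "F \<subseteq> B" "card F \<le> k + 2"
          "n + real (card A) - real (card (A + F)) \<le> n * (1 - \<beta>) ^ k" by blast
      have "n * (1 - \<beta>) ^ k \<le> n * \<epsilon>" using k n by (intro mult_left_mono) auto
      then show ?thesis using F by (intro attainsI[of F]) (auto simp: n_def algebra_simps)
    qed
  qed
qed

section \<open>Random choices without probability, and gluing along a staircase\<close>

text \<open>The right side is the expected number of \<open>x\<close> not hit when each
  \<open>f i\<close> is uniform in its cell \<open>C i\<close>, independently. The method of
  conditional expectations proves it: fix the choice in the last cell so that the weighted sum over
  the unhit \<open>x\<close> is at most its average, then continue with those \<open>x\<close>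
  only.\<close>

lemma exists_hitting_choice:
  fixes C :: "nat \<Rightarrow> 'b set" and H :: "'a \<Rightarrow> 'b \<Rightarrow> bool"
  assumes "\<And>i. i < k \<Longrightarrow> finite (C i) \<and> C i \<noteq> {}" "finite X"
  shows "\<exists>f. (\<forall>i<k. f i \<in> C i) \<and> real (card {x \<in> X. \<forall>i<k. \<not> H x (f i)})
     \<le> (\<Sum>x\<in>X. \<Prod>i<k. real (card {b \<in> C i. \<not> H x b}) / real (card (C i)))"
  using assms
proof (induction k arbitrary: X)
  case 0
  then show ?case by simp
next
  case (Suc k)
  define P where "P x = (\<Prod>i<k. real (card {b \<in> C i. \<not> H x b}) / real (card (C i)))" for x
  have Ck: "finite (C k)" "C k \<noteq> {}" using Suc.prems(1)[of k] by auto
  have sw: "(\<Sum>b\<in>C k. \<Sum>x\<in>{x \<in> X. \<not> H x b}. P x) = (\<Sum>x\<in>X. real (card {b \<in> C k. \<not> H x b}) * P x)"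
    using sum.swap_restrict[of "C k" X "\<lambda>_ x. P x" "\<lambda>b x. \<not> H x b"] Ck Suc.prems by simp
  obtain b where b: "b \<in> C k" "real (card (C k)) * (\<Sum>x\<in>{x \<in> X. \<not> H x b}. P x)
      \<le> (\<Sum>b\<in>C k. \<Sum>x\<in>{x \<in> X. \<not> H x b}. P x)"
    using exists_le_average[OF Ck, of "\<lambda>b. \<Sum>x\<in>{x \<in> X. \<not> H x b}. P x"] by blast
  obtain f where f: "\<forall>i<k. f i \<in> C i"
    "real (card {x \<in> {x \<in> X. \<not> H x b}. \<forall>i<k. \<not> H x (f i)}) \<le> (\<Sum>x\<in>{x \<in> X. \<not> H x b}. P x)"
    using Suc.IH[of "{x \<in> X. \<not> H x b}"] Suc.prems unfolding P_def by auto
  have cpos: "real (card (C k)) > 0" using Ck by (simp add: card_gt_0_iff)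
  have eq: "{x \<in> X. \<forall>i<Suc k. \<not> H x ((f(k := b)) i)} = {x \<in> {x \<in> X. \<not> H x b}. \<forall>i<k. \<not> H x (f i)}"
    by (auto simp: less_Suc_eq)
  have "(\<Sum>x\<in>{x \<in> X. \<not> H x b}. P x) \<le> (\<Sum>x\<in>X. real (card {b \<in> C k. \<not> H x b}) * P x) / real (card (C k))"
    using b(2) sw cpos by (simp add: field_simps)
  also have "\<dots> = (\<Sum>x\<in>X. \<Prod>i<Suc k. real (card {b \<in> C i. \<not> H x b}) / real (card (C i)))"
    by (simp add: P_def sum_divide_distrib mult.commute)
  finally show ?case using f b(1) eq by (intro exI[of _ "f(k := b)"]) (auto simp: less_Suc_eq)
qed

text \<open>The first sumset lies at or below \<open>a + b\<close>, the second at or above it, so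
  they share at most this point; hence the -1.\<close>

lemma attains_stair:
  fixes A0 A1 B0 B1 :: "int set"
  assumes "attains c0 A0 B0 t0" "attains c1 A1 B1 t1"
    and fin: "finite A" "finite B"
    and sub: "A0 \<subseteq> A" "A1 \<subseteq> A" "B0 \<subseteq> B" "B1 \<subseteq> B"
    and le: "\<And>x. x \<in> A0 \<Longrightarrow> x \<le> a" "\<And>x. x \<in> A1 \<Longrightarrow> a \<le> x"
      "\<And>x. x \<in> B0 \<Longrightarrow> x \<le> b" "\<And>x. x \<in> B1 \<Longrightarrow> b \<le> x"
  shows "attains (c0 + c1) A B (t0 + t1 - 1)"
proof -
  obtain F where F: "F \<subseteq> B0" "card F \<le> c0" "t0 \<le> real (card (A0 + F))"
    using assms(1) unfolding attains_def by blast
  obtain G where G: "G \<subseteq> B1" "card G \<le> c1" "t1 \<le> real (card (A1 + G))"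
    using assms(2) unfolding attains_def by blast
  have f: "finite F" "finite G" "finite A0" "finite A1"
    using F(1) G(1) fin sub by (meson finite_subset order_trans)+
  have "(A0 + F) \<inter> (A1 + G) \<subseteq> {a + b}"
  proof
    fix z assume z: "z \<in> (A0 + F) \<inter> (A1 + G)"
    then obtain x y x' y' where "z = x + y" "x \<in> A0" "y \<in> F" "z = x' + y'" "x' \<in> A1" "y' \<in> G"
      unfolding set_plus_def by blast
    then show "z \<in> {a + b}" using le(1)[of x] le(2)[of x'] le(3)[of y] le(4)[of y'] subsetD[OF F(1), of y]
        subsetD[OF G(1), of y'] by auto
  qed
  then have "card ((A0 + F) \<inter> (A1 + G)) \<le> card {a + b}" by (intro card_mono) auto
  moreover have "card (A0 + F) + card (A1 + G) = card ((A0 + F) \<union> (A1 + G)) + card ((A0 + F) \<inter> (A1 + G))"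
    using f by (intro card_Un_Int finite_set_add)
  moreover have "card ((A0 + F) \<union> (A1 + G)) \<le> card (A + (F \<union> G))"
    using f fin sub by (intro card_mono finite_set_add Un_least set_plus_mono2) auto
  ultimately show ?thesis using F G sub card_Un_le[of F G]
    by (intro attainsI[of "F \<union> G"]) auto
qed

section \<open>Almost intervals\<close>

text \<open>The summands are the ranks 1, ..., \<open>card H\<close>. With \<open>H\<close> a set of
  holes, this converts a gain proportional to the rank of a hole into a quadratic gain in the number
  of holes.\<close>

lemma sum_rank:
  fixes H :: "int set"
  assumes "finite H"
  shows "(\<Sum>x\<in>H. real (card {y \<in> H. y \<le> x})) = real (card H) * (real (card H) + 1) / 2"
  using assms
proof (induction rule: finite_linorder_max_induct)
  case empty
  then show ?case by simp
next
  case (insert b H)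
  have b: "b \<notin> H" using insert by auto
  have "{y \<in> insert b H. y \<le> x} = {y \<in> H. y \<le> x}" if "x \<in> H" for x
    using insert(2) that by force
  moreover have "{y \<in> insert b H. y \<le> b} = insert b H" using insert(2) by force
  ultimately have "(\<Sum>x\<in>insert b H. real (card {y \<in> insert b H. y \<le> x}))
      = real (card (insert b H)) + real (card H) * (real (card H) + 1) / 2"
    using insert b by (simp cong: sum.cong)
  also have "\<dots> = real (card (insert b H)) * (real (card (insert b H)) + 1) / 2"
    using insert b by (simp add: field_simps)
  finally show ?case .
qed

text \<open>\<open>h\<close> counts the holes of \<open>B\<close> in \<open>{0..m}\<close>. Below,
  \<open>e\<close> likewise counts the holes of \<open>A\<close> in \<open>{0..<L}\<close>.\<close>

lemma card_Int_ge:
  fixes B :: "int set"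
  assumes "B \<subseteq> {0..m}" "int (card B) = m + 1 - h" "I \<subseteq> {0..m}" "0 \<le> m"
  shows "int (card (B \<inter> I)) \<ge> int (card I) - h"
proof -
  have f: "finite B" "finite I" using assms finite_subset by blast+
  have "card (B \<union> I) + card (B \<inter> I) = card B + card I" using card_Un_Int[OF f] by simp
  moreover have "card (B \<union> I) \<le> card {0..m}" using assms by (intro card_mono) auto
  ultimately show ?thesis using assms(2,4) by simp
qed

lemma cell_miss_le:
  fixes A B :: "int set" and L m e h x :: int
  assumes A: "A \<subseteq> {0..<L}" "int (card A) = L - e" "0 \<le> L"
    and x: "\<And>b. b \<in> C \<Longrightarrow> x - b \<in> {0..<L}"
  shows "int (card {b \<in> C. x - b \<notin> A}) \<le> e"
proof -
  have fA: "finite A" using A(1) finite_subset by blast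
  have "card {b \<in> C. x - b \<notin> A} \<le> card ({0..<L} - A)"
    by (rule card_inj_on_le[where f = "\<lambda>b. x - b"]) (use x in \<open>auto simp: inj_on_def\<close>)
  also have "int (card ({0..<L} - A)) = e"
    using A fA card_mono[OF _ A(1)] by (subst card_Diff_subset) (auto simp: of_nat_diff)
  finally show ?thesis by simp
qed

text \<open>Let i be the number of holes of \<open>A\<close> in \<open>{0..x}\<close>. At least i -
  h elements of the cell hit \<open>x\<close>. For \<open>x < w\<close>, reflect
  \<open>A \<inter> {0..x}\<close> in \<open>x\<close>: by \<open>pre\<close> it has more than i
  elements, and \<open>B\<close> omits at most \<open>h\<close> of the reflected points. For
  \<open>x \<ge> w\<close> the whole cell is available and at most \<open>e\<close> of its elements
  fail, so w - h - e >= i - h of them hit.\<close>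

lemma left_cell_miss_le:
  fixes A B :: "int set" and L m e h w x :: int
  assumes A: "A \<subseteq> {0..<L}" "int (card A) = L - e"
    and B: "B \<subseteq> {0..m}" "int (card B) = m + 1 - h"
    and pre: "\<And>t. 0 \<le> t \<Longrightarrow> t < L \<Longrightarrow> 2 * int (card (A \<inter> {0..t})) > t + 1"
    and w: "0 < w" "2 * e \<le> w" "2 * h \<le> w" "w \<le> m"
    and x: "0 \<le> x" "x < L"
  shows "real (card {b \<in> B \<inter> {0..<w}. x - b \<notin> A}) / real (card (B \<inter> {0..<w}))
    \<le> 1 - (real (card ({0..x} - A)) - real_of_int h) / real_of_int w"
proof -
  define C where "C = B \<inter> {0..<w}"
  define i where "i = int (card ({0..x} - A))"
  have fA: "finite A" using A(1) finite_subset by blast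
  have fC: "finite C" by (simp add: C_def)
  have i_eq: "i + int (card (A \<inter> {0..x})) = x + 1"
  proof -
    have "card ({0..x} - A) + card (A \<inter> {0..x}) = card {0..x}"
    proof -
      have "({0..x} - A) \<union> (A \<inter> {0..x}) = {0..x}" by blast
      then show ?thesis by (subst card_Un_disjoint[symmetric]) auto
    qed
    then show ?thesis using x by (simp add: i_def)
  qed
  have ie: "i \<le> e"
  proof -
    have "card ({0..x} - A) \<le> card ({0..<L} - A)" using x by (intro card_mono) auto
    moreover have "int (card ({0..<L} - A)) = e"
      using A fA x card_mono[OF _ A(1)] by (subst card_Diff_subset) (auto simp: of_nat_diff)
    ultimately show ?thesis by (simp add: i_def)
  qed
  have cC: "w - h \<le> int (card C)"
  proof -
    have "{0..<w} \<subseteq> {0..m}" using w by (intro subsetI) auto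
    then show ?thesis using card_Int_ge[OF B, of "{0..<w}"] w by (auto simp: C_def)
  qed
  have cC2: "int (card C) \<le> w"
    using card_mono[of "{0..<w}" C] w by (auto simp: C_def)
  have split: "card {b \<in> C. x - b \<in> A} + card {b \<in> C. x - b \<notin> A} = card C"
    using fC by (subst card_Un_disjoint[symmetric]) (auto intro: arg_cong[where f = card])
  have hits: "i - h \<le> int (card {b \<in> C. x - b \<in> A})"
  proof (cases "x < w")
    case True
    define I where "I = (\<lambda>a. x - a) ` (A \<inter> {0..x})"
    have "I \<subseteq> {0..m}" using True w by (auto simp: I_def)
    moreover have "card I = card (A \<inter> {0..x})" unfolding I_def by (rule card_image) (auto simp: inj_on_def)
    ultimately have "int (card (A \<inter> {0..x})) - h \<le> int (card (B \<inter> I))"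
      using card_Int_ge[OF B, of I] w by simp
    also have "card (B \<inter> I) \<le> card {b \<in> C. x - b \<in> A}"
      using True w by (intro card_mono finite_subset[OF _ fC]) (auto simp: I_def C_def)
    finally show ?thesis using i_eq pre[of x] x by linarith
  next
    case False
    have "int (card {b \<in> C. x - b \<notin> A}) \<le> e"
      by (rule cell_miss_le[OF A]) (use False x w in \<open>auto simp: C_def\<close>)
    then show ?thesis using split cC ie w by linarith
  qed
  have pos: "real (card C) > 0" using cC w by linarith
  have "real_of_int (i - h) / real_of_int w \<le> real (card {b \<in> C. x - b \<in> A}) / real (card C)"
  proof (cases "i - h \<le> 0")
    case True
    then have "real_of_int (i - h) / real_of_int w \<le> 0" using w by (intro divide_nonpos_pos) auto
    also have "0 \<le> real (card {b \<in> C. x - b \<in> A}) / real (card C)" by simp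
    finally show ?thesis .
  next
    case False
    then show ?thesis using hits cC2 pos w by (intro frac_le) linarith+
  qed
  moreover have "real (card {b \<in> C. x - b \<notin> A}) / real (card C) = 1 - real (card {b \<in> C. x - b \<in> A}) / real (card C)"
    using split pos by (simp add: field_simps flip: of_nat_add)
  ultimately show ?thesis unfolding C_def[symmetric] by (simp add: i_def)
qed

text \<open>For the holes below \<open>v\<close>, the number of holes up to \<open>x\<close> is the
  rank of \<open>x\<close> in \<open>H\<close>; summing the ranks yields the gain |H|^2 /
  (2w).\<close>

lemma left_sum_le:
  fixes A B :: "int set" and L m e h w v :: int
  assumes A: "A \<subseteq> {0..<L}" "int (card A) = L - e"
    and B: "B \<subseteq> {0..m}" "int (card B) = m + 1 - h"
    and pre: "\<And>t. 0 \<le> t \<Longrightarrow> t < L \<Longrightarrow> 2 * int (card (A \<inter> {0..t})) > t + 1"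
    and w: "0 < w" "2 * e \<le> w" "2 * h \<le> w" "w \<le> m" "v \<le> L"
    and H: "H = {0..<v} - A"
  shows "(\<Sum>x\<in>H. real (card {b \<in> B \<inter> {0..<w}. x - b \<notin> A}) / real (card (B \<inter> {0..<w})))
    \<le> real (card H) - ((real (card H))\<^sup>2 / 2 - real_of_int h * real (card H)) / real_of_int w"
proof -
  have fH: "finite H" by (simp add: H)
  have "(\<Sum>x\<in>H. real (card {b \<in> B \<inter> {0..<w}. x - b \<notin> A}) / real (card (B \<inter> {0..<w})))
     \<le> (\<Sum>x\<in>H. 1 - (real (card {y \<in> H. y \<le> x}) - real_of_int h) / real_of_int w)"
  proof (rule sum_mono)
    fix x assume x: "x \<in> H"
    then have "{0..x} - A = {y \<in> H. y \<le> x}" by (auto simp: H)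
    then show "real (card {b \<in> B \<inter> {0..<w}. x - b \<notin> A}) / real (card (B \<inter> {0..<w}))
      \<le> 1 - (real (card {y \<in> H. y \<le> x}) - real_of_int h) / real_of_int w"
      using left_cell_miss_le[OF A B pre w(1-4), of x] x w(5) by (auto simp: H)
  qed
  also have "\<dots> = real (card H) - ((\<Sum>x\<in>H. real (card {y \<in> H. y \<le> x})) - real_of_int h * real (card H)) / real_of_int w"
    by (simp add: sum_subtractf sum_divide_distrib[symmetric] algebra_simps diff_divide_distrib)
  also have "\<dots> \<le> real (card H) - ((real (card H))\<^sup>2 / 2 - real_of_int h * real (card H)) / real_of_int w"
    unfolding sum_rank[OF fH] using w(1)
    by (intro diff_left_mono divide_right_mono) (auto simp: power2_eq_square field_simps)
  finally show ?thesis .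
qed

text \<open>\<open>N\<close> interior points are each missed with probability at most (2e/w)^3, and
  \<open>el\<close>, \<open>er\<close> are the holes near the two ends. The interior costs at most
  16 m e^3 / w^3, which the factor 64 in the last hypothesis turns into e^2 / (4w). With t = el + er
  the ends contribute at most t - t^2 / (4w) + h, which increases for t <= e, and at t = e the
  quadratic gain cancels the interior cost.\<close>

lemma miss_bound_arith:
  fixes N e h w m el er :: real
  assumes "0 < w" "0 \<le> h" "0 \<le> el" "0 \<le> er" "el + er \<le> e" "4 * e \<le> w" "0 \<le> N" "N \<le> 2 * m" "64 * (m + 1) * e \<le> w\<^sup>2"
  shows "N * (2 * e / w) ^ 3 + (el - (el\<^sup>2 / 2 - h * el) / w) + (er - (er\<^sup>2 / 2 - h * er) / w) \<le> e + h"
proof -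
  define t where "t = el + er"
  have t: "0 \<le> t" "t \<le> e" using assms by (auto simp: t_def)
  have "N * (2 * e / w) ^ 3 \<le> (2 * m) * (2 * e / w) ^ 3"
    using assms t by (intro mult_right_mono) auto
  also have "\<dots> = e\<^sup>2 / (4 * w) * (64 * m * e / w\<^sup>2)"
    using assms by (simp add: field_simps power2_eq_square power3_eq_cube)
  also have "\<dots> \<le> e\<^sup>2 / (4 * w) * 1"
    using assms t by (intro mult_left_mono) (auto simp: field_simps)
  finally have 1: "N * (2 * e / w) ^ 3 \<le> e\<^sup>2 / (4 * w)" by simp
  have "t\<^sup>2 / 2 \<le> el\<^sup>2 + er\<^sup>2"
    using zero_le_power2[of "el - er"] by (simp add: t_def power2_eq_square algebra_simps)
  then have "t\<^sup>2 / (4 * w) \<le> (el\<^sup>2 / 2 + er\<^sup>2 / 2) / w"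
    using assms(1) by (simp add: field_simps)
  moreover have "t - t\<^sup>2 / (4 * w) \<le> e - e\<^sup>2 / (4 * w)"
  proof -
    have "(e - t) * (e + t) \<le> (e - t) * (4 * w)" using assms t by (intro mult_left_mono) auto
    then have "(t * (4 * w) - t\<^sup>2) / (4 * w) \<le> (e * (4 * w) - e\<^sup>2) / (4 * w)"
      using assms(1) by (intro divide_right_mono) (auto simp: algebra_simps power2_eq_square)
    then show ?thesis using assms(1) by (simp add: diff_divide_distrib)
  qed
  moreover have "h * t / w \<le> h"
  proof -
    have "h * t \<le> h * w" using assms t by (intro mult_left_mono) auto
    then show ?thesis using assms(1) by (simp add: field_simps)
  qed
  ultimately have "t - ((el\<^sup>2 / 2 + er\<^sup>2 / 2) / w - h * t / w) \<le> e - e\<^sup>2 / (4 * w) + h" by linarith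
  moreover have "(el\<^sup>2 / 2 - h * el) / w + (er\<^sup>2 / 2 - h * er) / w = (el\<^sup>2 / 2 + er\<^sup>2 / 2) / w - h * t / w"
    by (simp add: t_def diff_divide_distrib add_divide_distrib algebra_simps)
  ultimately show ?thesis using 1 unfolding t_def by linarith
qed

lemma prod_le_cube:
  fixes f :: "nat \<Rightarrow> real"
  assumes "\<And>i. i < n \<Longrightarrow> 0 \<le> f i \<and> f i \<le> 1" "j + 2 < n" "\<And>i. i \<in> {j, j+1, j+2} \<Longrightarrow> f i \<le> q" "0 \<le> q"
  shows "prod f {..<n} \<le> q ^ 3"
proof -
  have "prod f {..<n} = prod f ({..<n} - {j, j+1, j+2}) * prod f {j, j+1, j+2}"
    by (rule prod.subset_diff) (use assms in auto)
  also have "\<dots> \<le> 1 * q ^ 3"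
  proof (rule mult_mono)
    show "prod f ({..<n} - {j, j+1, j+2}) \<le> 1" by (rule prod_le_1) (use assms in auto)
    have "prod f {j, j+1, j+2} \<le> prod (\<lambda>_. q) {j, j+1, j+2}"
      by (rule prod_mono) (use assms in auto)
    also have "\<dots> = q ^ 3" by (simp add: power3_eq_cube)
    finally show "prod f {j, j+1, j+2} \<le> q ^ 3" .
    show "0 \<le> prod f {j, j+1, j+2}" by (rule prod_nonneg) (use assms in auto)
  qed auto
  finally show ?thesis by simp
qed

lemma prod_le_factor:
  fixes f :: "nat \<Rightarrow> real"
  assumes "\<And>i. i < n \<Longrightarrow> 0 \<le> f i \<and> f i \<le> 1" "j < n"
  shows "prod f {..<n} \<le> f j"
proof -
  have "prod f {..<n} = f j * prod f ({..<n} - {j})"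
    using assms by (subst prod.remove[of _ j]) auto
  also have "\<dots> \<le> f j * 1" using assms by (intro mult_left_mono prod_le_1) auto
  finally show ?thesis by simp
qed

text \<open>Every hole of \<open>A + {0, m}\<close> near the left end has to be filled by an element of the first cell of
  \<open>B\<close>; the \<open>i\<close>-th such hole is filled with probability at least \<open>(i - h) / w\<close>, because more than half of
  every initial segment lies in \<open>A\<close>. This second-order gain beats the third-order error of the interior, where every sum
  meets three full cells.\<close>

lemma attains_almost_intervals:
  fixes A B :: "int set" and L m e h w :: int
  assumes A: "A \<subseteq> {0..<L}" "int (card A) = L - e"
    and B: "B \<subseteq> {0..m}" "int (card B) = m + 1 - h" "0 \<in> B" "m \<in> B"
    and pre: "\<And>t. 0 \<le> t \<Longrightarrow> t < L \<Longrightarrow> 2 * int (card (A \<inter> {0..t})) > t + 1"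
    and suf: "\<And>t. 0 \<le> t \<Longrightarrow> t < L \<Longrightarrow> 2 * int (card (A \<inter> {t..<L})) > L - t"
    and w: "0 < w" "13 * w \<le> L" "L \<le> m" "2 * h \<le> w" "64 * (m + 1) * e \<le> w\<^sup>2"
  shows "attains (nat ((m + 1) div w) + 3) A B (real_of_int (L + m - e - h))"
proof -
  define k where "k = nat ((m + 1) div w)"
  \<comment> \<open>The cells with index below \<open>k\<close> tile an initial part of
    \<open>{0..m}\<close>; the cell with index \<open>k\<close> is aligned with the right end
    instead, so that the right end mirrors the left, and may overlap the preceding cell.\<close>
  define C where "C i = (if i = k then B \<inter> {m - w<..m} else B \<inter> {int i * w..<int i * w + w})" for i
  \<comment> \<open>The elements 0 and m are always chosen, so near the ends only the points that
    \<open>A\<close> or \<open>A + m\<close> leaves open matter. The margin \<open>4 * w\<close>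
    guarantees every interior point three full cells after rounding up to a cell boundary.\<close>
  define Xl where "Xl = {0..<4 * w} - A"
  define Xr where "Xr = {x \<in> {L + m - 4 * w..<L + m}. x - m \<notin> A}"
  define Xi where "Xi = {4 * w..<L + m - 4 * w}"
  define X where "X = Xi \<union> (Xl \<union> Xr)"
  define H where "H x b \<longleftrightarrow> x - b \<in> A" for x b
  define \<phi> where "\<phi> x i = real (card {b \<in> C i. \<not> H x b}) / real (card (C i))" for x i
  have kw: "int k * w \<le> m + 1" 
  proof -
    have "(m + 1) div w * w + (m + 1) mod w = m + 1" by (rule div_mult_mod_eq)
    moreover have "0 \<le> (m + 1) mod w" using w by simp
    ultimately have "(m + 1) div w * w \<le> m + 1" by linarith
    moreover have "int k = (m + 1) div w" using w by (simp add: k_def pos_imp_zdiv_nonneg_iff)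
    ultimately show ?thesis by simp
  qed
  have fin: "finite A" "finite B" using A(1) B(1) finite_subset by blast+
  have e0: "e \<ge> 0"
    using card_mono[of "{0..<L}" A] A w by auto
  have h0: "h \<ge> 0"
    using card_mono[of "{0..m}" B] B w by auto
  have ew: "4 * e \<le> w"
  proof (rule ccontr)
    assume "\<not> ?thesis"
    then have "w * w < 4 * e * w" using w by (intro mult_strict_right_mono) auto
    also have "\<dots> \<le> 4 * e * (m + 1)" using e0 w by (intro mult_left_mono) auto
    also have "\<dots> \<le> 64 * (m + 1) * e" using e0 w by (simp add: algebra_simps)
    finally show False using w by (simp add: power2_eq_square)
  qed
  have sub_cell: "{int i * w..<int i * w + w} \<subseteq> {0..m}" if "i < k" for i
  proof -
    have "(int i + 1) * w \<le> int k * w" using that w by (intro mult_right_mono) auto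
    moreover have "0 \<le> int i * w" using w by simp
    moreover have "(int i + 1) * w = int i * w + w" by (simp add: algebra_simps)
    ultimately have "0 \<le> int i * w" "int i * w + w \<le> m + 1" using kw by linarith+
    then show ?thesis by (intro subsetI, unfold atLeastLessThan_iff atLeastAtMost_iff) linarith
  qed
  have cell: "C i \<subseteq> B" "w - h \<le> int (card (C i))" if "i < Suc k" for i
  proof -
    show "C i \<subseteq> B" by (auto simp: C_def)
    show "w - h \<le> int (card (C i))"
    proof (cases "i = k")
      case True
      have "{m - w<..m} \<subseteq> {0..m}" using w by (intro subsetI) auto
      then show ?thesis using card_Int_ge[OF B(1,2), of "{m - w<..m}"] w True by (auto simp: C_def)
    next
      case False
      then show ?thesis using card_Int_ge[OF B(1,2), of "{int i * w..<int i * w + w}"] w sub_cell[of i] that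
        by (auto simp: C_def)
    qed
  qed
  have fC: "finite (C i) \<and> C i \<noteq> {}" if "i < Suc k" for i
  proof -
    have "card (C i) \<noteq> 0" using cell(2)[OF that] w by auto
    then show ?thesis by (metis card.empty card.infinite)
  qed
  have fX: "finite Xl" "finite Xr" "finite Xi" "finite X"
    by (auto simp: Xl_def Xi_def X_def Xr_def intro: finite_subset[of _ "{L + m - 4 * w..<L + m}"])
  obtain f where f: "\<forall>i<Suc k. f i \<in> C i"
    "real (card {x \<in> X. \<forall>i<Suc k. \<not> H x (f i)}) \<le> (\<Sum>x\<in>X. \<Prod>i<Suc k. \<phi> x i)"
    using exists_hitting_choice[of "Suc k" C X H] fC fX unfolding \<phi>_def by blast
  have \<phi>01: "0 \<le> \<phi> x i \<and> \<phi> x i \<le> 1" if "i < Suc k" for x i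
    using fC[OF that] card_mono[of "C i" "{b \<in> C i. \<not> H x b}"]
    by (auto simp: \<phi>_def divide_le_eq card_gt_0_iff)
  have Pn: "0 \<le> (\<Prod>i<Suc k. \<phi> x i)" for x
    by (rule prod_nonneg) (use \<phi>01 in auto)
  define q where "q = 2 * real_of_int e / real_of_int w"
  have interior: "(\<Prod>i<Suc k. \<phi> x i) \<le> q ^ 3" if "x \<in> Xi" for x
  proof -
    \<comment> \<open>\<open>l\<close> is the least \<open>b \<ge> 0\<close> with
      \<open>x - b < L\<close>, and \<open>j\<close> is the first cell starting at or after
      \<open>l\<close>. For the cells \<open>j\<close>, \<open>j + 1\<close>, \<open>j + 2\<close>
      all differences \<open>x - b\<close> stay in \<open>{0..<L}\<close>, so each cell fails with
      probability at most e / (w/2).\<close>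
    define l where "l = max 0 (x - L + 1)"
    define j where "j = nat ((l + w - 1) div w)"
    have l0: "l \<ge> 0" by (simp add: l_def)
    have jj: "int j = (l + w - 1) div w" using l0 w by (simp add: j_def pos_imp_zdiv_nonneg_iff)
    have "(l + w - 1) div w * w + (l + w - 1) mod w = l + w - 1" by (rule div_mult_mod_eq)
    moreover have "0 \<le> (l + w - 1) mod w" "(l + w - 1) mod w < w" using w by auto
    ultimately have j: "l \<le> int j * w" "int j * w \<le> l + w - 1" unfolding jj by linarith+
    have x: "4 * w \<le> x" "x < L + m - 4 * w" using that by (auto simp: Xi_def)
    have up: "int j * w + 3 * w \<le> x + 1" "int j * w + 3 * w \<le> m + 1"
      using j x w unfolding l_def by (auto simp: max_def split: if_splits)
    then have "(int j + 3) * w \<le> m + 1" by (simp add: algebra_simps)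
    then have "(int j + 3) * w div w \<le> (m + 1) div w" using w by (intro zdiv_mono1)
    then have "int j + 3 \<le> (m + 1) div w" using w by simp
    then have jk: "j + 3 \<le> k" unfolding k_def by linarith
    have lo: "x - L + 1 \<le> int j * w" using j by (simp add: l_def)
    have "\<phi> x i \<le> q" if "i \<in> {j, j+1, j+2}" for i
    proof -
      have ik: "i < k" "i < Suc k" using that jk by auto
      have b: "int j * w \<le> int i * w" "int i * w + w \<le> int j * w + 3 * w" using that w
        by (auto simp: algebra_simps)
      have "int (card {b \<in> C i. x - b \<notin> A}) \<le> e"
      proof (rule cell_miss_le[OF A])
        fix b' assume "b' \<in> C i"
        then have "int i * w \<le> b'" "b' < int i * w + w" using ik by (auto simp: C_def)
        then show "x - b' \<in> {0..<L}" using b lo up unfolding atLeastLessThan_iff by linarith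
      qed (use w in auto)
      moreover have "real_of_int w / 2 \<le> real (card (C i))"
        using cell(2)[OF ik(2)] w(4) by linarith
      ultimately have "\<phi> x i \<le> real_of_int e / (real_of_int w / 2)"
        unfolding \<phi>_def H_def using w e0 by (intro frac_le) auto
      then show ?thesis by (simp add: q_def mult.commute)
    qed
    then show ?thesis by (intro prod_le_cube[of _ _ j] \<phi>01) (use jk e0 w in \<open>auto simp: q_def\<close>)
  qed
  have kpos: "0 < k"
  proof -
    have "1 * w \<le> m + 1" using w by auto
    then show ?thesis unfolding k_def using w by (simp add: pos_imp_zdiv_pos_iff)
  qed
  have left: "(\<Sum>x\<in>Xl. \<Prod>i<Suc k. \<phi> x i) \<le>
      real (card Xl) - ((real (card Xl))\<^sup>2 / 2 - real_of_int h * real (card Xl)) / real_of_int w"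
  proof -
    have "(\<Sum>x\<in>Xl. \<Prod>i<Suc k. \<phi> x i) \<le> (\<Sum>x\<in>Xl. \<phi> x 0)"
      by (intro sum_mono prod_le_factor \<phi>01) auto
    also have "\<dots> = (\<Sum>x\<in>Xl. real (card {b \<in> B \<inter> {0..<w}. x - b \<notin> A}) / real (card (B \<inter> {0..<w})))"
      using kpos by (simp add: \<phi>_def C_def H_def)
    also have "\<dots> \<le> real (card Xl) - ((real (card Xl))\<^sup>2 / 2 - real_of_int h * real (card Xl)) / real_of_int w"
      by (rule left_sum_le[OF A B(1,2) pre, where v = "4 * w"]) (use w ew e0 in \<open>auto simp: Xl_def\<close>)
    finally show ?thesis .
  qed
  have right: "(\<Sum>x\<in>Xr. \<Prod>i<Suc k. \<phi> x i) \<le>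
      real (card Xr) - ((real (card Xr))\<^sup>2 / 2 - real_of_int h * real (card Xr)) / real_of_int w"
  proof -
    \<comment> \<open>The right end is the left end of the reflected pair; the cell with index
      \<open>k\<close> becomes the first cell and \<open>suf\<close> becomes
      \<open>pre\<close>.\<close>
    define A' where "A' = (\<lambda>x. L - 1 - x) ` A"
    define B' where "B' = (\<lambda>b. m - b) ` B"
    define Y where "Y = {0..<4 * w} - A'"
    have memA: "y \<in> A' \<longleftrightarrow> L - 1 - y \<in> A" for y
      unfolding A'_def image_iff by (metis diff_diff_eq2 add_diff_cancel_left')
    have memB: "y \<in> B' \<longleftrightarrow> m - y \<in> B" for y
      unfolding B'_def image_iff by (metis diff_diff_eq2 add_diff_cancel_left')
    have cA: "card A' = card A" unfolding A'_def by (rule card_image) (auto simp: inj_on_def)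
    have cB: "card B' = card B" unfolding B'_def by (rule card_image) (auto simp: inj_on_def)
    have bij: "bij_betw (\<lambda>x. L + m - 1 - x) Xr Y"
      by (rule bij_betw_byWitness[where f' = "\<lambda>x. L + m - 1 - x"])
        (auto simp: Xr_def Y_def memA algebra_simps)
    have pre': "2 * int (card (A' \<inter> {0..t})) > t + 1" if "0 \<le> t" "t < L" for t
    proof -
      have "card (A' \<inter> {0..t}) = card (A \<inter> {L - 1 - t..<L})"
        by (rule bij_betw_same_card[where f = "\<lambda>x. L - 1 - x"],
            rule bij_betw_byWitness[where f' = "\<lambda>x. L - 1 - x"]) (auto simp: memA)
      then show ?thesis using suf[of "L - 1 - t"] that by simp
    qed
    have "(\<Sum>x\<in>Xr. \<Prod>i<Suc k. \<phi> x i) \<le> (\<Sum>x\<in>Xr. \<phi> x k)"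
      by (intro sum_mono prod_le_factor \<phi>01) auto
    also have "\<dots> = (\<Sum>y\<in>Y. real (card {b \<in> B' \<inter> {0..<w}. y - b \<notin> A'}) / real (card (B' \<inter> {0..<w})))"
    proof -
      have c1: "card (B \<inter> {m - w<..m}) = card (B' \<inter> {0..<w})"
        by (rule bij_betw_same_card[where f = "\<lambda>x. m - x"],
            rule bij_betw_byWitness[where f' = "\<lambda>x. m - x"]) (auto simp: memB)
      have c2: "card {b \<in> B \<inter> {m - w<..m}. x - b \<notin> A}
          = card {b \<in> B' \<inter> {0..<w}. (L + m - 1 - x) - b \<notin> A'}" for x
        by (rule bij_betw_same_card[where f = "\<lambda>x. m - x"],
            rule bij_betw_byWitness[where f' = "\<lambda>x. m - x"]) (auto simp: memB memA algebra_simps)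
      have "(\<Sum>x\<in>Xr. \<phi> x k) = (\<Sum>x\<in>Xr. real (card {b \<in> B' \<inter> {0..<w}. (L + m - 1 - x) - b \<notin> A'})
          / real (card (B' \<inter> {0..<w})))"
        by (simp only: \<phi>_def C_def H_def refl if_True c1 c2)
      also have "\<dots> = (\<Sum>y\<in>Y. real (card {b \<in> B' \<inter> {0..<w}. y - b \<notin> A'}) / real (card (B' \<inter> {0..<w})))"
        by (rule sum.reindex_bij_betw[OF bij])
      finally show ?thesis .
    qed
    also have "\<dots> \<le> real (card Y) - ((real (card Y))\<^sup>2 / 2 - real_of_int h * real (card Y)) / real_of_int w"
    proof (rule left_sum_le[where v = "4 * w" and L = L and m = m and e = e])
      show "A' \<subseteq> {0..<L}" using A(1) by (auto simp: A'_def)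
      show "B' \<subseteq> {0..m}" using B(1) by (auto simp: B'_def)
    qed (use w ew e0 cA cB A B pre' in \<open>auto simp: Y_def\<close>)
    finally show ?thesis using bij_betw_same_card[OF bij] by simp
  qed
  \<comment> \<open>Moved back by \<open>m\<close>, the open points at the right end are holes of
    \<open>A\<close> beyond those in \<open>Xl\<close>, since \<open>L\<close> exceeds
    \<open>8 * w\<close>; so both ends together have at most \<open>e\<close>.\<close>
  have holes: "card Xl + card Xr \<le> nat e"
  proof -
    have "card Xl + card Xr = card Xl + card ((\<lambda>x. x - m) ` Xr)"
      by (simp add: card_image)
    also have "\<dots> = card (Xl \<union> (\<lambda>x. x - m) ` Xr)"
    proof (rule card_Un_disjoint[symmetric])
      show "Xl \<inter> (\<lambda>x. x - m) ` Xr = {}" using w by (auto simp: Xl_def Xr_def)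
    qed (use fX in auto)
    also have "\<dots> \<le> card ({0..<L} - A)"
      using w by (intro card_mono) (auto simp: Xl_def Xr_def)
    also have "\<dots> = nat e"
      using A fin by (subst card_Diff_subset) auto
    finally show ?thesis .
  qed
  have X_disj: "Xi \<inter> (Xl \<union> Xr) = {}" "Xl \<inter> Xr = {}" using w by (auto simp: Xi_def Xl_def Xr_def)
  have "(\<Sum>x\<in>X. \<Prod>i<Suc k. \<phi> x i) = (\<Sum>x\<in>Xi. \<Prod>i<Suc k. \<phi> x i) +
      ((\<Sum>x\<in>Xl. \<Prod>i<Suc k. \<phi> x i) + (\<Sum>x\<in>Xr. \<Prod>i<Suc k. \<phi> x i))"
    unfolding X_def using X_disj fX by (simp add: sum.union_disjoint)
  also have "(\<Sum>x\<in>Xi. \<Prod>i<Suc k. \<phi> x i) \<le> real (card Xi) * q ^ 3"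
    using sum_bounded_above[of Xi "\<lambda>x. \<Prod>i<Suc k. \<phi> x i", OF interior] by simp
  finally have tot: "(\<Sum>x\<in>X. \<Prod>i<Suc k. \<phi> x i) \<le> real (card Xi) * q ^ 3
     + (real (card Xl) - ((real (card Xl))\<^sup>2 / 2 - real_of_int h * real (card Xl)) / real_of_int w)
     + (real (card Xr) - ((real (card Xr))\<^sup>2 / 2 - real_of_int h * real (card Xr)) / real_of_int w)"
    using left right by linarith
  also have "\<dots> \<le> real_of_int e + real_of_int h"
    unfolding q_def
  proof (rule miss_bound_arith[where m = "real_of_int m"])
    show "real (card Xl) + real (card Xr) \<le> real_of_int e" using holes e0 by linarith
    show "real (card Xi) \<le> 2 * real_of_int m" using w by (simp add: Xi_def)
    have "real_of_int (64 * (m + 1) * e) \<le> real_of_int (w\<^sup>2)" using w(5) by (simp only: of_int_le_iff)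
    then show "64 * (real_of_int m + 1) * real_of_int e \<le> (real_of_int w)\<^sup>2" by simp
  qed (use w h0 ew in auto)
  finally have miss: "real (card {x \<in> X. \<forall>i<Suc k. \<not> H x (f i)}) \<le> real_of_int (e + h)"
    using f(2) by simp
  define F where "F = insert 0 (insert m (f ` {..<Suc k}))"
  have FB: "F \<subseteq> B" using f(1) cell(1) B by (auto simp: F_def)
  have cF: "card F \<le> k + 3"
  proof -
    have "card F \<le> Suc (Suc (card (f ` {..<Suc k})))"
      unfolding F_def by (intro order_trans[OF card_insert_le_m1] ) (auto simp: card_insert_if)
    also have "card (f ` {..<Suc k}) \<le> Suc k" using card_image_le[of "{..<Suc k}" f] by simp
    finally show ?thesis by simp
  qed
  have "{0..<L + m} - (A + F) \<subseteq> {x \<in> X. \<forall>i<Suc k. \<not> H x (f i)}"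
  proof
    fix x assume x: "x \<in> {0..<L + m} - (A + F)"
    have no: "x - b \<notin> A" if "b \<in> F" for b
    proof
      assume "x - b \<in> A"
      then have "(x - b) + b \<in> A + F" using that by (intro set_plus_intro) auto
      then show False using x by simp
    qed
    have "x \<notin> A" "x - m \<notin> A" using no[of 0] no[of m] by (auto simp: F_def)
    then have "x \<in> X" using x by (auto simp: X_def Xi_def Xl_def Xr_def)
    moreover have "\<not> H x (f i)" if "i < Suc k" for i using no[of "f i"] that by (auto simp: F_def H_def)
    ultimately show "x \<in> {x \<in> X. \<forall>i<Suc k. \<not> H x (f i)}" by simp
  qed
  then have m1: "card ({0..<L + m} - (A + F)) \<le> card {x \<in> X. \<forall>i<Suc k. \<not> H x (f i)}"
    by (rule card_mono[rotated]) (use fX in auto)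
  have fF: "finite F" by (simp add: F_def)
  have "card {0..<L + m} \<le> card ((A + F) \<union> ({0..<L + m} - (A + F)))"
    by (rule card_mono) (use fin fF finite_set_add in auto)
  also have "\<dots> \<le> card (A + F) + card ({0..<L + m} - (A + F))" by (rule card_Un_le)
  finally have "real_of_int (L + m) \<le> real (card (A + F)) + real_of_int (e + h)"
    using m1 miss w by simp
  then show ?thesis using FB cF by (intro attainsI[of F]) (auto simp: k_def)
qed

section \<open>Elementary cases, rescaling, and extreme parts of a set\<close>

lemma attains_singleton:
  fixes A :: "int set"
  assumes "1 \<le> c"
  shows "attains c A {b} (real (card A))"
  using assms by (intro attainsI[of "{b}"]) (auto simp: card_set_add_singleton)

text \<open>Disposes of bounded \<open>B\<close>, where all of \<open>B\<close> may be chosen. The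
  sums climb a staircase: first \<open>A + Min B\<close>, then \<open>Max A + B\<close>. The summand
  1 in \<open>1 + card B\<close> is the cost of the first step.\<close>

lemma attains_all:
  fixes A B :: "int set"
  assumes "finite A" "A \<noteq> {}" "finite B" "B \<noteq> {}" "1 + card B \<le> c"
  shows "attains c A B (real (card A) + real (card B) - 1)"
proof -
  have "{Max A} + B = B + {Max A}" by (simp add: add.commute)
  then have "attains (card B) {Max A} B (real (card B))"
    by (intro attainsI[of B]) (auto simp: card_set_add_singleton)
  note maxB = this
  have "attains (1 + card B) A B (real (card A) + real (card B) - 1)"
  proof (rule attains_mono[OF attains_stair[OF attains_singleton[of 1 A "Min B"] maxB]])
    show "{Max A} \<subseteq> A" using Max_in[OF assms(1,2)] by blast
    show "{Min B} \<subseteq> B" using Min_in[OF assms(3,4)] by blast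
    show "\<And>x. x \<in> A \<Longrightarrow> x \<le> Max A" by (rule Max_ge[OF assms(1)])
    show "\<And>x. x \<in> B \<Longrightarrow> Min B \<le> x" by (rule Min_le[OF assms(3)])
  qed (use assms in auto)
  then show ?thesis by (rule attains_mono) (use assms in auto)
qed

lemma attains_affine:
  fixes A B :: "int set"
  assumes "attains c A B t" "d \<noteq> 0"
  shows "attains c ((\<lambda>x. s + d * x) ` A) ((\<lambda>x. s' + d * x) ` B) t"
proof -
  obtain F where F: "F \<subseteq> B" "card F \<le> c" "t \<le> real (card (A + F))"
    using assms(1) unfolding attains_def by blast
  have "(\<lambda>x. s + d * x) ` A + (\<lambda>x. s' + d * x) ` F = (\<lambda>x. s + s' + d * x) ` (A + F)"
  proof (intro equalityI subsetI)
    fix z assume "z \<in> (\<lambda>x. s + d * x) ` A + (\<lambda>x. s' + d * x) ` F"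
    then obtain a b where "a \<in> A" "b \<in> F" "z = (s + d * a) + (s' + d * b)"
      unfolding set_plus_def by blast
    then show "z \<in> (\<lambda>x. s + s' + d * x) ` (A + F)"
      by (intro image_eqI[of _ _ "a + b"] set_plus_intro) (auto simp: algebra_simps)
  next
    fix z assume "z \<in> (\<lambda>x. s + s' + d * x) ` (A + F)"
    then obtain a b where "a \<in> A" "b \<in> F" "z = s + s' + d * (a + b)"
      unfolding set_plus_def by blast
    then have "z = (s + d * a) + (s' + d * b)" "a \<in> A" "b \<in> F" by (auto simp: algebra_simps)
    then show "z \<in> (\<lambda>x. s + d * x) ` A + (\<lambda>x. s' + d * x) ` F"
      using set_plus_intro[of "s + d * a" _ "s' + d * b"] by blast
  qed
  moreover have "card ((\<lambda>x. s + s' + d * x) ` (A + F)) = card (A + F)"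
    by (rule card_image) (use assms(2) in \<open>auto simp: inj_on_def\<close>)
  moreover have "card ((\<lambda>x. s' + d * x) ` F) = card F"
    by (rule card_image) (use assms(2) in \<open>auto simp: inj_on_def\<close>)
  ultimately show ?thesis using F by (intro attainsI[of "(\<lambda>x. s' + d * x) ` F"]) auto
qed

lemma exists_initial_part:
  fixes A :: "int set"
  assumes "finite A" "j \<le> card A"
  shows "\<exists>P\<subseteq>A. card P = j \<and> (\<forall>x\<in>P. \<forall>y\<in>A - P. x < y)"
  using assms(2)
proof (induction j)
  case 0
  then show ?case by (intro exI[of _ "{}"]) auto
next
  case (Suc j)
  then obtain P where P: "P \<subseteq> A" "card P = j" "\<forall>x\<in>P. \<forall>y\<in>A - P. x < y" by auto
  have fP: "finite P" using P(1) assms(1) finite_subset by blast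
  define z where "z = Min (A - P)"
  have "A - P \<noteq> {}" using P Suc.prems card_mono[OF fP, of A] by auto
  then have z: "z \<in> A - P" unfolding z_def using assms(1) by (intro Min_in) auto
  have zl: "z \<le> y" if "y \<in> A - P" for y unfolding z_def using assms(1) that by (intro Min_le) auto
  have "\<forall>x\<in>insert z P. \<forall>y\<in>A - insert z P. x < y"
  proof (intro ballI)
    fix x y assume x: "x \<in> insert z P" and y: "y \<in> A - insert z P"
    show "x < y"
    proof (cases "x = z")
      case True
      then show ?thesis using zl[of y] y by fastforce
    next
      case False
      then show ?thesis using P(3) x y by blast
    qed
  qed
  then show ?case using P z fP by (intro exI[of _ "insert z P"]) auto
qed

lemma exists_final_part:
  fixes A :: "int set"
  assumes "finite A" "j \<le> card A"
  shows "\<exists>Q\<subseteq>A. card Q = j \<and> (\<forall>x\<in>Q. \<forall>y\<in>A - Q. y < x)"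
proof -
  obtain P where P: "P \<subseteq> A" "card P = card A - j" "\<forall>x\<in>P. \<forall>y\<in>A - P. x < y"
    using exists_initial_part[OF assms(1), of "card A - j"] by auto
  have "finite P" using P(1) assms(1) finite_subset by blast
  then have "card (A - P) = j" using P assms by (simp add: card_Diff_subset)
  then show ?thesis using P by (intro exI[of _ "A - P"]) auto
qed

section \<open>Windows and near-intervals\<close>

text \<open>Let P and Q be the first and last j elements of \<open>A\<close>, with j about \<theta>
  n / 4. If they are further apart than the diameter of \<open>B\<close>, then P + B and Q + B are
  disjoint and each has at least j + 7n/8 elements within reach; 7n/4 + 2j beats |A| + n because
  2|A| <= n + 1. Otherwise what remains of \<open>A\<close> lies in one window, and at most 2j <=
  \<delta> n elements are lost.\<close>

lemma attains_or_window:
  fixes \<alpha> \<delta> :: real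
  assumes "\<alpha> > 0" "\<delta> > 0"
  obtains c where "\<And>A B :: int set. finite A \<Longrightarrow> A \<noteq> {} \<Longrightarrow> finite B \<Longrightarrow> B \<noteq> {} \<Longrightarrow>
    \<alpha> * (real (card B) - 1) \<le> real (card A) \<Longrightarrow> 2 * card A \<le> card B \<Longrightarrow>
    attains c A B (real (card A) + real (card B) - 1) \<or>
    (\<exists>p. real (card A) - \<delta> * (real (card B) - 1) \<le> real (card (A \<inter> {p..<p + (Max B - Min B)})))"
proof -
  define \<theta> where "\<theta> = min \<alpha> \<delta>"
  have \<theta>: "0 < \<theta>" "\<theta> \<le> \<alpha>" "\<theta> \<le> \<delta>" using assms by (auto simp: \<theta>_def)
  obtain c where c: "\<And>A B :: int set. finite A \<Longrightarrow> finite B \<Longrightarrow> B \<noteq> {} \<Longrightarrow>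
    real (card A) \<ge> \<theta> / 4 * (real (card B) - 1) \<Longrightarrow>
    attains c A B (real (card A) + (1 - 1 / 8) * (real (card B) - 1))"
    using attains_approx[of "\<theta> / 4" "1 / 8"] \<theta> by auto
  \<comment> \<open>\<open>c + c\<close> serves the two ends. The ceiling pays for taking all of
    \<open>B\<close> when \<open>\<theta> * n < 4\<close>; beyond that, rounding \<open>j\<close> up
    still leaves \<open>2 * j \<le> \<theta> * n\<close>.\<close>
  define c' where "c' = c + c + nat \<lceil>4 / \<theta>\<rceil> + 4"
  show thesis
  proof (rule that[of c'])
    fix A B :: "int set"
    assume fin: "finite A" "finite B" and ne: "A \<noteq> {}" "B \<noteq> {}"
      and ge: "\<alpha> * (real (card B) - 1) \<le> real (card A)" and half: "2 * card A \<le> card B"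
    define n where "n = real (card B) - 1"
    define m where "m = Max B - Min B"
    have "card A > 0" using fin ne by (simp add: card_gt_0_iff)
    then have n1: "n \<ge> 1" using half by (simp add: n_def)
    show "attains c' A B (real (card A) + real (card B) - 1) \<or>
      (\<exists>p. real (card A) - \<delta> * (real (card B) - 1) \<le> real (card (A \<inter> {p..<p + (Max B - Min B)})))"
    proof (cases "n < 4 / \<theta>")
      case True
      then have "1 + card B \<le> c'" unfolding c'_def n_def by linarith
      then show ?thesis using attains_all[OF fin(1) ne(1) fin(2) ne(2)] by blast
    next
      case False
      then have big: "\<theta> * n \<ge> 4" using \<theta> by (simp add: field_simps)
      define j where "j = nat \<lceil>\<theta> / 4 * n\<rceil>"
      have j: "real j \<ge> \<theta> / 4 * n" "real j \<le> \<theta> / 4 * n + 1"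
        unfolding j_def using big by linarith+
      have j2: "2 * real j \<le> \<theta> * n" using j big by linarith
      have "\<theta> * n \<le> \<alpha> * n" "\<theta> * n \<le> \<delta> * n" using \<theta> n1 by (auto intro: mult_right_mono)
      then have jA: "2 * real j \<le> real (card A)" and jd: "2 * real j \<le> \<delta> * n"
        using j2 ge by (auto simp: n_def)
      have j0: "j > 0" using j(1) big by (cases j) auto
      obtain P where P: "P \<subseteq> A" "card P = j" "\<forall>x\<in>P. \<forall>y\<in>A - P. x < y"
        using exists_initial_part[OF fin(1), of j] jA by auto
      obtain Q where Q: "Q \<subseteq> A" "card Q = j" "\<forall>x\<in>Q. \<forall>y\<in>A - Q. y < x"
        using exists_final_part[OF fin(1), of j] jA by auto
      have fPQ: "finite P" "finite Q" using P(1) Q(1) fin finite_subset by blast+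
      have nePQ: "P \<noteq> {}" "Q \<noteq> {}" using P(2) Q(2) j0 by auto
      define u where "u = Max P"
      define v where "v = Min Q"
      have u: "u \<in> P" "\<And>x. x \<in> P \<Longrightarrow> x \<le> u" using fPQ nePQ by (auto simp: u_def)
      have v: "v \<in> Q" "\<And>x. x \<in> Q \<Longrightarrow> v \<le> x" using fPQ nePQ by (auto simp: v_def)
      show ?thesis
      proof (cases "m < v - u")
        case True
        have "attains (c + c) A B ((real (card P) + (1 - 1 / 8) * (real (card B) - 1)) +
           (real (card Q) + (1 - 1 / 8) * (real (card B) - 1)))"
        proof (rule attains_union[where A = P and A' = Q and ?B1.0 = B and ?B2.0 = B])
          fix a a' b b' assume "a \<in> P" "a' \<in> Q" "b \<in> B" "b' \<in> B"
          then show "a + b \<noteq> a' + b'"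
            using u(2)[of a] v(2)[of a'] Max_ge[OF fin(2), of b] Min_le[OF fin(2), of b'] True
            unfolding m_def by linarith
        next
          show "attains c P B (real (card P) + (1 - 1 / 8) * (real (card B) - 1))"
            by (rule c[OF fPQ(1) fin(2) ne(2)]) (use P(2) j(1) n_def in simp)
          show "attains c Q B (real (card Q) + (1 - 1 / 8) * (real (card B) - 1))"
            by (rule c[OF fPQ(2) fin(2) ne(2)]) (use Q(2) j(1) n_def in simp)
        qed (fact P(1) Q(1) fin order_refl)+
        moreover have "real (card A) + real (card B) - 1 \<le>
           (real (card P) + (1 - 1 / 8) * (real (card B) - 1)) +
           (real (card Q) + (1 - 1 / 8) * (real (card B) - 1))"
        proof -
          have "2 * real (card A) \<le> n + 1" using half by (simp add: n_def)
          moreover have "real (card B) = n + 1" by (simp add: n_def)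
          ultimately show ?thesis using P(2) Q(2) j0 n1 by (simp add: field_simps)
        qed
        ultimately have "attains c' A B (real (card A) + real (card B) - 1)"
          by (intro attains_mono[where c = "c + c" and c' = c' and A = A and B = B])
            (use fin in \<open>auto simp: c'_def\<close>)
        then show ?thesis ..
      next
        case False
        have "A - (P \<union> Q) \<subseteq> A \<inter> {u..<u + m}"
        proof
          fix x assume x: "x \<in> A - (P \<union> Q)"
          then have "u < x" "x < v" using P(3) Q(3) u(1) v(1) by blast+
          then show "x \<in> A \<inter> {u..<u + m}" using x False by auto
        qed
        then have "card (A - (P \<union> Q)) \<le> card (A \<inter> {u..<u + m})" using fin by (intro card_mono) auto
        moreover have "card A - card (P \<union> Q) \<le> card (A - (P \<union> Q))"
          using fPQ by (intro diff_card_le_card_Diff) auto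
        moreover have "card (P \<union> Q) \<le> j + j" using card_Un_le[of P Q] P Q by simp
        ultimately have "real (card A) - \<delta> * n \<le> real (card (A \<inter> {u..<u + m}))" using jd by linarith
        then show ?thesis unfolding n_def m_def by blast
      qed
    qed
  qed
qed

text \<open>A random element of \<open>B\<close> hits a given \<open>x\<close> with probability at
  least \<gamma>, so k independent ones miss it with probability at most (1 - \<gamma>)^k, which is
  below \<eta> for a k independent of the sets.\<close>

lemma attains_of_many_representations:
  fixes \<eta> \<gamma> :: real
  assumes "\<eta> > 0" "\<gamma> > 0"
  obtains k where "\<And>(A :: int set) B X. finite A \<Longrightarrow> finite B \<Longrightarrow> B \<noteq> {} \<Longrightarrow> finite X \<Longrightarrow>
    (\<And>x. x \<in> X \<Longrightarrow> \<gamma> * real (card B) \<le> real (card {b \<in> B. x - b \<in> A})) \<Longrightarrow>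
    attains k A B ((1 - \<eta>) * real (card X))"
proof -
  define g where "g = min \<gamma> 1"
  have g: "0 < g" "g \<le> 1" "g \<le> \<gamma>" using assms by (auto simp: g_def)
  obtain k where k: "(1 - g) ^ k < \<eta>"
    using real_arch_pow_inv[OF assms(1), of "1 - g"] g by auto
  show thesis
  proof (rule that[of k])
    fix A B X :: "int set"
    assume fin: "finite A" "finite B" "finite X" and ne: "B \<noteq> {}"
      and rep: "\<And>x. x \<in> X \<Longrightarrow> \<gamma> * real (card B) \<le> real (card {b \<in> B. x - b \<in> A})"
    have cB: "real (card B) > 0" using fin ne by (simp add: card_gt_0_iff)
    obtain f where f: "\<forall>i<k. f i \<in> B" "real (card {x \<in> X. \<forall>i<k. \<not> (x - f i \<in> A)})
       \<le> (\<Sum>x\<in>X. \<Prod>i<k. real (card {b \<in> B. \<not> (x - b \<in> A)}) / real (card B))"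
      using exists_hitting_choice[of k "\<lambda>_. B" X "\<lambda>x b. x - b \<in> A"] fin ne by auto
    have "(\<Prod>i<k. real (card {b \<in> B. \<not> (x - b \<in> A)}) / real (card B)) \<le> \<eta>" if "x \<in> X" for x
    proof -
      have "card {b \<in> B. x - b \<in> A} + card {b \<in> B. \<not> (x - b \<in> A)} = card B"
        using fin by (subst card_Un_disjoint[symmetric]) (auto intro: arg_cong[where f = card])
      then have "real (card {b \<in> B. \<not> (x - b \<in> A)}) = real (card B) - real (card {b \<in> B. x - b \<in> A})" by linarith
      moreover have "g * real (card B) \<le> \<gamma> * real (card B)" using g by (intro mult_right_mono) auto
      ultimately have "real (card {b \<in> B. \<not> (x - b \<in> A)}) \<le> (1 - g) * real (card B)"
        using rep[OF that] unfolding left_diff_distrib by linarith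
      then have "real (card {b \<in> B. \<not> (x - b \<in> A)}) / real (card B) \<le> 1 - g"
        using cB by (simp add: pos_divide_le_eq)
      then have "(real (card {b \<in> B. \<not> (x - b \<in> A)}) / real (card B)) ^ k \<le> (1 - g) ^ k"
        by (intro power_mono) auto
      then show ?thesis using k by simp
    qed
    then have "(\<Sum>x\<in>X. \<Prod>i<k. real (card {b \<in> B. \<not> (x - b \<in> A)}) / real (card B)) \<le> real (card X) * \<eta>"
      by (rule sum_bounded_above)
    then have un: "real (card {x \<in> X. \<forall>i<k. \<not> (x - f i \<in> A)}) \<le> real (card X) * \<eta>" using f(2) by linarith
    have "X \<subseteq> (A + f ` {..<k}) \<union> {x \<in> X. \<forall>i<k. \<not> (x - f i \<in> A)}"
    proof
      fix x assume x: "x \<in> X"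
      have "x \<in> A + f ` {..<k}" if "i < k" "x - f i \<in> A" for i
        using set_plus_intro[OF that(2), of "f i" "f ` {..<k}"] that by simp
      then show "x \<in> (A + f ` {..<k}) \<union> {x \<in> X. \<forall>i<k. \<not> (x - f i \<in> A)}" using x by blast
    qed
    then have "card X \<le> card ((A + f ` {..<k}) \<union> {x \<in> X. \<forall>i<k. \<not> (x - f i \<in> A)})"
      using fin by (intro card_mono) (auto intro: finite_set_add)
    also have "\<dots> \<le> card (A + f ` {..<k}) + card {x \<in> X. \<forall>i<k. \<not> (x - f i \<in> A)}" by (rule card_Un_le)
    finally have "(1 - \<eta>) * real (card X) \<le> real (card (A + f ` {..<k}))" using un by (simp add: algebra_simps)
    then show "attains k A B ((1 - \<eta>) * real (card X))"
      using f(1) card_image_le[of "{..<k}" f] by (intro attainsI[of "f ` {..<k}"]) auto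
  qed
qed

text \<open>Inside the window \<open>{p..<p + m}\<close> cut t elements off \<open>A\<close> at
  either end, up to u on the left and from v on the right. Each x in \<open>{u..v + m}\<close> has
  at least t - h representations: the left end serves x < p + m, the right end the other x. So
  nearly all of this interval can be covered by boundedly many elements of \<open>B\<close>. Either
  that suffices, or the interval is short, which makes v - u at most about |A|.\<close>

lemma attains_or_near_interval:
  fixes \<alpha> \<kappa> :: real
  assumes "\<alpha> > 0" "\<kappa> > 0"
  obtains c \<epsilon> where "\<epsilon> > 0" "\<And>(A :: int set) B m. finite A \<Longrightarrow> A \<noteq> {} \<Longrightarrow> B \<subseteq> {0..m} \<Longrightarrow> 0 \<in> B \<Longrightarrow> m \<in> B \<Longrightarrow>
    \<alpha> * real_of_int m \<le> real (card A) \<Longrightarrow> 2 * card A \<le> card B \<Longrightarrow>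
    (1 - \<epsilon>) * real_of_int m \<le> real (card B) - 1 \<Longrightarrow>
    attains c A B (real (card A) + real (card B) - 1) \<or>
    (\<exists>q r. real (card A) - \<kappa> * real_of_int m \<le> real (card (A \<inter> {q..<r})) \<and> q < r \<and>
      real_of_int (r - q) \<le> real (card A) + \<kappa> * real_of_int m)"
proof -
  \<comment> \<open>The losses to be absorbed in \<kappa> m are \<theta> m elements outside the
    window and at most 2 \<theta> m at each end, and 3 \<theta> m in the length of the
    interval.\<close>
  define \<theta> where "\<theta> = min (min \<alpha> \<kappa>) 1 / 8"
  have \<theta>: "0 < \<theta>" "8 * \<theta> \<le> \<alpha>" "8 * \<theta> \<le> \<kappa>" "8 * \<theta> \<le> 1" using assms by (auto simp: \<theta>_def)
  obtain c1 where c1: "\<And>A B :: int set. finite A \<Longrightarrow> A \<noteq> {} \<Longrightarrow> finite B \<Longrightarrow> B \<noteq> {} \<Longrightarrow>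
    \<alpha> * (real (card B) - 1) \<le> real (card A) \<Longrightarrow> 2 * card A \<le> card B \<Longrightarrow>
    attains c1 A B (real (card A) + real (card B) - 1) \<or>
    (\<exists>p. real (card A) - \<theta> * (real (card B) - 1) \<le> real (card (A \<inter> {p..<p + (Max B - Min B)})))"
    using attains_or_window[OF assms(1) \<theta>(1)] by blast
  obtain c2 where c2: "\<And>(A :: int set) B X. finite A \<Longrightarrow> finite B \<Longrightarrow> B \<noteq> {} \<Longrightarrow> finite X \<Longrightarrow>
    (\<And>x. x \<in> X \<Longrightarrow> \<theta> / 4 * real (card B) \<le> real (card {b \<in> B. x - b \<in> A})) \<Longrightarrow>
    attains c2 A B ((1 - \<theta>) * real (card X))"
  proof -
    have "\<theta> / 4 > 0" using \<theta> by simp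
    from attains_of_many_representations[OF \<theta>(1) this] that show thesis by blast
  qed
  define c where "c = c1 + c2 + nat \<lceil>1 / \<theta>\<rceil> + 4"
  show thesis
  \<comment> \<open>With this \<epsilon> the set \<open>B\<close> has at most \<theta> m / 2 holes,
    so at least \<theta> m / 2 of the t representations survive; this is at least
    \<open>\<theta> / 4 * card B\<close> since
    \<open>card B \<le> m + 1 \<le> 2 * m\<close>.\<close>
  proof (rule that[of "\<theta> / 2" c])
    show "\<theta> / 2 > 0" using \<theta> by simp
    fix A B :: "int set" and m :: int
    assume fA: "finite A" "A \<noteq> {}" and B: "B \<subseteq> {0..m}" "0 \<in> B" "m \<in> B"
      and ge: "\<alpha> * real_of_int m \<le> real (card A)" and half: "2 * card A \<le> card B"
      and full: "(1 - \<theta> / 2) * real_of_int m \<le> real (card B) - 1"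
    have fB: "finite B" "B \<noteq> {}" using B finite_subset by blast+
    have cA: "card A > 0" using fA by (simp add: card_gt_0_iff)
    have m0: "m \<ge> 0" using B by auto
    have cB: "real (card B) \<le> real_of_int m + 1" using card_mono[OF _ B(1)] m0 by simp
    have m1: "m \<ge> 1" using cB half cA by linarith
    have "Max B = m" "Min B = 0" using B fB by (auto intro!: Max_eqI Min_eqI)
    then have MM: "Max B - Min B = m" by simp
    have geB: "\<alpha> * (real (card B) - 1) \<le> real (card A)"
      using mult_left_mono[of "real (card B) - 1" "real_of_int m" \<alpha>] cB ge assms by linarith
    define goal where "goal \<longleftrightarrow> attains c A B (real (card A) + real (card B) - 1) \<or>
     (\<exists>q r. real (card A) - \<kappa> * real_of_int m \<le> real (card (A \<inter> {q..<r})) \<and> q < r \<and>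
      real_of_int (r - q) \<le> real (card A) + \<kappa> * real_of_int m)"
    have goal
    proof (cases "real_of_int m < 1 / \<theta>")
      case True
      then have "1 + card B \<le> c" unfolding c_def using cB by linarith
      then show ?thesis using attains_all[OF fA fB] unfolding goal_def by blast
    next
      case False
      then have big: "\<theta> * real_of_int m \<ge> 1" using \<theta> by (simp add: field_simps)
      consider "attains c1 A B (real (card A) + real (card B) - 1)"
        | p where "real (card A) - \<theta> * (real (card B) - 1) \<le> real (card (A \<inter> {p..<p + m}))"
        using c1[OF fA fB geB half] unfolding MM by blast
      then show ?thesis
      proof cases
        case 1
        then have "attains c A B (real (card A) + real (card B) - 1)"
          by (rule attains_mono) (use fA fB in \<open>auto simp: c_def\<close>)
        then show ?thesis unfolding goal_def by blast
      next
        case 2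
        define A1 where "A1 = A \<inter> {p..<p + m}"
        define t where "t = nat \<lceil>\<theta> * real_of_int m\<rceil>"
        have t: "real t \<ge> \<theta> * real_of_int m" "real t \<le> 2 * \<theta> * real_of_int m"
          unfolding t_def using big by linarith+
        have "\<theta> * (real (card B) - 1) \<le> \<theta> * real_of_int m" using cB \<theta> by (intro mult_left_mono) auto
        then have A1: "real (card A) - \<theta> * real_of_int m \<le> real (card A1)" using 2 unfolding A1_def by linarith
        have "8 * \<theta> * real_of_int m \<le> \<alpha> * real_of_int m" using \<theta> m1 by (intro mult_right_mono) auto
        then have tA1: "t \<le> card A1" using A1 t ge big by linarith
        have fA1: "finite A1" using fA by (simp add: A1_def)
        have t0: "t > 0" using t(1) big by (cases t) auto
        obtain P where P: "P \<subseteq> A1" "card P = t" "\<forall>x\<in>P. \<forall>y\<in>A1 - P. x < y"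
          using exists_initial_part[OF fA1 tA1] by auto
        obtain Q where Q: "Q \<subseteq> A1" "card Q = t" "\<forall>x\<in>Q. \<forall>y\<in>A1 - Q. y < x"
          using exists_final_part[OF fA1 tA1] by auto
        have fPQ: "finite P" "finite Q" using P(1) Q(1) fA1 finite_subset by blast+
        have nePQ: "P \<noteq> {}" "Q \<noteq> {}" using P(2) Q(2) t0 by auto
        define u where "u = Max P"
        define v where "v = Min Q"
        have u: "u \<in> P" "\<And>x. x \<in> P \<Longrightarrow> x \<le> u" using fPQ nePQ by (auto simp: u_def)
        have v: "v \<in> Q" "\<And>x. x \<in> Q \<Longrightarrow> v \<le> x" using fPQ nePQ by (auto simp: v_def)
        have mid: "real (card A1) - 2 * real t + 2 \<le> real (card (A \<inter> {u..v}))" and uv: "u < v"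
        proof -
          have sub: "insert u (insert v (A1 - (P \<union> Q))) \<subseteq> A \<inter> {u..v}" if "u \<le> v"
          proof
            fix x assume "x \<in> insert u (insert v (A1 - (P \<union> Q)))"
            then consider "x = u" | "x = v" | "x \<in> A1" "u < x" "x < v" using P(3) Q(3) u(1) v(1) by blast
            then show "x \<in> A \<inter> {u..v}" using that P(1) Q(1) u(1) v(1) by cases (auto simp: A1_def)
          qed
          have c1': "card A1 \<le> card (A1 - (P \<union> Q)) + (t + t)"
            using diff_card_le_card_Diff[of "P \<union> Q" A1] fPQ card_Un_le[of P Q] P(2) Q(2) by simp
          have "8 * \<theta> * real_of_int m \<le> real (card A)"
            using \<open>8 * \<theta> * real_of_int m \<le> \<alpha> * real_of_int m\<close> ge by linarith
          then have "card (A1 - (P \<union> Q)) \<noteq> 0" using c1' A1 t big by linarith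
          then obtain x where "x \<in> A1 - (P \<union> Q)" by (metis card.empty ex_in_conv)
          then have "u < x" "x < v" using P(3) Q(3) u(1) v(1) by blast+
          then show uv: "u < v" by simp
          have "u \<in> P \<union> Q" "v \<in> P \<union> Q" using u v by auto
          then have "card (insert u (insert v (A1 - (P \<union> Q)))) = card (A1 - (P \<union> Q)) + 2"
            using fA1 uv by simp
          moreover have "card (insert u (insert v (A1 - (P \<union> Q)))) \<le> card (A \<inter> {u..v})"
            using sub uv fA by (intro card_mono) auto
          ultimately show "real (card A1) - 2 * real t + 2 \<le> real (card (A \<inter> {u..v}))" using c1' by linarith
        qed
        define h where "h = m + 1 - int (card B)"
        have h: "int (card B) = m + 1 - h" by (simp add: h_def)
        have hle: "real_of_int h \<le> \<theta> / 2 * real_of_int m" using full by (simp add: h_def algebra_simps)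
        have rep: "\<theta> / 4 * real (card B) \<le> real (card {b \<in> B. x - b \<in> A})" if x: "x \<in> {u..v + m}" for x
        proof -
          obtain R where R: "R \<subseteq> A1" "card R = t" "\<And>a. a \<in> R \<Longrightarrow> x - a \<in> {0..m}"
          proof (cases "x < p + m")
            case True
            have "x - a \<in> {0..m}" if "a \<in> P" for a
              using u(2)[OF that] x True P(1) that by (auto simp: A1_def)
            then show ?thesis using that[of P] P by auto
          next
            case False
            have "x - a \<in> {0..m}" if "a \<in> Q" for a
              using v(2)[OF that] x False Q(1) that by (auto simp: A1_def)
            then show ?thesis using that[of Q] Q by auto
          qed
          have "int (card ((\<lambda>a. x - a) ` R)) - h \<le> int (card (B \<inter> (\<lambda>a. x - a) ` R))"
            by (rule card_Int_ge[OF B(1) h]) (use R m0 in auto)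
          also have "card ((\<lambda>a. x - a) ` R) = t"
            using R by (subst card_image) (auto simp: inj_on_def)
          also have "card (B \<inter> (\<lambda>a. x - a) ` R) \<le> card {b \<in> B. x - b \<in> A}"
            using R(1) fB by (intro card_mono) (auto simp: A1_def)
          finally have "real t - real_of_int h \<le> real (card {b \<in> B. x - b \<in> A})" by linarith
          moreover have "\<theta> / 4 * real (card B) \<le> \<theta> / 4 * (2 * real_of_int m)"
            using cB m1 \<theta> by (intro mult_left_mono) auto
          ultimately show ?thesis using hle t(1) by linarith
        qed
        have at: "attains c2 A B ((1 - \<theta>) * real (card {u..v + m}))"
          by (rule c2[OF fA(1) fB]) (use rep in auto)
        have cX: "real (card {u..v + m}) = real_of_int (v - u) + real_of_int m + 1"
          using uv m0 by simp
        have "u \<in> A1" "v \<in> A1" using u(1) v(1) P(1) Q(1) by blast+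
        then have vm: "v - u \<le> m" by (auto simp: A1_def)
        show ?thesis
        proof (cases "real (card A) + real (card B) - 1 \<le> (1 - \<theta>) * real (card {u..v + m})")
          case True
          have "attains c A B (real (card A) + real (card B) - 1)"
            by (rule attains_mono[OF at _ True]) (use fA fB in \<open>auto simp: c_def\<close>)
          then show ?thesis unfolding goal_def by blast
        next
          case False
          have "\<theta> * real (card {u..v + m}) \<le> \<theta> * (3 * real_of_int m)"
            unfolding cX using vm m1 \<theta> by (intro mult_left_mono) auto
          moreover have "real (card {u..v + m}) < real (card A) + real (card B) - 1 + \<theta> * real (card {u..v + m})"
            using False by (simp add: algebra_simps)
          moreover have "8 * \<theta> * real_of_int m \<le> \<kappa> * real_of_int m" using \<theta> m1 by (intro mult_right_mono) auto
          ultimately have len: "real_of_int (v + 1 - u) \<le> real (card A) + \<kappa> * real_of_int m"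
            using cB cX big by (auto simp: algebra_simps)
          have "real (card A) - \<kappa> * real_of_int m \<le> real (card (A \<inter> {u..v}))"
            using mid A1 t(2) \<open>8 * \<theta> * real_of_int m \<le> \<kappa> * real_of_int m\<close> big by linarith
          moreover have "{u..v} = {u..<v + 1}" by auto
          ultimately show ?thesis using len uv unfolding goal_def
            by (intro disjI2 exI[of _ u] exI[of _ "v + 1"]) auto
        qed
      qed
    qed
    then show "attains c A B (real (card A) + real (card B) - 1) \<or>
     (\<exists>q r. real (card A) - \<kappa> * real_of_int m \<le> real (card (A \<inter> {q..<r})) \<and> q < r \<and>
      real_of_int (r - q) \<le> real (card A) + \<kappa> * real_of_int m)" unfolding goal_def .
  qed
qed

text \<open>Take the last \<open>p\<close> for which \<open>{q..<p}\<close> is at most half filled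
  by \<open>A\<close>. A later prefix starting at \<open>p\<close> that is at most half filled would
  give a later such point, and \<open>p - q\<close> is at most twice the number of holes before
  \<open>p\<close>.\<close>

lemma exists_dense_prefixes:
  fixes A :: "int set"
  assumes "q \<le> r"
  shows "\<exists>p. q \<le> p \<and> p \<le> r \<and> p - q \<le> 2 * int (card ({q..<r} - A)) \<and>
    (\<forall>t. p \<le> t \<longrightarrow> t < r \<longrightarrow> 2 * int (card (A \<inter> {p..t})) > t + 1 - p)"
proof -
  define S where "S = {p \<in> {q..r}. 2 * int (card (A \<inter> {q..<p})) \<le> p - q}"
  define p where "p = Max S"
  have fS: "finite S" by (rule finite_subset[of _ "{q..r}"]) (auto simp: S_def)
  have "q \<in> S" using assms by (simp add: S_def)
  then have pS: "p \<in> S" unfolding p_def using fS by (intro Max_in) auto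
  have pm: "x \<le> p" if "x \<in> S" for x unfolding p_def using fS that by simp
  have p: "q \<le> p" "p \<le> r" "2 * int (card (A \<inter> {q..<p})) \<le> p - q" using pS by (auto simp: S_def)
  have cs: "int (card ({q..<p} - A)) + int (card (A \<inter> {q..<p})) = p - q"
  proof -
    have "({q..<p} - A) \<union> (A \<inter> {q..<p}) = {q..<p}" by blast
    then have "card ({q..<p} - A) + card (A \<inter> {q..<p}) = card {q..<p}"
      by (subst card_Un_disjoint[symmetric]) auto
    then show ?thesis using p by simp
  qed
  have "card ({q..<p} - A) \<le> card ({q..<r} - A)" using p by (intro card_mono) auto
  then have len: "p - q \<le> 2 * int (card ({q..<r} - A))" using cs p by linarith
  have "2 * int (card (A \<inter> {p..t})) > t + 1 - p" if t: "p \<le> t" "t < r" for t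
  proof -
    have "t + 1 \<notin> S" using pm[of "t + 1"] t by auto
    then have "2 * int (card (A \<inter> {q..<t + 1})) > t + 1 - q" using t p by (auto simp: S_def)
    moreover have "card (A \<inter> {q..<t + 1}) = card (A \<inter> {q..<p}) + card (A \<inter> {p..t})"
      using t p by (subst card_Un_disjoint[symmetric]) (auto intro!: arg_cong[where f = card])
    ultimately show ?thesis using p by simp
  qed
  then show ?thesis using p len by blast
qed

text \<open>Trim on the left first, then trim the remainder on the right by reflection. Trimming on
  the right does not disturb the prefixes already made dense. Each trimming costs at most
  \<open>2 * e\<close> in length.\<close>

lemma exists_dense_interval:
  fixes A :: "int set"
  assumes "q \<le> r"
  defines "e \<equiv> int (card ({q..<r} - A))"
  shows "\<exists>p s. q \<le> p \<and> p \<le> s \<and> s \<le> r \<and> r - q \<le> s - p + 4 * e \<and>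
    (\<forall>t. p \<le> t \<longrightarrow> t < s \<longrightarrow> 2 * int (card (A \<inter> {p..t})) > t + 1 - p) \<and>
    (\<forall>t. p \<le> t \<longrightarrow> t < s \<longrightarrow> 2 * int (card (A \<inter> {t..<s})) > s - t)"
proof -
  obtain p where p: "q \<le> p" "p \<le> r" "p - q \<le> 2 * e"
    "\<And>t. p \<le> t \<Longrightarrow> t < r \<Longrightarrow> 2 * int (card (A \<inter> {p..t})) > t + 1 - p"
    using exists_dense_prefixes[OF assms(1), of A] unfolding e_def by blast
  have img: "uminus ` (X :: int set) = {x. - x \<in> X}" for X by force
  have cimg: "card {x. - x \<in> X} = card X" for X :: "int set"
    unfolding img[symmetric] by (rule card_image) simp
  define A' where "A' = {x. - x \<in> A}"
  obtain s' where s': "1 - r \<le> s'" "s' \<le> 1 - p" "s' - (1 - r) \<le> 2 * int (card ({1 - r..<1 - p} - A'))"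
    "\<And>t. s' \<le> t \<Longrightarrow> t < 1 - p \<Longrightarrow> 2 * int (card (A' \<inter> {s'..t})) > t + 1 - s'"
    using exists_dense_prefixes[of "1 - r" "1 - p" A'] p by auto
  define s where "s = 1 - s'"
  have "card ({1 - r..<1 - p} - A') = card {x. - x \<in> {p..<r} - A}"
    by (rule arg_cong[where f = card]) (auto simp: A'_def)
  also have "\<dots> = card ({p..<r} - A)" by (rule cimg)
  also have "\<dots> \<le> card ({q..<r} - A)" using p by (intro card_mono) auto
  finally have "r - s \<le> 2 * e" using s'(3) by (simp add: s_def e_def)
  moreover have "2 * int (card (A \<inter> {t..<s})) > s - t" if "p \<le> t" "t < s" for t
  proof -
    have "A' \<inter> {s'..- t} = {x. - x \<in> A \<inter> {t..<s}}" by (auto simp: A'_def s_def)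
    then have "card (A' \<inter> {s'..- t}) = card (A \<inter> {t..<s})" using cimg by metis
    then show ?thesis using s'(4)[of "- t"] that by (simp add: s_def)
  qed
  ultimately show ?thesis using p s'(1,2)
    by (intro exI[of _ p] exI[of _ s]) (auto simp: s_def)
qed

text \<open>Trim the near-interval containing most of \<open>A\<close> to one whose prefixes and
  suffixes are dense and apply the cell argument there. The remaining elements of \<open>A\<close>
  keep their exact number: those to the left are added to 0, those to the right to \<open>m\<close>,
  and these sums lie outside the sums already counted.\<close>

lemma attains_of_nearly_full:
  fixes \<alpha> :: real
  assumes "\<alpha> > 0"
  obtains c \<epsilon> where "\<epsilon> > 0" "\<And>(A :: int set) B m. finite A \<Longrightarrow> A \<noteq> {} \<Longrightarrow> B \<subseteq> {0..m} \<Longrightarrow> 0 \<in> B \<Longrightarrow> m \<in> B \<Longrightarrow>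
    \<alpha> * real_of_int m \<le> real (card A) \<Longrightarrow> 2 * card A \<le> card B \<Longrightarrow>
    (1 - \<epsilon>) * real_of_int m \<le> real (card B) - 1 \<Longrightarrow>
    attains c A B (real (card A) + real (card B) - 1)"
proof -
  \<comment> \<open>Cells have length w = floor(\<beta> m). The factor 52 = 4 * 13 leaves ample room
    for the condition \<open>13 * w \<le> L\<close>. The choice of \<kappa> makes e <= 2 \<kappa> m
    imply 64 (m + 1) e <= 256 \<kappa> m^2 = (\<beta> m / 2)^2 <= w^2.\<close>
  define \<beta> where "\<beta> = min \<alpha> 1 / 52"
  define \<kappa> where "\<kappa> = \<beta>\<^sup>2 / 1024"
  have \<beta>: "0 < \<beta>" "52 * \<beta> \<le> \<alpha>" "52 * \<beta> \<le> 1" using assms by (auto simp: \<beta>_def)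
  have \<kappa>: "0 < \<kappa>" "\<kappa> \<le> \<beta> / 1024"
  proof -
    show "0 < \<kappa>" using \<beta> by (simp add: \<kappa>_def)
    have "\<beta> * \<beta> \<le> \<beta> * 1" using \<beta> by (intro mult_left_mono) auto
    then show "\<kappa> \<le> \<beta> / 1024" by (simp add: \<kappa>_def power2_eq_square)
  qed
  obtain c1 \<epsilon>1 where e1: "\<epsilon>1 > 0" and c1: "\<And>(A :: int set) B m. finite A \<Longrightarrow> A \<noteq> {} \<Longrightarrow> B \<subseteq> {0..m} \<Longrightarrow> 0 \<in> B \<Longrightarrow> m \<in> B \<Longrightarrow>
    \<alpha> * real_of_int m \<le> real (card A) \<Longrightarrow> 2 * card A \<le> card B \<Longrightarrow>
    (1 - \<epsilon>1) * real_of_int m \<le> real (card B) - 1 \<Longrightarrow>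
    attains c1 A B (real (card A) + real (card B) - 1) \<or>
    (\<exists>q r. real (card A) - \<kappa> * real_of_int m \<le> real (card (A \<inter> {q..<r})) \<and> q < r \<and>
      real_of_int (r - q) \<le> real (card A) + \<kappa> * real_of_int m)"
    by (rule attains_or_near_interval[OF assms \<kappa>(1)]) (rule that)
  \<comment> \<open>\<beta> / 4 bounds the holes of \<open>B\<close> so that
    \<open>2 * h \<le> w\<close>. In \<open>c\<close>, the number of cells is at most 2m / (\<beta>
    m / 2) = 4 / \<beta>; further elements are the 3 of the cell argument and one each for the parts
    of \<open>A\<close> on either side.\<close>
  define \<epsilon> where "\<epsilon> = min \<epsilon>1 (\<beta> / 4)"
  define c where "c = c1 + nat \<lceil>4 / \<beta>\<rceil> + 8"
  show thesis
  proof (rule that[of \<epsilon> c])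
    show "\<epsilon> > 0" using e1 \<beta> by (simp add: \<epsilon>_def)
    fix A B :: "int set" and m :: int
    assume fA: "finite A" "A \<noteq> {}" and B: "B \<subseteq> {0..m}" "0 \<in> B" "m \<in> B"
      and ge: "\<alpha> * real_of_int m \<le> real (card A)" and half: "2 * card A \<le> card B"
      and full: "(1 - \<epsilon>) * real_of_int m \<le> real (card B) - 1"
    have fB: "finite B" "B \<noteq> {}" using B finite_subset by blast+
    have cA: "card A > 0" using fA by (simp add: card_gt_0_iff)
    have m0: "m \<ge> 0" using B by auto
    have cB: "int (card B) \<le> m + 1" using card_mono[OF _ B(1)] m0 by simp
    have m1: "m \<ge> 1" using cB half cA by linarith
    have "\<epsilon> * real_of_int m \<le> \<epsilon>1 * real_of_int m" "\<epsilon> * real_of_int m \<le> \<beta> / 4 * real_of_int m"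
      using m1 by (auto intro!: mult_right_mono simp: \<epsilon>_def)
    then have full1: "(1 - \<epsilon>1) * real_of_int m \<le> real (card B) - 1"
      and full2: "real_of_int m - \<beta> / 4 * real_of_int m \<le> real (card B) - 1"
      using full unfolding left_diff_distrib by linarith+
    show "attains c A B (real (card A) + real (card B) - 1)"
    proof (cases "real_of_int m < 2 / \<beta>")
      case True
      moreover have "2 / \<beta> \<le> 4 / \<beta>" using \<beta> by (simp add: field_simps)
      ultimately have "1 + card B \<le> c" unfolding c_def using cB by linarith
      then show ?thesis using attains_all[OF fA fB] by blast
    next
      case False
      then have big: "\<beta> * real_of_int m \<ge> 2" using \<beta> by (simp add: field_simps)
      consider "attains c1 A B (real (card A) + real (card B) - 1)"
        | q r where "real (card A) - \<kappa> * real_of_int m \<le> real (card (A \<inter> {q..<r}))" "q < r"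
          "real_of_int (r - q) \<le> real (card A) + \<kappa> * real_of_int m"
        using c1[OF fA B ge half full1] by blast
      then show ?thesis
      proof cases
        case 1
        then show ?thesis by (rule attains_mono) (use fA fB in \<open>auto simp: c_def\<close>)
      next
        case 2
        define e0 where "e0 = int (card ({q..<r} - A))"
        have e0_eq: "e0 + int (card (A \<inter> {q..<r})) = r - q"
        proof -
          have "({q..<r} - A) \<union> (A \<inter> {q..<r}) = {q..<r}" by blast
          then have "card ({q..<r} - A) + card (A \<inter> {q..<r}) = card {q..<r}"
            by (subst card_Un_disjoint[symmetric]) auto
          then show ?thesis using 2(2) by (simp add: e0_def)
        qed
        have e0: "real_of_int e0 \<le> 2 * \<kappa> * real_of_int m"
          using e0_eq 2(1,3) by linarith
        obtain p s where ps: "q \<le> p" "p \<le> s" "s \<le> r" "r - q \<le> s - p + 4 * e0"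
          "\<And>t. p \<le> t \<Longrightarrow> t < s \<Longrightarrow> 2 * int (card (A \<inter> {p..t})) > t + 1 - p"
          "\<And>t. p \<le> t \<Longrightarrow> t < s \<Longrightarrow> 2 * int (card (A \<inter> {t..<s})) > s - t"
          using exists_dense_interval[OF less_imp_le[OF 2(2)], of A] unfolding e0_def by blast
        have ps4: "real_of_int (r - q) \<le> real_of_int (s - p + 4 * e0)"
          using ps(4) by (simp only: of_int_le_iff)
        define L where "L = s - p"
        define A1 where "A1 = A \<inter> {p..<s}"
        define A2 where "A2 = (\<lambda>x. - p + 1 * x) ` A1"
        define e where "e = int (card ({p..<s} - A))"
        define h where "h = m + 1 - int (card B)"
        define w where "w = \<lfloor>\<beta> * real_of_int m\<rfloor>"
        have "card ({p..<s} - A) \<le> card ({q..<r} - A)" using ps by (intro card_mono) auto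
        then have ee0: "e \<le> e0" by (simp add: e_def e0_def)
        have cA1: "int (card A1) = L - e"
        proof -
          have "({p..<s} - A) \<union> (A \<inter> {p..<s}) = {p..<s}" by blast
          then have "card ({p..<s} - A) + card (A \<inter> {p..<s}) = card {p..<s}"
            by (subst card_Un_disjoint[symmetric]) auto
          then show ?thesis using ps(2) by (simp add: e_def A1_def L_def)
        qed
        have cA2: "card A2 = card A1" unfolding A2_def by (rule card_image) (auto simp: inj_on_def)
        have w: "real_of_int w \<le> \<beta> * real_of_int m" "\<beta> * real_of_int m \<le> 2 * real_of_int w"
          unfolding w_def using big by linarith+
        have \<kappa>m: "\<kappa> * real_of_int m \<le> \<beta> / 1024 * real_of_int m" using \<kappa> m1 by (intro mult_right_mono) auto
        have \<beta>m: "52 * \<beta> * real_of_int m \<le> \<alpha> * real_of_int m" "52 * \<beta> * real_of_int m \<le> 1 * real_of_int m"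
          using \<beta> m1 by (intro mult_right_mono; simp)+
        have rq: "52 * \<beta> * real_of_int m - \<kappa> * real_of_int m \<le> real_of_int (r - q)"
          using 2(1) e0_eq \<beta>m(1) ge unfolding e0_def by linarith
        have at: "attains (nat ((m + 1) div w) + 3) A2 B (real_of_int (L + m - e - h))"
        proof (rule attains_almost_intervals)
          show "A2 \<subseteq> {0..<L}" by (auto simp: A2_def A1_def L_def)
          show "int (card A2) = L - e" using cA1 cA2 by simp
          show "int (card B) = m + 1 - h" by (simp add: h_def)
          show "2 * int (card (A2 \<inter> {0..t})) > t + 1" if "0 \<le> t" "t < L" for t
          proof -
            have "A2 \<inter> {0..t} = (\<lambda>x. - p + 1 * x) ` (A \<inter> {p..p + t})"
              using that by (auto simp: A2_def A1_def L_def)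
            then have "card (A2 \<inter> {0..t}) = card (A \<inter> {p..p + t})"
              by (simp add: card_image inj_on_def)
            then show ?thesis using ps(5)[of "p + t"] that by (simp add: L_def)
          qed
          show "2 * int (card (A2 \<inter> {t..<L})) > L - t" if "0 \<le> t" "t < L" for t
          proof -
            have "A2 \<inter> {t..<L} = (\<lambda>x. - p + 1 * x) ` (A \<inter> {p + t..<s})"
              using that by (auto simp: A2_def A1_def L_def)
            then have "card (A2 \<inter> {t..<L}) = card (A \<inter> {p + t..<s})"
              by (simp add: card_image inj_on_def)
            then show ?thesis using ps(6)[of "p + t"] that by (simp add: L_def)
          qed
          show "0 < w" using w(2) big by linarith
          have "real_of_int (13 * w) \<le> real_of_int L"
            using w(1) rq ps4 e0 \<kappa>m big by (simp add: L_def)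
          then show "13 * w \<le> L" by simp
          have "2 * real (card A) \<le> real_of_int m + 1" using half cB by linarith
          moreover have "real_of_int L \<le> real_of_int (r - q)" using ps(1-3) by (simp add: L_def)
          ultimately have "real_of_int L \<le> real_of_int m"
            using 2(3) \<kappa>m \<beta>m(2) big by linarith
          then show "L \<le> m" by simp
          have "real_of_int (2 * h) \<le> real_of_int w" using full2 w(2) by (simp add: h_def)
          then show "2 * h \<le> w" by simp
          have "64 * (real_of_int m + 1) * real_of_int e \<le> 64 * (2 * real_of_int m) * (2 * \<kappa> * real_of_int m)"
            using m1 ee0 e0 \<kappa> by (intro mult_mono) (auto simp: e_def)
          also have "\<dots> = (\<beta> * real_of_int m / 2)\<^sup>2" by (simp add: \<kappa>_def power2_eq_square)
          also have "\<dots> \<le> (real_of_int w)\<^sup>2" using w(2) big by (intro power_mono) auto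
          finally have "real_of_int (64 * (m + 1) * e) \<le> real_of_int (w\<^sup>2)" by simp
          then show "64 * (m + 1) * e \<le> w\<^sup>2" by (simp only: of_int_le_iff)
        qed (use B in auto)
        have "(\<lambda>x. p + 1 * x) ` A2 = A1" "(\<lambda>x. 0 + 1 * x) ` B = B" by (auto simp: A2_def image_image)
        then have at1: "attains (nat ((m + 1) div w) + 3) A1 B (real_of_int (L + m - e - h))"
          using attains_affine[OF at, of 1 p 0] by simp
        have w0: "0 < w" using w(2) big by linarith
        have "(m + 1) div w * w + (m + 1) mod w = m + 1" by (rule div_mult_mod_eq)
        moreover have "0 \<le> (m + 1) mod w" using w0 by simp
        ultimately have "(m + 1) div w * w \<le> m + 1" by linarith
        then have "real_of_int ((m + 1) div w * w) \<le> real_of_int (m + 1)" by (simp only: of_int_le_iff)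
        then have "real_of_int ((m + 1) div w) * real_of_int w \<le> 2 * real_of_int m" using m1 by simp
        moreover have "0 \<le> (m + 1) div w" using w0 m1 by (simp add: pos_imp_zdiv_nonneg_iff)
        ultimately have "real_of_int ((m + 1) div w) * (\<beta> * real_of_int m / 2) \<le> 2 * real_of_int m"
          using mult_left_mono[of "\<beta> * real_of_int m / 2" "real_of_int w" "real_of_int ((m + 1) div w)"] w(2) by auto
        then have "real_of_int ((m + 1) div w) \<le> 4 / \<beta>" using m1 \<beta> by (simp add: field_simps)
        then have cnt: "nat ((m + 1) div w) + 3 + 1 + 1 \<le> c" unfolding c_def by linarith
        have at2: "attains (nat ((m + 1) div w) + 3 + 1) (A \<inter> {..<s}) B
           (real_of_int (L + m - e - h) + real (card (A \<inter> {..<p})))"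
        proof (rule attains_union[OF at1 attains_singleton[of 1 "A \<inter> {..<p}" 0]])
          fix a a' b b' assume "a \<in> A1" "a' \<in> A \<inter> {..<p}" "b \<in> B" "b' \<in> {0 :: int}"
          then have "p \<le> a" "a' < p" "0 \<le> b" "b' = 0" using B(1) by (auto simp: A1_def)
          then show "a + b \<noteq> a' + b'" by linarith
        qed (use fA fB B ps(2) in \<open>auto simp: A1_def\<close>)
        have at3: "attains (nat ((m + 1) div w) + 3 + 1 + 1) A B
           (real_of_int (L + m - e - h) + real (card (A \<inter> {..<p})) + real (card (A \<inter> {s..})))"
        proof (rule attains_union[OF at2 attains_singleton[of 1 "A \<inter> {s..}" m]])
          fix a a' b b' assume "a \<in> A \<inter> {..<s}" "a' \<in> A \<inter> {s..}" "b \<in> B" "b' \<in> {m}"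
          then have "a < s" "s \<le> a'" "b \<le> m" "b' = m" using B(1) by auto
          then show "a + b \<noteq> a' + b'" by linarith
        qed (use fA fB B in auto)
        have "card A = card (A \<inter> {..<p}) + card A1 + card (A \<inter> {s..})"
        proof -
          have un: "A = ((A \<inter> {..<p}) \<union> A1) \<union> (A \<inter> {s..})" using ps(2) by (auto simp: A1_def)
          have "card A = card (((A \<inter> {..<p}) \<union> A1) \<union> (A \<inter> {s..}))" by (rule arg_cong[OF un])
          also have "\<dots> = card ((A \<inter> {..<p}) \<union> A1) + card (A \<inter> {s..})"
            using fA ps(2) by (intro card_Un_disjoint) (auto simp: A1_def)
          also have "card ((A \<inter> {..<p}) \<union> A1) = card (A \<inter> {..<p}) + card A1"
            using fA by (intro card_Un_disjoint) (auto simp: A1_def)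
          finally show ?thesis .
        qed
        then have "real (card A) + real (card B) - 1 \<le>
           real_of_int (L + m - e - h) + real (card (A \<inter> {..<p})) + real (card (A \<inter> {s..}))"
          using cA1 by (simp add: h_def)
        then show ?thesis using attains_mono[OF at3 cnt _ order_refl order_refl] fA fB by blast
      qed
    qed
  qed
qed

text \<open>A set of residues mod \<open>m\<close> is represented by its full preimage in the
  integers, so that translates can be written without reduction mod \<open>m\<close>.\<close>

definition periodic :: "int \<Rightarrow> int set \<Rightarrow> bool" where
  "periodic m M \<longleftrightarrow> (\<forall>x. x mod m \<in> M \<longleftrightarrow> x \<in> M)"

text \<open>For periodic \<open>M\<close> and positive \<open>m\<close> this is half the size of the
  symmetric difference of M and M - g in Z/m.\<close>

definition shift_defect :: "int \<Rightarrow> int set \<Rightarrow> int \<Rightarrow> nat" where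
  "shift_defect m M g = card {r \<in> {0..<m}. r \<in> M \<and> r + g \<notin> M}"

section \<open>Representation energy\<close>

lemma periodic_cong: "periodic m M \<Longrightarrow> x mod m = y mod m \<Longrightarrow> x \<in> M \<longleftrightarrow> y \<in> M"
  unfolding periodic_def by metis

lemma card_periodic_shift:
  fixes m :: int
  assumes "m > 0" "\<And>x. P (x mod m) \<longleftrightarrow> P x"
  shows "card {r \<in> {0..<m}. P (r + g)} = card {r \<in> {0..<m}. P r}"
proof (rule bij_betw_same_card[where f = "\<lambda>r. (r + g) mod m"],
    rule bij_betw_byWitness[where f' = "\<lambda>r. (r - g) mod m"])
  show "\<forall>a\<in>{r \<in> {0..<m}. P (r + g)}. ((a + g) mod m - g) mod m = a"
    by (auto simp: mod_diff_left_eq)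
  show "\<forall>a'\<in>{r \<in> {0..<m}. P r}. ((a' - g) mod m + g) mod m = a'"
    by (auto simp: mod_add_left_eq)
  show "(\<lambda>r. (r + g) mod m) ` {r \<in> {0..<m}. P (r + g)} \<subseteq> {r \<in> {0..<m}. P r}"
    using assms by auto
  show "(\<lambda>r. (r - g) mod m) ` {r \<in> {0..<m}. P r} \<subseteq> {r \<in> {0..<m}. P (r + g)}"
  proof
    fix y assume "y \<in> (\<lambda>r. (r - g) mod m) ` {r \<in> {0..<m}. P r}"
    then obtain r where r: "0 \<le> r" "r < m" "P r" "y = (r - g) mod m" by auto
    have "(y + g) mod m = r" using r by (simp add: mod_add_left_eq)
    then have "P (y + g)" using assms(2)[of "y + g"] r(3) by simp
    then show "y \<in> {r \<in> {0..<m}. P (r + g)}" using r assms(1) by auto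
  qed
qed

text \<open>Bernoulli gives 1 + kx <= (1 + x)^k, and (1 - x)^k (1 + x)^k <= 1. The rational bound
  replaces the power so that its distance from a chord can be computed exactly.\<close>

lemma pow_le_inverse_linear:
  fixes x :: real
  assumes "0 \<le> x" "x \<le> 1"
  shows "(1 - x) ^ k \<le> 1 / (1 + real k * x)"
proof -
  have "(1 - x) ^ k * (1 + real k * x) \<le> (1 - x) ^ k * (1 + x) ^ k"
    using Bernoulli_inequality[of x k] assms by (intro mult_left_mono) auto
  also have "\<dots> = (1 - x\<^sup>2) ^ k" by (simp add: power_mult_distrib[symmetric] power2_eq_square algebra_simps)
  also have "\<dots> \<le> 1" using assms by (intro power_le_one) (auto simp: power_le_one)
  finally show ?thesis using assms by (simp add: pos_le_divide_eq add_pos_nonneg)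
qed

text \<open>The function \<open>R \<mapsto> n / (n + k R)\<close> lies below its chord \<open>1 - R / s\<close> up to a small error at
  \<open>R = s\<close>; the gain in between is proportional to \<open>R (s - R)\<close>.\<close>

lemma inverse_linear_chord:
  fixes n k s R :: real
  assumes "n > 0" "k > 0" "s > 0" "0 \<le> R" "R \<le> s"
  shows "n / (n + k * R) \<le> 1 - R / s + R / s * (n / (n + k * s)) - R * (s - R) * k\<^sup>2 / (n + k * s)\<^sup>2"
proof -
  have p: "n + k * R > 0" "n + k * s > 0" using assms by (auto intro: add_pos_nonneg)
  have eq: "1 - R / s + R / s * (n / (n + k * s)) - n / (n + k * R)
      = R * (s - R) * k\<^sup>2 / ((n + k * R) * (n + k * s))"
  proof -
    have "1 - R / s + R / s * (n / (n + k * s)) - n / (n + k * R)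
      = (s * (n + k * s) * (n + k * R) - R * (n + k * s) * (n + k * R) + R * n * (n + k * R) - n * s * (n + k * s))
        / (s * ((n + k * R) * (n + k * s)))"
      using p assms by (simp add: divide_simps) (simp add: algebra_simps)
    also have "s * (n + k * s) * (n + k * R) - R * (n + k * s) * (n + k * R) + R * n * (n + k * R) - n * s * (n + k * s)
      = s * (R * (s - R) * k\<^sup>2)"
      by (simp add: algebra_simps power2_eq_square)
    finally show ?thesis using assms by simp
  qed
  have "k * R \<le> k * s" using assms by (intro mult_left_mono) auto
  then have "(n + k * R) * (n + k * s) \<le> (n + k * s)\<^sup>2"
    unfolding power2_eq_square using p by (intro mult_right_mono) auto
  then have "R * (s - R) * k\<^sup>2 / (n + k * s)\<^sup>2 \<le> R * (s - R) * k\<^sup>2 / ((n + k * R) * (n + k * s))"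
    using assms p by (intro divide_left_mono) auto
  then show ?thesis using eq by linarith
qed

lemma sum_card_filter_swap:
  assumes "finite X" "finite Y"
  shows "(\<Sum>x\<in>X. card {y \<in> Y. P x y}) = (\<Sum>y\<in>Y. card {x \<in> X. P x y})"
  using sum.swap_restrict[OF assms, of "\<lambda>_ _. 1::nat" P] by simp

lemma mod_Max_eq_mod_Min:
  fixes B :: "int set"
  assumes "m = Max B - Min B"
  shows "Max B mod m = Min B mod m"
  by (simp add: assms mod_eq_dvd_iff)

lemma inj_on_mod_diff_Max:
  fixes B :: "int set"
  assumes "finite B" "m = Max B - Min B"
  shows "inj_on (\<lambda>b. b mod m) (B - {Max B})"
proof -
  have "B - {Max B} \<subseteq> {Min B..<Min B + m}"
  proof
    fix x assume "x \<in> B - {Max B}"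
    then show "x \<in> {Min B..<Min B + m}" using Min_le[OF assms(1), of x] Max_ge[OF assms(1), of x]
      by (auto simp: assms(2))
  qed
  then show ?thesis using inj_on_mod_atLeastLessThan[of _ "Min B" m 0] by simp
qed

lemma residue_mem_iff:
  fixes B :: "int set"
  assumes "finite B" "card B \<ge> 2" "m = Max B - Min B"
  shows "(\<exists>b\<in>B. x mod m = b mod m) \<longleftrightarrow> (\<exists>b\<in>B - {Max B}. x mod m = b mod m)"
proof
  assume "\<exists>b\<in>B. x mod m = b mod m"
  then obtain b where b: "b \<in> B" "x mod m = b mod m" by blast
  have "Min B \<in> B - {Max B}" using Min_less_Max[OF assms(1,2)] Min_in[OF assms(1)] b(1) by auto
  then show "\<exists>b\<in>B - {Max B}. x mod m = b mod m"
    using b mod_Max_eq_mod_Min[OF assms(3)] by (cases "b = Max B") auto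
qed blast

text \<open>\<open>Max B\<close> repeats the residue of \<open>Min B\<close>, and all other residues
  are distinct.\<close>

lemma card_residues:
  fixes B :: "int set"
  assumes "finite B" "card B \<ge> 2" "m = Max B - Min B" "M = {x. \<exists>b\<in>B. x mod m = b mod m}"
  shows "real (card {r \<in> {0..<m}. r \<in> M}) = real (card B) - 1"
proof -
  have "m > 0" using Min_less_Max[OF assms(1,2)] assms(3) by simp
  then have "{r \<in> {0..<m}. r \<in> M} = (\<lambda>b. b mod m) ` (B - {Max B})"
    unfolding assms(4) residue_mem_iff[OF assms(1-3)] by (auto simp: image_iff)
  then have "card {r \<in> {0..<m}. r \<in> M} = card (B - {Max B})"
    using inj_on_mod_diff_Max[OF assms(1,3)] by (simp add: card_image)
  moreover have "Max B \<in> B" using assms(1,2) by (intro Max_in) auto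
  ultimately show ?thesis using card_Suc_Diff1[OF assms(1), of "Max B"] by linarith
qed

text \<open>Besides both ends take k random elements of \<open>B - {Max B}\<close>. A residue r is
  missed with probability at most (1 - R r / n)^k, where R r counts its representations; the window
  makes the residues of \<open>A1\<close> distinct, so these really number R r. Together with the
  ends it is enough to miss at most m - n residues. If the expectation is larger, the energy, the
  sum of R r (|A1| - R r), is at most 2 n^3 / k, and some \<open>a0\<close> does at least as well as
  the average.\<close>

lemma attains_or_small_energy:
  fixes A B A1 M :: "int set" and k :: nat and m :: int
  assumes fin: "finite A" "finite B" and ne: "A1 \<noteq> {}" and cB: "card B \<ge> 2"
    and A1: "A1 \<subseteq> A" "A1 \<subseteq> {p..<p + m}" and s: "real (card A1) \<le> real (card B) - 1"
    and k: "k \<ge> 1"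
    and m_def: "m = Max B - Min B" and M_def: "M = {x. \<exists>b\<in>B. x mod m = b mod m}"
  shows "attains (k + 2) A B (real (card A) + real (card B) - 1) \<or>
    (\<exists>a0\<in>A1. real (card A1) * (\<Sum>a\<in>A1. real (shift_defect m M (a - a0))) \<le> 2 * (real (card B) - 1) ^ 3 / real k)"
proof -
  have lt: "Min B < Max B" by (rule Min_less_Max[OF fin(2) cB])
  have m: "m > 0" using lt by (simp add: m_def)
  have fA1: "finite A1" using A1 fin finite_subset by blast
  have Bne: "B \<noteq> {}" using cB by auto
  define B' where "B' = B - {Max B}"
  define n where "n = real (card B) - 1"
  have n0: "n > 0" using cB by (simp add: n_def)
  have MB: "Max B \<in> B" "Min B \<in> B" using fin Bne by auto
  have cB': "real (card B') = n"
    unfolding B'_def n_def using fin MB card_Suc_Diff1[of B "Max B"] by linarith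
  have fB': "finite B'" using fin by (simp add: B'_def)
  have "Min B \<in> B'" using MB lt by (auto simp: B'_def)
  then have B'ne: "B' \<noteq> {}" by auto
  have M_iff: "x \<in> M \<longleftrightarrow> (\<exists>b\<in>B'. x mod m = b mod m)" for x
    unfolding M_def B'_def using residue_mem_iff[OF fin(2) cB m_def] by simp
  have per: "x mod m \<in> M \<longleftrightarrow> x \<in> M" for x unfolding M_iff by simp
  have injB: "inj_on (\<lambda>b. b mod m) B'"
    unfolding B'_def by (rule inj_on_mod_diff_Max[OF fin(2) m_def])
  have injA: "inj_on (\<lambda>a. a mod m) A1"
    using inj_on_mod_atLeastLessThan[OF A1(2), of 0] by simp
  have cM: "real (card {r \<in> {0..<m}. r \<in> M}) = n"
    unfolding n_def by (rule card_residues[OF fin(2) cB m_def M_def])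
  define R where "R r = real (card {a \<in> A1. r - a \<in> M})" for r
  define sz where "sz = real (card A1)"
  have sz: "sz > 0" "sz \<le> n" using ne fA1 s by (auto simp: sz_def n_def card_gt_0_iff)
  have R01: "0 \<le> R r" "R r \<le> sz" for r
    using fA1 by (auto simp: R_def sz_def card_mono)
  have sumR: "(\<Sum>r\<in>{0..<m}. R r) = sz * n"
  proof -
    have "(\<Sum>r\<in>{0..<m}. card {a \<in> A1. r - a \<in> M}) = (\<Sum>a\<in>A1. card {r \<in> {0..<m}. r - a \<in> M})"
      by (rule sum_card_filter_swap) (use fA1 in auto)
    also have "\<dots> = (\<Sum>a\<in>A1. card {r \<in> {0..<m}. r \<in> M})"
      using card_periodic_shift[OF m, of "\<lambda>x. x \<in> M" "- _"] per by (intro sum.cong) auto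
    finally have "(\<Sum>r\<in>{0..<m}. card {a \<in> A1. r - a \<in> M}) = card A1 * card {r \<in> {0..<m}. r \<in> M}" by simp
    then have "real (\<Sum>r\<in>{0..<m}. card {a \<in> A1. r - a \<in> M}) = real (card A1) * real (card {r \<in> {0..<m}. r \<in> M})"
      by (simp only: of_nat_mult)
    then show ?thesis using cM by (simp add: R_def sz_def)
  qed
  \<comment> \<open>\<open>R r * (sz - R r)\<close> counts the pairs with r - a in \<open>M\<close>
    and r - a0 outside \<open>M\<close>. For a fixed pair, summing over all r and substituting r - a
    gives the defect of the shift by a - a0.\<close>
  have energy: "(\<Sum>r\<in>{0..<m}. R r * (sz - R r)) = (\<Sum>a0\<in>A1. \<Sum>a\<in>A1. real (shift_defect m M (a - a0)))"
  proof -
    have "R r * (sz - R r) = real (card {z \<in> A1 \<times> A1. r - snd z \<in> M \<and> r - fst z \<notin> M})" for r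
    proof -
      have "{z \<in> A1 \<times> A1. r - snd z \<in> M \<and> r - fst z \<notin> M} = {a \<in> A1. r - a \<notin> M} \<times> {a \<in> A1. r - a \<in> M}"
        by auto
      then have "card {z \<in> A1 \<times> A1. r - snd z \<in> M \<and> r - fst z \<notin> M}
          = card {a \<in> A1. r - a \<notin> M} * card {a \<in> A1. r - a \<in> M}"
        by (simp add: card_cartesian_product)
      moreover have "card {a \<in> A1. r - a \<notin> M} + card {a \<in> A1. r - a \<in> M} = card A1"
      proof -
        have "{a \<in> A1. r - a \<notin> M} \<union> {a \<in> A1. r - a \<in> M} = A1" by blast
        then show ?thesis using fA1 by (subst card_Un_disjoint[symmetric]) auto
      qed
      then have "real (card {a \<in> A1. r - a \<notin> M}) = sz - R r" unfolding sz_def R_def by linarith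
      ultimately show ?thesis by (simp add: R_def)
    qed
    then have "(\<Sum>r\<in>{0..<m}. R r * (sz - R r))
       = real (\<Sum>r\<in>{0..<m}. card {z \<in> A1 \<times> A1. r - snd z \<in> M \<and> r - fst z \<notin> M})" by simp
    also have "(\<Sum>r\<in>{0..<m}. card {z \<in> A1 \<times> A1. r - snd z \<in> M \<and> r - fst z \<notin> M})
       = (\<Sum>z\<in>A1 \<times> A1. card {r \<in> {0..<m}. r - snd z \<in> M \<and> r - fst z \<notin> M})"
      by (rule sum_card_filter_swap) (use fA1 in auto)
    also have "\<dots> = (\<Sum>z\<in>A1 \<times> A1. shift_defect m M (snd z - fst z))"
    proof (rule sum.cong[OF refl])
      fix z :: "int \<times> int"
      have "card {r \<in> {0..<m}. r + (- snd z) \<in> M \<and> r + (- snd z) + (snd z - fst z) \<notin> M}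
         = card {r \<in> {0..<m}. r \<in> M \<and> r + (snd z - fst z) \<notin> M}"
      proof (rule card_periodic_shift[OF m])
        fix x
        have "x mod m + (snd z - fst z) \<in> M \<longleftrightarrow> x + (snd z - fst z) \<in> M"
          using per[of "x mod m + (snd z - fst z)"] per[of "x + (snd z - fst z)"] by (simp add: mod_add_left_eq)
        then show "(x mod m \<in> M \<and> x mod m + (snd z - fst z) \<notin> M) \<longleftrightarrow> (x \<in> M \<and> x + (snd z - fst z) \<notin> M)"
          using per[of x] by simp
      qed
      then show "card {r \<in> {0..<m}. r - snd z \<in> M \<and> r - fst z \<notin> M} = shift_defect m M (snd z - fst z)"
        by (simp add: shift_defect_def)
    qed
    finally show ?thesis by (simp add: sum.cartesian_product split_def)
  qed
  define E where "E = (\<Sum>r\<in>{0..<m}. R r * (sz - R r))"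
  \<comment> \<open>The condition says exactly that the convexity gain k^2 E / (n + k sz)^2
    outweighs n^2 / (n + k sz), the amount by which the chord estimate exceeds m - n.\<close>
  show ?thesis
  proof (cases "n\<^sup>2 * (n + real k * sz) \<le> (real k)\<^sup>2 * E")
    case True
    define H where "H x b \<longleftrightarrow> (\<exists>a\<in>A1. x mod m = (a + b) mod m)" for x b
    obtain f where f: "\<forall>i<k. f i \<in> B'" "real (card {x \<in> {0..<m}. \<forall>i<k. \<not> H x (f i)})
       \<le> (\<Sum>x\<in>{0..<m}. \<Prod>i<k. real (card {b \<in> B'. \<not> H x b}) / real (card B'))"
    proof -
      have "\<exists>f. (\<forall>i<k. f i \<in> B') \<and> real (card {x \<in> {0..<m}. \<forall>i<k. \<not> H x (f i)})
        \<le> (\<Sum>x\<in>{0..<m}. \<Prod>i<k. real (card {b \<in> B'. \<not> H x b}) / real (card B'))"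
        by (rule exists_hitting_choice) (simp_all add: fB' B'ne)
      then show thesis using that by blast
    qed
    have frac: "(\<Prod>i<k. real (card {b \<in> B'. \<not> H x b}) / real (card B')) \<le> n / (n + real k * R x)" for x
    proof -
      have "card {b \<in> B'. H x b} = card {a \<in> A1. x - a \<in> M}"
      proof -
        \<comment> \<open>Both projections of \<open>T\<close> are injective, so the
          \<open>b\<close> that hit \<open>x\<close> and the \<open>a\<close> that represent it are
          equally many.\<close>
        define T where "T = {z \<in> A1 \<times> B'. x mod m = (fst z + snd z) mod m}"
        have "inj_on snd T"
        proof (rule inj_onI)
          fix z z' assume z: "z \<in> T" "z' \<in> T" "snd z = snd z'"
          have zT: "fst z \<in> A1" "fst z' \<in> A1" "x mod m = (fst z + snd z) mod m" "x mod m = (fst z' + snd z') mod m"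
            using z(1,2) unfolding T_def mem_Collect_eq mem_Times_iff by blast+
          then have "(fst z + snd z) mod m = (fst z' + snd z) mod m" using z(3) by metis
          then have "fst z mod m = fst z' mod m" by (simp add: mod_eq_dvd_iff)
          then have "fst z = fst z'" using inj_onD[OF injA] zT by blast
          then show "z = z'" using z(3) by (rule prod_eqI)
        qed
        moreover have "inj_on fst T"
        proof (rule inj_onI)
          fix z z' assume z: "z \<in> T" "z' \<in> T" "fst z = fst z'"
          have zT: "snd z \<in> B'" "snd z' \<in> B'" "x mod m = (fst z + snd z) mod m" "x mod m = (fst z' + snd z') mod m"
            using z(1,2) unfolding T_def mem_Collect_eq mem_Times_iff by blast+
          then have "(fst z + snd z) mod m = (fst z + snd z') mod m" using z(3) by metis
          then have "snd z mod m = snd z' mod m" by (simp add: mod_eq_dvd_iff)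
          then have "snd z = snd z'" using inj_onD[OF injB] zT by blast
          then show "z = z'" using z(3) by (intro prod_eqI)
        qed
        moreover have "snd ` T = {b \<in> B'. H x b}"
        proof (intro equalityI subsetI)
          fix b assume "b \<in> {b \<in> B'. H x b}"
          then obtain a where "a \<in> A1" "b \<in> B'" "x mod m = (a + b) mod m" unfolding H_def by blast
          then have "(a, b) \<in> T" by (simp add: T_def)
          then show "b \<in> snd ` T" by force
        qed (auto simp: T_def H_def)
        moreover have "fst ` T = {a \<in> A1. x - a \<in> M}"
        proof -
          have "x mod m = (a + b) mod m \<longleftrightarrow> (x - a) mod m = b mod m" for a b
            by (simp add: mod_eq_dvd_iff algebra_simps)
          note shift = this
          show ?thesis
          proof (intro equalityI subsetI)
            fix a assume "a \<in> {a \<in> A1. x - a \<in> M}"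
            then obtain b where "a \<in> A1" "b \<in> B'" "x mod m = (a + b) mod m"
              unfolding M_iff shift by blast
            then have "(a, b) \<in> T" by (simp add: T_def)
            then show "a \<in> fst ` T" by force
          next
            fix a assume "a \<in> fst ` T"
            then obtain b where "a \<in> A1" "b \<in> B'" "x mod m = (a + b) mod m" by (auto simp: T_def)
            then show "a \<in> {a \<in> A1. x - a \<in> M}" unfolding M_iff shift by blast
          qed
        qed
        ultimately show ?thesis using card_image[of snd T] card_image[of fst T] by simp
      qed
      moreover have "card {b \<in> B'. H x b} + card {b \<in> B'. \<not> H x b} = card B'"
      proof -
        have "{b \<in> B'. H x b} \<union> {b \<in> B'. \<not> H x b} = B'" by blast
        then show ?thesis using fB' by (subst card_Un_disjoint[symmetric]) auto
      qed
      ultimately have "real (card {b \<in> B'. \<not> H x b}) = n - R x" unfolding R_def using cB' by linarith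
      then have "(\<Prod>i<k. real (card {b \<in> B'. \<not> H x b}) / real (card B')) = (1 - R x / n) ^ k"
        using cB' n0 by (simp add: diff_divide_distrib)
      also have "\<dots> \<le> 1 / (1 + real k * (R x / n))"
        using R01[of x] sz n0 by (intro pow_le_inverse_linear) auto
      also have "\<dots> = n / (n + real k * R x)" using n0 by (simp add: field_simps)
      finally show ?thesis .
    qed
    have k0: "real k > 0" using k by simp
    have dpos: "n + real k * sz > 0" using n0 sz k0 by (intro add_pos_nonneg) auto
    have "real (card {x \<in> {0..<m}. \<forall>i<k. \<not> H x (f i)}) \<le> (\<Sum>x\<in>{0..<m}. n / (n + real k * R x))"
      by (rule order_trans[OF f(2)]) (intro sum_mono frac)
    also have "\<dots> \<le> (\<Sum>x\<in>{0..<m}. 1 - R x / sz + R x / sz * (n / (n + real k * sz))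
        - R x * (sz - R x) * (real k)\<^sup>2 / (n + real k * sz)\<^sup>2)"
      by (intro sum_mono inverse_linear_chord) (use n0 k0 sz R01 in auto)
    also have "\<dots> = real_of_int m - (\<Sum>x\<in>{0..<m}. R x) / sz + (\<Sum>x\<in>{0..<m}. R x) / sz * (n / (n + real k * sz))
        - E * (real k)\<^sup>2 / (n + real k * sz)\<^sup>2"
      using m by (simp add: sum.distrib sum_subtractf E_def sum_divide_distrib sum_distrib_right sum_distrib_left)
    \<comment> \<open>The linear part of the chord bound depends only on the sum of R, which is
      \<open>sz * n\<close>.\<close>
    also have "\<dots> = real_of_int m - n + (n\<^sup>2 * (n + real k * sz) - E * (real k)\<^sup>2) / (n + real k * sz)\<^sup>2"
    proof -
      have "n * (n / (n + real k * sz)) = n\<^sup>2 * (n + real k * sz) / (n + real k * sz)\<^sup>2"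
        using dpos by (simp add: power2_eq_square)
      then show ?thesis unfolding sumR using sz by (simp add: diff_divide_distrib)
    qed
    also have "\<dots> \<le> real_of_int m - n"
      using True by (auto simp: mult.commute intro!: divide_nonpos_nonneg)
    finally have unhit: "real (card {x \<in> {0..<m}. \<forall>i<k. \<not> H x (f i)}) \<le> real_of_int m - n" .
    define F where "F = insert (Min B) (insert (Max B) (f ` {..<k}))"
    have FB: "F \<subseteq> B" using f(1) MB by (auto simp: F_def B'_def)
    have fF: "finite F" by (simp add: F_def)
    have cF: "card F \<le> k + 2"
      unfolding F_def using card_image_le[of "{..<k}" f] by (auto simp: card_insert_if)
    have res: "card A + card ((\<lambda>x. x mod m) ` (A + F)) \<le> card (A + F)"
      unfolding m_def by (rule card_add_residues) (use fin fF lt in \<open>auto simp: F_def\<close>)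
    have "{0..<m} \<subseteq> (\<lambda>x. x mod m) ` (A + F) \<union> {x \<in> {0..<m}. \<forall>i<k. \<not> H x (f i)}"
    proof
      fix x assume x: "x \<in> {0..<m}"
      show "x \<in> (\<lambda>x. x mod m) ` (A + F) \<union> {x \<in> {0..<m}. \<forall>i<k. \<not> H x (f i)}"
      proof (cases "\<forall>i<k. \<not> H x (f i)")
        case True
        then show ?thesis using x by blast
      next
        case False
        then obtain i a where "i < k" "a \<in> A1" "x mod m = (a + f i) mod m" unfolding H_def by blast
        moreover have "a + f i \<in> A + F" using calculation A1(1) by (intro set_plus_intro) (auto simp: F_def)
        ultimately show ?thesis using x by (auto intro!: image_eqI[of _ _ "a + f i"])
      qed
    qed
    then have "card {0..<m} \<le> card ((\<lambda>x. x mod m) ` (A + F) \<union> {x \<in> {0..<m}. \<forall>i<k. \<not> H x (f i)})"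
      by (rule card_mono[rotated])
        (auto simp: fin fF finite_set_add intro: finite_subset[of _ "{0..<m}"])
    also have "\<dots> \<le> card ((\<lambda>x. x mod m) ` (A + F)) + card {x \<in> {0..<m}. \<forall>i<k. \<not> H x (f i)}"
      by (rule card_Un_le)
    finally have "real_of_int m \<le> real (card ((\<lambda>x. x mod m) ` (A + F))) + real (card {x \<in> {0..<m}. \<forall>i<k. \<not> H x (f i)})"
      using m by simp
    then have "real (card A) + real (card B) - 1 \<le> real (card (A + F))" using res unhit n_def by linarith
    then show ?thesis using FB cF by (intro disjI1 attainsI[of F]) auto
  next
    case False
    have "(real k)\<^sup>2 * E \<le> n\<^sup>2 * (n + real k * sz)" using False by simp
    also have "\<dots> \<le> n\<^sup>2 * (real k * n + real k * n)"
      using k n0 sz by (intro mult_left_mono add_mono) auto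
    also have "\<dots> = (real k)\<^sup>2 * (2 * n ^ 3 / real k)"
      using k by (simp add: power2_eq_square power3_eq_cube)
    finally have "E \<le> 2 * n ^ 3 / real k" using k by (simp add: mult_le_cancel_left_pos del: times_divide_eq_right)
    moreover obtain a0 where "a0 \<in> A1" "real (card A1) * (\<Sum>a\<in>A1. real (shift_defect m M (a - a0))) \<le> E"
      using exists_le_average[OF fA1 ne, of "\<lambda>a0. \<Sum>a\<in>A1. real (shift_defect m M (a - a0))"] energy
      unfolding E_def by auto
    ultimately have "\<exists>a0\<in>A1. real (card A1) * (\<Sum>a\<in>A1. real (shift_defect m M (a - a0))) \<le> 2 * n ^ 3 / real k"
      by (intro bexI[of _ a0]) linarith+
    then show ?thesis unfolding n_def ..
  qed
qed

section \<open>Near-periods\<close>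

lemma int_subgroup_multiples:
  fixes D :: "int set" and m :: int
  assumes "m \<in> D" "m > 0" and closed: "\<And>x y. x \<in> D \<Longrightarrow> y \<in> D \<Longrightarrow> x - y \<in> D"
  shows "\<exists>d>0. d dvd m \<and> D = {x. d dvd x}"
proof -
  define l where "l = (LEAST k. 0 < k \<and> int k \<in> D)"
  define d where "d = int l"
  have l: "0 < l \<and> int l \<in> D"
    unfolding l_def by (rule LeastI[of _ "nat m"]) (use assms in auto)
  have lmin: "l \<le> k" if "0 < k" "int k \<in> D" for k
    unfolding l_def by (rule Least_le) (use that in auto)
  have d: "d > 0" "d \<in> D" using l by (auto simp: d_def)
  have z: "0 \<in> D" using closed[OF d(2) d(2)] by simp
  have neg: "- x \<in> D" if "x \<in> D" for x using closed[OF z that] by simp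
  have add: "x + y \<in> D" if "x \<in> D" "y \<in> D" for x y
    using closed[OF that(1) neg[OF that(2)]] by simp
  have nmul: "int k * d \<in> D" for k
    by (induction k) (use z d add in \<open>auto simp: algebra_simps\<close>)
  have mul: "j * d \<in> D" for j
    by (cases j rule: int_cases2) (use nmul neg[OF nmul] in auto)
  have "d dvd x" if "x \<in> D" for x
  proof -
    have "x mod d = x - x div d * d" by (simp add: minus_div_mult_eq_mod)
    then have "x mod d \<in> D" using closed[OF that mul] by simp
    moreover have "0 \<le> x mod d" "x mod d < d" using d by auto
    ultimately have "x mod d = 0"
      using lmin[of "nat (x mod d)"] by (cases "x mod d = 0") (auto simp: d_def)
    then show ?thesis by auto
  qed
  moreover have "x \<in> D" if "d dvd x" for x
    using that mul by (metis dvdE mult.commute)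
  ultimately show ?thesis using d assms(1) by (intro exI[of _ d]) auto
qed

lemma shift_defect_zero: "shift_defect m M 0 = 0"
  by (simp add: shift_defect_def)

lemma shift_defect_mod:
  assumes "periodic m M"
  shows "shift_defect m M (g mod m) = shift_defect m M g"
proof -
  have "r + g mod m \<in> M \<longleftrightarrow> r + g \<in> M" for r
    using periodic_cong[OF assms, of "r + g mod m" "r + g"] by (simp add: mod_add_right_eq)
  then show ?thesis by (simp add: shift_defect_def)
qed

lemma shift_defect_complement:
  "card {r \<in> {0..<m}. r \<in> M \<and> r + g \<in> M} + shift_defect m M g = card {r \<in> {0..<m}. r \<in> M}"
proof -
  have "{r \<in> {0..<m}. r \<in> M \<and> r + g \<in> M} \<union> {r \<in> {0..<m}. r \<in> M \<and> r + g \<notin> M} = {r \<in> {0..<m}. r \<in> M}"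
    by blast
  moreover have "finite {r \<in> {0..<m}. P r}" for P
    by (rule finite_subset[of _ "{0..<m}"]) auto
  ultimately show ?thesis
    unfolding shift_defect_def by (subst card_Un_disjoint[symmetric]) auto
qed

lemma periodic_shift_mem:
  assumes "periodic m M"
  shows "x mod m + g \<in> M \<longleftrightarrow> x + g \<in> M"
  using periodic_cong[OF assms, of "x mod m + g" "x + g"] by (simp add: mod_add_left_eq)

text \<open>M and its translate overlap equally often for g and -g; the defect is the complement of
  this overlap in M.\<close>

lemma shift_defect_uminus:
  assumes "m > 0" "periodic m M"
  shows "shift_defect m M (- g) = shift_defect m M g"
proof -
  have "card {r \<in> {0..<m}. r + g \<in> M \<and> (r + g) + - g \<in> M} = card {r \<in> {0..<m}. r \<in> M \<and> r + - g \<in> M}"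
    using card_periodic_shift[OF assms(1), of "\<lambda>x. x \<in> M \<and> x + - g \<in> M" g]
      periodic_shift_mem[OF assms(2), of _ "- g"] periodic_shift_mem[OF assms(2), of _ 0] by simp
  then have "card {r \<in> {0..<m}. r \<in> M \<and> r + g \<in> M} = card {r \<in> {0..<m}. r \<in> M \<and> r + - g \<in> M}"
    by (simp add: conj_commute)
  then show ?thesis using shift_defect_complement[of m M g] shift_defect_complement[of m M "- g"] by linarith
qed

text \<open>A point lost under the shift by g - h is lost by the shift by -h or by the following
  shift by g. Hence differences of near-periods with tolerance x are near-periods with tolerance
  2x.\<close>

lemma shift_defect_diff:
  assumes "m > 0" "periodic m M"
  shows "shift_defect m M (g - h) \<le> shift_defect m M g + shift_defect m M h"
proof -
  have fin: "finite {r \<in> {0..<m}. P r}" for P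
    by (rule finite_subset[of _ "{0..<m}"]) auto
  have "shift_defect m M (g - h) \<le>
      card ({r \<in> {0..<m}. r \<in> M \<and> r + - h \<notin> M} \<union> {r \<in> {0..<m}. r + - h \<in> M \<and> (r + - h) + g \<notin> M})"
    unfolding shift_defect_def by (intro card_mono finite_UnI fin) (auto simp: algebra_simps)
  also have "\<dots> \<le> card {r \<in> {0..<m}. r \<in> M \<and> r + - h \<notin> M} + card {r \<in> {0..<m}. r + - h \<in> M \<and> (r + - h) + g \<notin> M}"
    by (rule card_Un_le)
  also have "card {r \<in> {0..<m}. r \<in> M \<and> r + - h \<notin> M} = shift_defect m M h"
    using shift_defect_uminus[OF assms, of h] by (simp add: shift_defect_def)
  also have "card {r \<in> {0..<m}. r + - h \<in> M \<and> (r + - h) + g \<notin> M} = shift_defect m M g"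
    unfolding shift_defect_def
    by (rule card_periodic_shift[OF assms(1), of "\<lambda>x. x \<in> M \<and> x + g \<notin> M"])
      (use periodic_shift_mem[OF assms(2)] periodic_shift_mem[OF assms(2), of _ 0] in simp)
  finally show ?thesis by linarith
qed

definition near_periods :: "int \<Rightarrow> int set \<Rightarrow> real \<Rightarrow> int set" where
  "near_periods m M x = {g \<in> {0..<m}. real (shift_defect m M g) \<le> x}"

lemma finite_near_periods: "finite (near_periods m M x)"
  unfolding near_periods_def by (rule finite_subset[of _ "{0..<m}"]) auto

text \<open>Each such shift retains at least n/2 points of \<open>M\<close>, while the overlaps of
  \<open>M\<close> with its translates sum to n^2 over all m shifts.\<close>

lemma card_near_periods_le:
  assumes "m > 0" "periodic m M" "n = real (card {r \<in> {0..<m}. r \<in> M})" "x \<le> n / 2" "n > 0"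
  shows "real (card (near_periods m M x)) \<le> 2 * n"
proof -
  define K where "K = near_periods m M x"
  define X where "X = {r \<in> {0..<m}. r \<in> M}"
  have fX: "finite X" unfolding X_def by (rule finite_subset[of _ "{0..<m}"]) auto
  have "real (card K) * (n / 2) = (\<Sum>g\<in>K. n / 2)" by simp
  also have "\<dots> \<le> (\<Sum>g\<in>K. real (card {r \<in> X. r + g \<in> M}))"
  proof (rule sum_mono)
    fix g assume "g \<in> K"
    then have "real (shift_defect m M g) \<le> n / 2" using assms(4) by (simp add: K_def near_periods_def)
    moreover have "{r \<in> X. r + g \<in> M} = {r \<in> {0..<m}. r \<in> M \<and> r + g \<in> M}" by (auto simp: X_def)
    ultimately show "n / 2 \<le> real (card {r \<in> X. r + g \<in> M})"
      using shift_defect_complement[of m M g] assms(3) by simp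
  qed
  also have "\<dots> \<le> (\<Sum>g\<in>{0..<m}. real (card {r \<in> X. r + g \<in> M}))"
    by (rule sum_mono2) (auto simp: K_def near_periods_def)
  also have "\<dots> = real (\<Sum>g\<in>{0..<m}. card {r \<in> X. r + g \<in> M})" by simp
  also have "(\<Sum>g\<in>{0..<m}. card {r \<in> X. r + g \<in> M}) = (\<Sum>r\<in>X. card {g \<in> {0..<m}. r + g \<in> M})"
    by (rule sum_card_filter_swap) (use fX in auto)
  also have "\<dots> = (\<Sum>r\<in>X. card X)"
    using card_periodic_shift[OF assms(1), of "\<lambda>x. x \<in> M"] assms(2)
    by (intro sum.cong) (auto simp: X_def periodic_def add.commute)
  also have "real \<dots> = n * n" by (simp add: X_def assms(3))
  finally show ?thesis using assms(5) by (simp add: K_def field_simps)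
qed

text \<open>If \<open>|K - K| < 3/2 |K|\<close> then every difference of \<open>K\<close> has more than \<open>|K| / 2\<close> representations, so
  the representations of two differences meet and \<open>K - K\<close> is closed under subtraction.\<close>

lemma subgroup_of_near_periods:
  assumes m: "m > 0" and per: "periodic m M" and x: "x \<ge> 0"
    and small: "2 * card (near_periods m M (2 * x)) < 3 * card (near_periods m M x)"
  shows "\<exists>d>0. d dvd m \<and> (\<forall>g\<in>near_periods m M x. d dvd g) \<and>
    (\<forall>g. d dvd g \<longrightarrow> real (shift_defect m M g) \<le> 2 * x)"
proof -
  define K where "K = near_periods m M x"
  define L where "L = near_periods m M (2 * x)"
  define D where "D = {g. \<exists>k1\<in>K. \<exists>k2\<in>K. (k1 - k2) mod m = g mod m}"
  have fin: "finite K" "finite L" by (simp_all add: K_def L_def finite_near_periods)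
  have K0: "0 \<in> K" using m x by (simp add: K_def near_periods_def shift_defect_zero)
  have KL: "(k1 - k2) mod m \<in> L" if "k1 \<in> K" "k2 \<in> K" for k1 k2
    using that shift_defect_diff[OF m per, of k1 k2] m
    by (auto simp: K_def L_def near_periods_def shift_defect_mod[OF per])
  have rep: "2 * card {k \<in> K. \<exists>k'\<in>K. (k - k') mod m = g mod m} > card K" if g: "g \<in> D" for g
  proof -
    obtain k1 k2 where k: "k1 \<in> K" "k2 \<in> K" "(k1 - k2) mod m = g mod m" using g unfolding D_def by blast
    \<comment> \<open>The translates K - k1 and K - k2 both lie in \<open>L\<close>, which has fewer
      than 3/2 |K| elements, so they meet in more than |K|/2 points. A common point u - k1 = v - k2
      represents g as u - v.\<close>
    define I where "I = (\<lambda>k z. (z - k) mod m) "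
    have inj: "inj_on (I k) K" for k
    proof -
      have "K \<subseteq> {0..<0 + m}" by (auto simp: K_def near_periods_def)
      then show ?thesis using inj_on_mod_atLeastLessThan[of K 0 m "- k"] by (simp add: I_def)
    qed
    have sub: "I k ` K \<subseteq> L" if "k \<in> K" for k using KL that by (auto simp: I_def)
    have "card (I k1 ` K \<union> I k2 ` K) \<le> card L"
      using sub k fin by (intro card_mono) auto
    moreover have "card (I k1 ` K) + card (I k2 ` K) = card (I k1 ` K \<union> I k2 ` K) + card (I k1 ` K \<inter> I k2 ` K)"
      using fin by (intro card_Un_Int) auto
    ultimately have "2 * card (I k1 ` K \<inter> I k2 ` K) > card K"
      using small inj by (simp add: card_image K_def[symmetric] L_def[symmetric])
    moreover have "card (I k1 ` K \<inter> I k2 ` K) \<le> card {k \<in> K. \<exists>k'\<in>K. (k - k') mod m = g mod m}"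
    proof -
      have "I k1 ` K \<inter> I k2 ` K \<subseteq> I k1 ` {k \<in> K. \<exists>k'\<in>K. (k - k') mod m = g mod m}"
      proof
        fix y assume "y \<in> I k1 ` K \<inter> I k2 ` K"
        then obtain u v where uv: "u \<in> K" "v \<in> K" "y = (u - k1) mod m" "(u - k1) mod m = (v - k2) mod m"
          by (auto simp: I_def)
        from uv(4) have "m dvd (u - k1) - (v - k2)" by (simp add: mod_eq_dvd_iff)
        moreover have "(u - k1) - (v - k2) = (u - v) - (k1 - k2)" by simp
        ultimately have "(u - v) mod m = (k1 - k2) mod m" by (simp add: mod_eq_dvd_iff)
        then show "y \<in> I k1 ` {k \<in> K. \<exists>k'\<in>K. (k - k') mod m = g mod m}"
          using uv k(3) unfolding I_def by (intro image_eqI[of _ _ u]) auto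
      qed
      then have "card (I k1 ` K \<inter> I k2 ` K) \<le> card (I k1 ` {k \<in> K. \<exists>k'\<in>K. (k - k') mod m = g mod m})"
        using fin by (intro card_mono) auto
      also have "\<dots> \<le> card {k \<in> K. \<exists>k'\<in>K. (k - k') mod m = g mod m}"
        using fin by (intro card_image_le) auto
      finally show ?thesis .
    qed
    ultimately show ?thesis by linarith
  qed
  have closed: "g - h \<in> D" if "g \<in> D" "h \<in> D" for g h
  proof -
    define U where "U y = {k \<in> K. \<exists>k'\<in>K. (k - k') mod m = y mod m}" for y
    have "card (U g \<union> U h) \<le> card K" using fin by (intro card_mono) (auto simp: U_def)
    moreover have "card (U g) + card (U h) = card (U g \<union> U h) + card (U g \<inter> U h)"
      using fin by (intro card_Un_Int) (auto simp: U_def)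
    ultimately have "card (U g \<inter> U h) \<noteq> 0"
      using rep[OF that(1)] rep[OF that(2)] unfolding U_def by linarith
    then obtain k where "k \<in> U g \<inter> U h" by (metis card.empty ex_in_conv)
    then obtain u v where uv: "u \<in> K" "v \<in> K" "(k - u) mod m = g mod m" "(k - v) mod m = h mod m"
      by (auto simp: U_def)
    have "(g - h) mod m = ((k - u) - (k - v)) mod m" using uv(3,4) by (metis mod_diff_eq)
    also have "(k - u) - (k - v) = v - u" by simp
    finally show ?thesis using uv unfolding D_def by force
  qed
  have "m \<in> D" using K0 unfolding D_def by force
  from int_subgroup_multiples[OF this m closed]
  obtain d where d: "d > 0" "d dvd m" "D = {x. d dvd x}" by blast
  have "d dvd g" if "g \<in> K" for g
  proof -
    have "(g - 0) mod m = g mod m" by simp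
    then have "g \<in> D" using that K0 unfolding D_def by blast
    then show ?thesis using d by simp
  qed
  moreover have "real (shift_defect m M g) \<le> 2 * x" if "d dvd g" for g
  proof -
    have "g \<in> D" using that d by simp
    then obtain k1 k2 where k: "k1 \<in> K" "k2 \<in> K" "(k1 - k2) mod m = g mod m" by (auto simp: D_def)
    then have "g mod m \<in> L" using KL by metis
    then show ?thesis by (simp add: L_def near_periods_def shift_defect_mod[OF per])
  qed
  ultimately show ?thesis using d unfolding K_def by blast
qed

text \<open>Growth by 3/2 at each of \<open>J\<close> steps would carry \<open>f\<close> from
  \<open>c\<close> beyond \<open>U\<close>. It is used for the numbers of near-periods at doubling
  tolerances.\<close>

lemma exists_small_growth:
  fixes f :: "nat \<Rightarrow> nat" and c U :: real
  assumes "c \<le> real (f 0)" "real (f J) \<le> U" "U < c * (3 / 2) ^ J"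
  shows "\<exists>j<J. 2 * f (Suc j) < 3 * f j"
proof (rule ccontr)
  assume "\<not> ?thesis"
  then have step: "\<And>j. j < J \<Longrightarrow> 3 * f j \<le> 2 * f (Suc j)" by (meson not_le)
  have "c * (3 / 2) ^ j \<le> real (f j)" if "j \<le> J" for j
    using that
  proof (induction j)
    case 0
    then show ?case using assms(1) by simp
  next
    case (Suc j)
    have "c * (3 / 2) ^ j \<le> real (f j)" using Suc by simp
    moreover have "real (3 * f j) \<le> real (2 * f (Suc j))"
      using step[of j] Suc.prems unfolding of_nat_le_iff by simp
    ultimately show ?case by simp
  qed
  from this[of J] show False using assms by linarith
qed

section \<open>Residue classes\<close>

text \<open>Split \<open>B\<close> into the class of \<open>b0\<close> and everything else. As
  \<open>A2\<close> lies in one class, its sums with the two parts are disjoint, and the approximate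
  bound for each part contributes a full \<open>card A2\<close>. Each part loses 1 in size, hence
  the 2.\<close>

lemma attains_two_classes:
  fixes \<alpha> \<epsilon> :: real
  assumes "\<alpha> > 0" "\<epsilon> > 0"
  obtains c where "\<And>(A2 :: int set) A B d a0 b0 b1. finite A \<Longrightarrow> A2 \<subseteq> A \<Longrightarrow> finite B \<Longrightarrow>
    (\<forall>a\<in>A2. d dvd a - a0) \<Longrightarrow> b0 \<in> B \<Longrightarrow> b1 \<in> B \<Longrightarrow> \<not> d dvd b1 - b0 \<Longrightarrow>
    \<alpha> * real (card B) \<le> real (card A2) \<Longrightarrow>
    attains c A B (2 * real (card A2) + (1 - \<epsilon>) * (real (card B) - 2))"
proof -
  obtain c where c: "\<And>A B :: int set. finite A \<Longrightarrow> finite B \<Longrightarrow> B \<noteq> {} \<Longrightarrow>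
    real (card A) \<ge> \<alpha> * (real (card B) - 1) \<Longrightarrow>
    attains c A B (real (card A) + (1 - \<epsilon>) * (real (card B) - 1))"
    using attains_approx[OF assms] by blast
  show thesis
  proof (rule that[of "c + c"])
    fix A2 A B :: "int set" and d a0 b0 b1 :: int
    assume fin: "finite A" "A2 \<subseteq> A" "finite B" and cls': "\<forall>a\<in>A2. d dvd a - a0"
      and b: "b0 \<in> B" "b1 \<in> B" "\<not> d dvd b1 - b0" and ge: "\<alpha> * real (card B) \<le> real (card A2)"
    note cls = bspec[OF cls']
    define B0 where "B0 = {b \<in> B. d dvd b - b0}"
    define B1 where "B1 = {b \<in> B. \<not> d dvd b - b0}"
    have fA2: "finite A2" using fin finite_subset by blast
    have f: "finite B0" "finite B1" "B0 \<noteq> {}" "B1 \<noteq> {}" "B0 \<subseteq> B" "B1 \<subseteq> B"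
      using fin(3) b by (auto simp: B0_def B1_def)
    have cB: "card B0 + card B1 = card B"
    proof -
      have "B0 \<union> B1 = B" by (auto simp: B0_def B1_def)
      then show ?thesis using f by (subst card_Un_disjoint[symmetric]) (auto simp: B0_def B1_def)
    qed
    have le: "\<alpha> * (real (card Bi) - 1) \<le> real (card A2)" if "Bi \<subseteq> B" for Bi
    proof -
      have "real (card Bi) - 1 \<le> real (card B)" using card_mono[OF fin(3) that] by simp
      then have "\<alpha> * (real (card Bi) - 1) \<le> \<alpha> * real (card B)" using assms(1) by (intro mult_left_mono) auto
      then show ?thesis using ge by linarith
    qed
    have "attains (c + c) A B ((real (card A2) + (1 - \<epsilon>) * (real (card B0) - 1)) +
       (real (card A2) + (1 - \<epsilon>) * (real (card B1) - 1)))"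
    proof (rule attains_union[OF c[OF fA2 f(1,3)] c[OF fA2 f(2,4)]])
      fix a a' b b' assume h: "a \<in> A2" "a' \<in> A2" "b \<in> B0" "b' \<in> B1"
      show "a + b \<noteq> a' + b'"
      proof
        assume "a + b = a' + b'"
        then have eq: "b' - b0 = (a - a0) - (a' - a0) + (b - b0)" by simp
        have "d dvd a - a0" "d dvd a' - a0" "d dvd b - b0"
          using cls[OF h(1)] cls[OF h(2)] h(3) by (auto simp: B0_def)
        then have "d dvd b' - b0" unfolding eq by (intro dvd_add[OF dvd_diff])
        then show False using h(4) by (simp add: B1_def)
      qed
    qed (use le f fin in auto)
    moreover have "real (card B) = real (card B0) + real (card B1)" using cB by linarith
    ultimately show "attains (c + c) A B (2 * real (card A2) + (1 - \<epsilon>) * (real (card B) - 2))"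
      by (simp add: algebra_simps)
  qed
qed

text \<open>Dividing by \<open>d\<close> turns \<open>B\<close> into a nearly full subset of
  \<open>{0..m div d}\<close> and handles \<open>A2\<close>. The rest of \<open>A\<close> needs only
  the extra element \<open>Min B\<close>: its sums lie in other classes mod \<open>d\<close> than
  those of \<open>A2 + B\<close>.\<close>

lemma attains_one_class:
  fixes \<alpha> :: real
  assumes "\<alpha> > 0"
  obtains c \<epsilon> where "\<epsilon> > 0" "\<And>(A :: int set) A2 B m d a0. finite A \<Longrightarrow> finite B \<Longrightarrow> card B \<ge> 2 \<Longrightarrow> d > 0 \<Longrightarrow>
    A2 = {a \<in> A. d dvd a - a0} \<Longrightarrow> A2 \<noteq> {} \<Longrightarrow> (\<forall>b\<in>B. d dvd b - Min B) \<Longrightarrow> m = Max B - Min B \<Longrightarrow>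
    \<alpha> * real_of_int (m div d) \<le> real (card A2) \<Longrightarrow> 2 * card A2 \<le> card B \<Longrightarrow>
    (1 - \<epsilon>) * real_of_int (m div d) \<le> real (card B) - 1 \<Longrightarrow>
    attains c A B (real (card A) + real (card B) - 1)"
proof -
  obtain c \<epsilon> where \<epsilon>: "\<epsilon> > 0" and c: "\<And>(A :: int set) B m. finite A \<Longrightarrow> A \<noteq> {} \<Longrightarrow> B \<subseteq> {0..m} \<Longrightarrow> 0 \<in> B \<Longrightarrow> m \<in> B \<Longrightarrow>
    \<alpha> * real_of_int m \<le> real (card A) \<Longrightarrow> 2 * card A \<le> card B \<Longrightarrow>
    (1 - \<epsilon>) * real_of_int m \<le> real (card B) - 1 \<Longrightarrow>
    attains c A B (real (card A) + real (card B) - 1)"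
    by (rule attains_of_nearly_full[OF assms]) (rule that)
  show thesis
  proof (rule that[of \<epsilon> "c + 1"])
    show "\<epsilon> > 0" by fact
    fix A A2 B :: "int set" and m d a0 :: int
    assume fin: "finite A" "finite B" and cB2: "card B \<ge> 2" and d: "d > 0"
      and A2: "A2 = {a \<in> A. d dvd a - a0}" "A2 \<noteq> {}"
      and "\<forall>b\<in>B. d dvd b - Min B" and m: "m = Max B - Min B"
      and ge: "\<alpha> * real_of_int (m div d) \<le> real (card A2)" and half: "2 * card A2 \<le> card B"
      and full: "(1 - \<epsilon>) * real_of_int (m div d) \<le> real (card B) - 1"
    then have cls: "\<And>b. b \<in> B \<Longrightarrow> d dvd b - Min B" by blast
    define lo where "lo = Min B"
    define A' where "A' = {x. a0 + d * x \<in> A2}"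
    define B' where "B' = {x. lo + d * x \<in> B}"
    have Bne: "B \<noteq> {}" using cB2 by auto
    have fA2: "finite A2" using fin by (simp add: A2)
    have inj: "inj_on (\<lambda>x. s + d * x) X" for s :: int and X using d by (auto simp: inj_on_def)
    have imA: "(\<lambda>x. a0 + d * x) ` A' = A2"
    proof (intro equalityI subsetI)
      fix a assume a: "a \<in> A2"
      then obtain y where "a - a0 = d * y" by (auto simp: A2)
      then have "a = a0 + d * y" by simp
      then show "a \<in> (\<lambda>x. a0 + d * x) ` A'" using a by (auto simp: A'_def)
    qed (auto simp: A'_def)
    have imB: "(\<lambda>x. lo + d * x) ` B' = B"
    proof (intro equalityI subsetI)
      fix b assume b: "b \<in> B"
      then obtain y where "b - lo = d * y" using cls[OF b] unfolding lo_def by (elim dvdE)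
      then have "b = lo + d * y" by simp
      then show "b \<in> (\<lambda>x. lo + d * x) ` B'" using b by (auto simp: B'_def)
    qed (auto simp: B'_def)
    have cA: "card A' = card A2" using card_image[OF inj, of a0 A'] imA by simp
    have cB: "card B' = card B" using card_image[OF inj, of lo B'] imB by simp
    have fA': "finite A'" using finite_imageD[OF _ inj] imA fA2 by metis
    have A'ne: "A' \<noteq> {}" using imA A2(2) by auto
    have hiB: "Max B \<in> B" "Min B \<in> B" using fin Bne by auto
    have "d dvd m" using cls[OF hiB(1)] by (simp add: m)
    then have md: "d * (m div d) = m" by simp
    have "attains c A' B' (real (card A') + real (card B') - 1)"
    proof (rule c[OF fA' A'ne])
      show "B' \<subseteq> {0..m div d}"
      proof
        fix x assume "x \<in> B'"
        then have "lo \<le> lo + d * x" "lo + d * x \<le> lo + d * (m div d)"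
          using Min_le[OF fin(2), of "lo + d * x"] Max_ge[OF fin(2), of "lo + d * x"] md m
          by (auto simp: B'_def lo_def)
        then have "d * 0 \<le> d * x" "d * x \<le> d * (m div d)" by auto
        then have "0 \<le> x" "x \<le> m div d" using d mult_le_cancel_left_pos by blast+
        then show "x \<in> {0..m div d}" by simp
      qed
      show "0 \<in> B'" using hiB by (simp add: B'_def lo_def)
      show "m div d \<in> B'" using hiB md m by (simp add: B'_def lo_def)
    qed (use ge half full cA cB in auto)
    then have "attains c A2 B (real (card A2) + real (card B) - 1)"
      using attains_affine[of c A' B' _ d a0 lo] d imA imB cA cB by simp
    then have "attains (c + 1) A B ((real (card A2) + real (card B) - 1) + real (card (A - A2)))"
    proof (rule attains_union[OF _ attains_singleton[of 1 "A - A2" lo]])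
      fix a a' b b' assume h: "a \<in> A2" "a' \<in> A - A2" "b \<in> B" "b' \<in> {lo}"
      show "a + b \<noteq> a' + b'"
      proof
        assume "a + b = a' + b'"
        then have eq: "a' - a0 = (a - a0) + (b - lo)" using h(4) by simp
        have "d dvd a - a0" "d dvd b - lo" using cls[OF h(3)] h(1) by (auto simp: A2 lo_def)
        then have "d dvd a' - a0" unfolding eq by (rule dvd_add)
        then show False using h(2) by (simp add: A2)
      qed
    qed (use fin hiB in \<open>auto simp: A2 lo_def\<close>)
    moreover have "real (card A) = real (card A2) + real (card (A - A2))"
    proof -
      have "A2 \<subseteq> A" by (auto simp: A2)
      then have "card A2 + card (A - A2) = card A"
        using card_Diff_subset[OF fA2] card_mono[OF fin(1)] by fastforce
      then show ?thesis by linarith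
    qed
    ultimately show "attains (c + 1) A B (real (card A) + real (card B) - 1)" by (simp add: algebra_simps)
  qed
qed

text \<open>Each of the m/d multiples of \<open>d\<close> in \<open>{0..<m}\<close> retains at least
  (1 - \<epsilon>) n points of \<open>M\<close>, and the overlaps over all shifts sum to
  n^2.\<close>

lemma near_full_of_periods:
  fixes m d :: int
  assumes m: "m > 0" and d: "d > 0" "d dvd m" and per: "periodic m M"
    and n: "n = real (card {r \<in> {0..<m}. r \<in> M})" "n > 0"
    and small: "\<And>g. d dvd g \<Longrightarrow> real (shift_defect m M g) \<le> \<epsilon> * n"
  shows "(1 - \<epsilon>) * real_of_int (m div d) \<le> n"
proof -
  define G where "G = {g \<in> {0..<m}. d dvd g}"
  define X where "X = {r \<in> {0..<m}. r \<in> M}"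
  have fX: "finite X" "finite G" unfolding X_def G_def by (rule finite_subset[of _ "{0..<m}"], auto)+
  have md: "d * (m div d) = m" using d by simp
  have q0: "m div d \<ge> 0" using m d by (simp add: pos_imp_zdiv_nonneg_iff)
  have cG: "real (card G) = real_of_int (m div d)"
  proof -
    have "G = (\<lambda>x. d * x) ` {0..<m div d}"
    proof (intro equalityI subsetI)
      fix g assume "g \<in> G"
      then obtain y where y: "g = d * y" "0 \<le> d * y" "d * y < d * (m div d)" using md by (auto simp: G_def)
      then have "0 \<le> y" "y < m div d" using d(1) by (auto simp: zero_le_mult_iff mult_less_cancel_left_pos)
      then show "g \<in> (\<lambda>x. d * x) ` {0..<m div d}" using y by auto
    next
      fix g assume "g \<in> (\<lambda>x. d * x) ` {0..<m div d}"
      then obtain y where y: "g = d * y" "y \<in> {0..<m div d}" by blast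
      then have y: "g = d * y" "0 \<le> y" "y < m div d" by auto
      then have "d * y < d * (m div d)" using d(1) by (intro mult_strict_left_mono)
      then show "g \<in> G" using y d md by (auto simp: G_def)
    qed
    then have "card G = card {0..<m div d}" using d by (simp add: card_image inj_on_def)
    then show ?thesis using q0 by simp
  qed
  have "real (card G) * ((1 - \<epsilon>) * n) = (\<Sum>g\<in>G. (1 - \<epsilon>) * n)" by simp
  also have "\<dots> \<le> (\<Sum>g\<in>G. real (card {r \<in> X. r + g \<in> M}))"
  proof (rule sum_mono)
    fix g assume "g \<in> G"
    then have "real (shift_defect m M g) \<le> \<epsilon> * n" using small by (simp add: G_def)
    moreover have "{r \<in> X. r + g \<in> M} = {r \<in> {0..<m}. r \<in> M \<and> r + g \<in> M}" by (auto simp: X_def)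
    ultimately show "(1 - \<epsilon>) * n \<le> real (card {r \<in> X. r + g \<in> M})"
      using shift_defect_complement[of m M g] n(1) by (simp add: algebra_simps)
  qed
  also have "\<dots> \<le> (\<Sum>g\<in>{0..<m}. real (card {r \<in> X. r + g \<in> M}))"
    by (rule sum_mono2) (auto simp: G_def)
  also have "\<dots> = real (\<Sum>g\<in>{0..<m}. card {r \<in> X. r + g \<in> M})" by simp
  also have "(\<Sum>g\<in>{0..<m}. card {r \<in> X. r + g \<in> M}) = (\<Sum>r\<in>X. card {g \<in> {0..<m}. r + g \<in> M})"
    by (rule sum_card_filter_swap) (use fX in auto)
  also have "\<dots> = (\<Sum>r\<in>X. card X)"
    using card_periodic_shift[OF m, of "\<lambda>x. x \<in> M"] per
    by (intro sum.cong) (auto simp: X_def periodic_def add.commute)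
  also have "real \<dots> = n * n" by (simp add: X_def n(1))
  finally have "(1 - \<epsilon>) * real_of_int (m div d) * n \<le> n * n" unfolding cG by (simp add: mult.commute mult.left_commute)
  then show ?thesis using n(2) by (rule mult_right_le_imp_le)
qed

text \<open>Markov's inequality for the counting measure.\<close>

lemma card_filter_gt_le:
  fixes f :: "'a \<Rightarrow> real"
  assumes "finite X" "\<And>x. x \<in> X \<Longrightarrow> 0 \<le> f x"
  shows "real (card {x \<in> X. t < f x}) * t \<le> sum f X"
proof -
  have "real (card {x \<in> X. t < f x}) * t = (\<Sum>x\<in>{x \<in> X. t < f x}. t)" by simp
  also have "\<dots> \<le> (\<Sum>x\<in>{x \<in> X. t < f x}. f x)" by (rule sum_mono) auto
  also have "\<dots> \<le> sum f X" using assms by (intro sum_mono2) auto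
  finally show ?thesis .
qed

text \<open>By Markov all but \<delta> n elements \<open>a\<close> of \<open>A1\<close> have a - a0
  of defect at most \<xi> n. These differences are distinct mod m, so there are at least \<gamma> n
  near-periods at tolerance \<xi> n. There are at most 2n at tolerance 2^J \<xi> n, because this is
  at most n/2. So some doubling of the tolerance in between increases their number by a factor below
  3/2, and at that scale a subgroup of near-periods contains all these differences.\<close>

lemma most_in_one_class:
  fixes A1 M :: "int set" and J :: nat
  assumes m: "m > 0" and per: "periodic m M" and n: "n = real (card {r \<in> {0..<m}. r \<in> M})" "n > 0"
    and A1: "finite A1" "A1 \<subseteq> {p..<p + m}"
    and \<xi>: "\<xi> > 0" "2 ^ J * \<xi> \<le> 1 / 2" and J: "2 < \<gamma> * (3 / 2) ^ J"
    and defects: "(\<Sum>a\<in>A1. real (shift_defect m M (a - a0))) \<le> \<delta> * \<xi> * n\<^sup>2"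
    and large: "\<gamma> * n \<le> real (card A1) - \<delta> * n"
  obtains d where "d > 0" "d dvd m" "\<And>g. d dvd g \<Longrightarrow> real (shift_defect m M g) \<le> 2 ^ J * \<xi> * n"
    "real (card A1) - \<delta> * n \<le> real (card {a \<in> A1. d dvd a - a0})"
proof -
  define G where "G = {a \<in> A1. real (shift_defect m M (a - a0)) \<le> \<xi> * n}"
  define f where "f j = card (near_periods m M (2 ^ j * (\<xi> * n)))" for j :: nat
  have fG: "finite G" using A1 by (simp add: G_def)
  have cG: "real (card A1) - \<delta> * n \<le> real (card G)"
  proof -
    have "real (card {a \<in> A1. \<xi> * n < real (shift_defect m M (a - a0))}) * (\<xi> * n) \<le> \<delta> * n * (\<xi> * n)"
    proof (rule order_trans[OF card_filter_gt_le[OF A1(1)]])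
      have eq: "\<delta> * \<xi> * n\<^sup>2 = \<delta> * n * (\<xi> * n)" by (simp add: power2_eq_square)
      show "(\<Sum>a\<in>A1. real (shift_defect m M (a - a0))) \<le> \<delta> * n * (\<xi> * n)" using defects[unfolded eq] .
    qed simp
    then have "real (card {a \<in> A1. \<xi> * n < real (shift_defect m M (a - a0))}) \<le> \<delta> * n"
      by (rule mult_right_le_imp_le) (use \<xi>(1) n(2) in simp)
    moreover have "card {a \<in> A1. \<xi> * n < real (shift_defect m M (a - a0))} + card G = card A1"
    proof -
      have "{a \<in> A1. \<xi> * n < real (shift_defect m M (a - a0))} \<union> G = A1" by (auto simp: G_def)
      then show ?thesis using A1(1) fG by (subst card_Un_disjoint[symmetric]) (auto simp: G_def)
    qed
    ultimately show ?thesis by linarith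
  qed
  have GK: "(a - a0) mod m \<in> near_periods m M (2 ^ j * (\<xi> * n))" if "a \<in> G" for a j
  proof -
    have "real (shift_defect m M (a - a0)) \<le> 1 * (\<xi> * n)" using that by (simp add: G_def)
    also have "\<dots> \<le> 2 ^ j * (\<xi> * n)" using \<xi>(1) n(2) by (intro mult_right_mono) auto
    finally show ?thesis using m by (simp add: near_periods_def shift_defect_mod[OF per])
  qed
  have "card G \<le> f 0"
    unfolding f_def
  proof (rule card_inj_on_le[where f = "\<lambda>a. (a - a0) mod m"])
    show "inj_on (\<lambda>a. (a - a0) mod m) G"
      using inj_on_mod_atLeastLessThan[of G p m "- a0"] A1(2) by (auto simp: G_def)
    show "(\<lambda>a. (a - a0) mod m) ` G \<subseteq> near_periods m M (2 ^ 0 * (\<xi> * n))"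
      using GK by blast
  qed (rule finite_near_periods)
  then have f0: "\<gamma> * n \<le> real (f 0)" using cG large by linarith
  have fJ: "real (f J) \<le> 2 * n"
    unfolding f_def
  proof (rule card_near_periods_le[OF m per n(1) _ n(2)])
    have "2 ^ J * \<xi> * n \<le> 1 / 2 * n" using \<xi>(2) n(2) by (intro mult_right_mono) auto
    then show "2 ^ J * (\<xi> * n) \<le> n / 2" by (simp add: mult.assoc)
  qed
  have "2 * n < \<gamma> * n * (3 / 2) ^ J"
    using mult_strict_right_mono[OF J n(2)] by (simp add: mult.commute mult.left_commute)
  from exists_small_growth[OF f0 fJ this]
  obtain j where j: "j < J" "2 * f (Suc j) < 3 * f j" by blast
  define x where "x = 2 ^ j * (\<xi> * n)"
  have x0: "x \<ge> 0" using \<xi>(1) n(2) by (simp add: x_def)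
  have "2 * card (near_periods m M (2 * x)) < 3 * card (near_periods m M x)"
    using j(2) unfolding f_def x_def by (simp only: power_Suc mult.assoc)
  from subgroup_of_near_periods[OF m per x0 this]
  obtain d where d: "d > 0" "d dvd m" "\<And>g. g \<in> near_periods m M x \<Longrightarrow> d dvd g"
    "\<And>g. d dvd g \<Longrightarrow> real (shift_defect m M g) \<le> 2 * x" by blast
  show thesis
  proof (rule that[OF d(1,2)])
    fix g assume "d dvd g"
    then have "real (shift_defect m M g) \<le> 2 * x" by (rule d(4))
    also have "2 * x = 2 ^ Suc j * (\<xi> * n)" by (simp add: x_def)
    also have "\<dots> \<le> 2 ^ J * (\<xi> * n)"
      using j(1) \<xi>(1) n(2) by (intro mult_right_mono power_increasing) auto
    finally show "real (shift_defect m M g) \<le> 2 ^ J * \<xi> * n" by (simp add: mult.assoc)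
  next
    have "d dvd a - a0" if "a \<in> G" for a
      using d(3)[of "(a - a0) mod m"] GK[OF that, of j] d(2) by (simp add: x_def dvd_mod_iff)
    then have "G \<subseteq> {a \<in> A1. d dvd a - a0}" by (auto simp: G_def)
    then have "card G \<le> card {a \<in> A1. d dvd a - a0}" using A1(1) by (intro card_mono) auto
    then show "real (card A1) - \<delta> * n \<le> real (card {a \<in> A1. d dvd a - a0})" using cG by linarith
  qed
qed

lemma attains_of_card_le_half:
  fixes \<alpha> :: real
  assumes \<alpha>: "\<alpha> > 0"
  obtains c where "\<And>A B :: int set. finite A \<Longrightarrow> A \<noteq> {} \<Longrightarrow> finite B \<Longrightarrow> B \<noteq> {} \<Longrightarrow>
    \<alpha> * real (card B) \<le> real (card A) \<Longrightarrow> 2 * card A \<le> card B \<Longrightarrow>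
    attains c A B (real (card A) + real (card B) - 1)"
proof -
  define \<delta> where "\<delta> = \<alpha> / 16"
  have pos: "\<alpha> / 4 > 0" "\<alpha> / 2 > 0" "\<alpha> / 8 > 0" using \<alpha> by simp_all
  have \<delta>: "\<delta> > 0" using \<alpha> by (simp add: \<delta>_def)
  obtain cF \<epsilon>F where \<epsilon>F: "\<epsilon>F > 0" and cF: "\<And>(A :: int set) A2 B m d a0. finite A \<Longrightarrow> finite B \<Longrightarrow> card B \<ge> 2 \<Longrightarrow> d > 0 \<Longrightarrow>
    A2 = {a \<in> A. d dvd a - a0} \<Longrightarrow> A2 \<noteq> {} \<Longrightarrow> (\<forall>b\<in>B. d dvd b - Min B) \<Longrightarrow> m = Max B - Min B \<Longrightarrow>
    \<alpha> / 4 * real_of_int (m div d) \<le> real (card A2) \<Longrightarrow> 2 * card A2 \<le> card B \<Longrightarrow>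
    (1 - \<epsilon>F) * real_of_int (m div d) \<le> real (card B) - 1 \<Longrightarrow>
    attains cF A B (real (card A) + real (card B) - 1)"
    by (rule attains_one_class[OF pos(1)]) (rule that)
  \<comment> \<open>The bound 1/2 serves twice: it limits the near-periods at the largest tolerance
    to 2n, and it gives \<open>m div d \<le> 2 * n\<close> when \<open>B\<close> lies in one
    class.\<close>
  define \<epsilon> where "\<epsilon> = min \<epsilon>F (1 / 2)"
  have \<epsilon>: "\<epsilon> > 0" "\<epsilon> \<le> \<epsilon>F" "\<epsilon> \<le> 1 / 2" using \<epsilon>F by (auto simp: \<epsilon>_def)
  obtain J where J: "4 / \<alpha> < (3 / 2) ^ J" using real_arch_pow[of "3 / 2" "4 / \<alpha>"] by auto
  define \<xi> where "\<xi> = \<epsilon> / 2 ^ J"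
  have \<xi>: "\<xi> > 0" "2 ^ J * \<xi> = \<epsilon>" using \<epsilon> by (auto simp: \<xi>_def)
  \<comment> \<open>Chosen so that energy at most 2 n^3 / k, divided by |A1| >= \<alpha> n / 2,
    leaves a total defect of at most \<delta> \<xi> n^2.\<close>
  define k where "k = nat \<lceil>4 / (\<alpha> * \<xi> * \<delta>)\<rceil> + 1"
  have k: "4 / (\<alpha> * \<xi> * \<delta>) \<le> real k" "k \<ge> 1" unfolding k_def by linarith+
  obtain cW where cW: "\<And>A B :: int set. finite A \<Longrightarrow> A \<noteq> {} \<Longrightarrow> finite B \<Longrightarrow> B \<noteq> {} \<Longrightarrow>
    \<alpha> * (real (card B) - 1) \<le> real (card A) \<Longrightarrow> 2 * card A \<le> card B \<Longrightarrow>
    attains cW A B (real (card A) + real (card B) - 1) \<or>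
    (\<exists>p. real (card A) - \<delta> * (real (card B) - 1) \<le> real (card (A \<inter> {p..<p + (Max B - Min B)})))"
    by (rule attains_or_window[OF \<alpha> \<delta>]) (rule that)
  obtain cT where cT: "\<And>(A2 :: int set) A B d a0 b0 b1. finite A \<Longrightarrow> A2 \<subseteq> A \<Longrightarrow> finite B \<Longrightarrow>
    (\<forall>a\<in>A2. d dvd a - a0) \<Longrightarrow> b0 \<in> B \<Longrightarrow> b1 \<in> B \<Longrightarrow> \<not> d dvd b1 - b0 \<Longrightarrow>
    \<alpha> / 2 * real (card B) \<le> real (card A2) \<Longrightarrow>
    attains cT A B (2 * real (card A2) + (1 - \<alpha> / 8) * (real (card B) - 2))"
    by (rule attains_two_classes[OF pos(2,3)]) (rule that)
  define c where "c = cW + (k + 2) + cF + cT + nat \<lceil>2 / \<alpha>\<rceil> + 4"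
  show thesis
  proof (rule that[of c])
    fix A B :: "int set"
    assume fin: "finite A" "finite B" and ne: "A \<noteq> {}" "B \<noteq> {}"
      and ge: "\<alpha> * real (card B) \<le> real (card A)" and half: "2 * card A \<le> card B"
    define n where "n = real (card B) - 1"
    define m where "m = Max B - Min B"
    define M where "M = {x. \<exists>b\<in>B. x mod m = b mod m}"
    have cA: "card A > 0" using fin ne by (simp add: card_gt_0_iff)
    have cB2: "card B \<ge> 2" using half cA by linarith
    have n1: "n \<ge> 1" using cB2 by (simp add: n_def)
    have B_n: "real (card B) = n + 1" by (simp add: n_def)
    have halfn: "2 * real (card A) \<le> n + 1" using half B_n by linarith
    have gen: "\<alpha> * n + \<alpha> \<le> real (card A)" using ge by (simp add: B_n algebra_simps)
    show "attains c A B (real (card A) + real (card B) - 1)"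
    proof (cases "n < 2 / \<alpha>")
      case True
      then have "1 + card B \<le> c" unfolding c_def using B_n by linarith
      then show ?thesis using attains_all[OF fin(1) ne(1) fin(2) ne(2)] by blast
    next
      case False
      then have big: "\<alpha> * n \<ge> 2" using \<alpha> by (simp add: field_simps)
      have mono: "attains c A B (real (card A) + real (card B) - 1)"
        if "attains c' A B t" "c' \<le> c" "real (card A) + real (card B) - 1 \<le> t" for c' t
        by (rule attains_mono[OF that]) (use fin in auto)
      have lt: "Min B < Max B" by (rule Min_less_Max[OF fin(2) cB2])
      have m: "m > 0" using lt by (simp add: m_def)
      have per: "periodic m M" by (simp add: periodic_def M_def)
      have nM: "n = real (card {r \<in> {0..<m}. r \<in> M})"
        using card_residues[OF fin(2) cB2 m_def M_def] by (simp add: n_def)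
      consider "attains cW A B (real (card A) + real (card B) - 1)"
        | p where "real (card A) - \<delta> * n \<le> real (card (A \<inter> {p..<p + m}))"
        using cW[OF fin(1) ne(1) fin(2) ne(2) _ half] ge \<alpha> by (auto simp: m_def n_def algebra_simps)
      then show ?thesis
      proof cases
        case 1
        then show ?thesis by (rule mono) (simp_all add: c_def)
      next
        case 2
        define A1 where "A1 = A \<inter> {p..<p + m}"
        have A1: "A1 \<subseteq> A" "A1 \<subseteq> {p..<p + m}" "finite A1" using fin by (auto simp: A1_def)
        have sA1: "real (card A) - \<alpha> * n / 16 \<le> real (card A1)" using 2 by (simp add: A1_def \<delta>_def)
        have s_half: "\<alpha> * n / 2 \<le> real (card A1)" using sA1 gen \<alpha> big by linarith
        have A1ne: "A1 \<noteq> {}" using s_half big by auto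
        have "real (card A1) \<le> real (card A)" using card_mono[OF fin(1) A1(1)] by simp
        then have s_le: "real (card A1) \<le> real (card B) - 1" using halfn n1 by (simp add: n_def)
        consider "attains (k + 2) A B (real (card A) + real (card B) - 1)"
          | a0 where "a0 \<in> A1" "real (card A1) * (\<Sum>a\<in>A1. real (shift_defect m M (a - a0))) \<le> 2 * n ^ 3 / real k"
          using attains_or_small_energy[OF fin A1ne cB2 A1(1,2) s_le k(2) m_def M_def] unfolding n_def by blast
        then show ?thesis
        proof cases
          case 1
          then show ?thesis by (rule mono) (simp_all add: c_def)
        next
          case 2
          define S where "S = (\<Sum>a\<in>A1. real (shift_defect m M (a - a0)))"
          have S0: "S \<ge> 0" unfolding S_def by (rule sum_nonneg) simp
          have Sle: "S \<le> \<delta> * \<xi> * n\<^sup>2"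
          proof -
            have "\<alpha> * n / 2 * S \<le> real (card A1) * S" using s_half S0 by (rule mult_right_mono)
            also have "\<dots> \<le> 2 * n ^ 3 / real k" using 2(2) by (simp add: S_def)
            also have "\<dots> \<le> 2 * n ^ 3 / (4 / (\<alpha> * \<xi> * \<delta>))"
              using k \<alpha> \<xi>(1) \<delta> n1 by (intro divide_left_mono mult_pos_pos divide_pos_pos) auto
            also have "\<dots> = \<alpha> * n / 2 * (\<delta> * \<xi> * n\<^sup>2)"
              by (simp add: power2_eq_square power3_eq_cube)
            finally show ?thesis using big by (simp add: mult_le_cancel_left_pos)
          qed
          have large: "\<alpha> / 2 * n \<le> real (card A1) - \<delta> * n" using sA1 gen \<alpha> big by (simp add: \<delta>_def)
          have growth: "2 < \<alpha> / 2 * (3 / 2) ^ J" using J \<alpha> by (simp add: field_simps)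
          have n0: "n > 0" and \<xi>J: "2 ^ J * \<xi> \<le> 1 / 2" using n1 \<epsilon>(3) \<xi>(2) by simp_all
          obtain d where d: "d > 0" "d dvd m" "\<And>g. d dvd g \<Longrightarrow> real (shift_defect m M g) \<le> 2 ^ J * \<xi> * n"
            "real (card A1) - \<delta> * n \<le> real (card {a \<in> A1. d dvd a - a0})"
            by (rule most_in_one_class[OF m per nM n0 A1(3,2) \<xi>(1) \<xi>J growth Sle[unfolded S_def] large]) (rule that)
          define A2 where "A2 = {a \<in> A. d dvd a - a0}"
          have "card {a \<in> A1. d dvd a - a0} \<le> card A2"
            using fin A1(1) by (intro card_mono) (auto simp: A2_def)
          then have cA2: "real (card A) - \<alpha> * n / 8 \<le> real (card A2)" using d(4) sA1 by (simp add: \<delta>_def)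
          have A2le: "card A2 \<le> card A" using fin by (intro card_mono) (auto simp: A2_def)
          have A2ne: "A2 \<noteq> {}" using cA2 gen big \<alpha> by auto
          have hiB: "Max B \<in> B" "Min B \<in> B" using fin ne by auto
          show ?thesis
          proof (cases "\<forall>b\<in>B. d dvd b - Min B")
            case True
            have "(1 - \<epsilon>) * real_of_int (m div d) \<le> n"
            proof (rule near_full_of_periods[OF m d(1,2) per nM n0])
              show "real (shift_defect m M g) \<le> \<epsilon> * n" if "d dvd g" for g
                using d(3)[OF that] \<xi>(2) by simp
            qed
            note near = this
            have q0: "real_of_int (m div d) \<ge> 0" using m d(1) by (simp add: pos_imp_zdiv_nonneg_iff)
            have le1: "(1 - \<epsilon>F) * real_of_int (m div d) \<le> (1 - \<epsilon>) * real_of_int (m div d)"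
              by (rule mult_right_mono[OF _ q0]) (use \<epsilon>(2) in simp)
            have le2: "1 / 2 * real_of_int (m div d) \<le> (1 - \<epsilon>) * real_of_int (m div d)"
              by (rule mult_right_mono[OF _ q0]) (use \<epsilon>(3) in simp)
            have q: "(1 - \<epsilon>F) * real_of_int (m div d) \<le> n" "real_of_int (m div d) \<le> 2 * n"
              using near le1 le2 by linarith+
            \<comment> \<open>The density \<alpha> / 4 was prescribed because \<open>m div d\<close>
              may be as large as 2n, while \<open>A2\<close> still has at least \<alpha> n / 2
              elements.\<close>
            have "\<alpha> / 4 * real_of_int (m div d) \<le> \<alpha> / 4 * (2 * n)" using \<alpha> q(2) by (intro mult_left_mono) auto
            then have "\<alpha> / 4 * real_of_int (m div d) \<le> real (card A2)" using cA2 gen \<alpha> big by linarith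
            moreover have "2 * card A2 \<le> card B" using A2le half by linarith
            moreover have "(1 - \<epsilon>F) * real_of_int (m div d) \<le> real (card B) - 1" using q(1) by (simp add: n_def)
            ultimately have "attains cF A B (real (card A) + real (card B) - 1)"
              by (rule cF[OF fin cB2 d(1) A2_def A2ne True m_def])
            then show ?thesis by (rule mono) (simp_all add: c_def)
          next
            case False
            then obtain b1 where b1: "b1 \<in> B" "\<not> d dvd b1 - Min B" by blast
            have "\<alpha> / 2 * real (card B) \<le> real (card A2)"
              using cA2 gen \<alpha> big by (simp add: B_n algebra_simps)
            moreover have "A2 \<subseteq> A" "\<forall>a\<in>A2. d dvd a - a0" by (auto simp: A2_def)
            ultimately have "attains cT A B (2 * real (card A2) + (1 - \<alpha> / 8) * (real (card B) - 2))"
              using cT[OF fin(1) _ fin(2) _ hiB(2) b1] by blast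
            \<comment> \<open>The window and Markov each cost \<delta> n = \<alpha> n / 16, so 2|A2|
              >= 2|A| - \<alpha> n / 4. Approximation costs less than another \<alpha> n / 8, and
              the split of \<open>B\<close> costs 1. The spare |A| >= \<alpha> n covers this, since
              \<alpha> n >= 2.\<close>
            moreover have "real (card A) + real (card B) - 1 \<le> 2 * real (card A2) + (1 - \<alpha> / 8) * (real (card B) - 2)"
            proof -
              have "(1 - \<alpha> / 8) * (real (card B) - 2) = n - 1 - \<alpha> * n / 8 + \<alpha> / 8"
                by (simp add: B_n field_simps)
              then show ?thesis using cA2 gen \<alpha> big B_n by linarith
            qed
            ultimately show ?thesis by (intro mono[of cT]) (simp_all add: c_def)
          qed
        qed
      qed
    qed
  qed
qed

section \<open>Reduction to small A\<close>

text \<open>The two parts share the cut point \<open>a\<close>. The sizes therefore add up to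
  \<open>card A + 1\<close>, which repays the -1 lost when staircases are glued.\<close>

lemma exists_overlapping_split:
  fixes A :: "int set"
  assumes "finite A" "0 < j" "j \<le> card A"
  obtains A0 A1 a where "A0 \<subseteq> A" "A1 \<subseteq> A" "card A1 = j" "card A0 = card A + 1 - j"
    "\<And>x. x \<in> A0 \<Longrightarrow> x \<le> a" "\<And>x. x \<in> A1 \<Longrightarrow> a \<le> x"
proof -
  obtain Q where Q: "Q \<subseteq> A" "card Q = j" "\<forall>x\<in>Q. \<forall>y\<in>A - Q. y < x"
    using exists_final_part[OF assms(1,3)] by blast
  have fQ: "finite Q" using Q(1) assms(1) finite_subset by blast
  have Qne: "Q \<noteq> {}" using Q(2) assms(2) by auto
  have a: "Min Q \<in> Q" using fQ Qne by simp
  show thesis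
  proof (rule that[of "insert (Min Q) (A - Q)" Q "Min Q"])
    show "insert (Min Q) (A - Q) \<subseteq> A" using a Q(1) by blast
    have "card (insert (Min Q) (A - Q)) = Suc (card (A - Q))" using a assms(1) by simp
    also have "\<dots> = card A + 1 - j" using Q(1,2) fQ assms(3) by (simp add: card_Diff_subset)
    finally show "card (insert (Min Q) (A - Q)) = card A + 1 - j" .
    show "x \<le> Min Q" if "x \<in> insert (Min Q) (A - Q)" for x 
    proof (cases "x = Min Q")
      case False
      then have "x < Min Q" using that Q(3) a by blast
      then show ?thesis by simp
    qed simp
    show "Min Q \<le> x" if "x \<in> Q" for x using fQ that by simp
  qed (use Q in auto)
qed

text \<open>In the middle range put D = |B| - |A| and cut off upper parts of sizes D and 2D, the
  extreme ratio of the small case. The lower parts then have equal size |A| + 1 - D, where three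
  elements suffice. Each overlap contributes 1, and the sizes give exactly |A| + |B| - 1.\<close>

lemma attains_of_card_ratio:
  fixes \<alpha> :: real
  assumes "\<alpha> > 0"
  obtains c where "\<And>A B :: int set. finite A \<Longrightarrow> A \<noteq> {} \<Longrightarrow> finite B \<Longrightarrow> B \<noteq> {} \<Longrightarrow>
    \<alpha> * real (card B) \<le> real (card A) \<Longrightarrow> attains c A B (real (card A) + real (card B) - 1)"
proof -
  \<comment> \<open>The cap 1/2 lets the same \<open>c\<close> serve the upper parts of the cut,
    whose ratio is exactly 1/2.\<close>
  define \<beta> where "\<beta> = min \<alpha> (1 / 2)"
  have \<beta>: "\<beta> > 0" "\<beta> \<le> \<alpha>" "\<beta> \<le> 1 / 2" using assms by (auto simp: \<beta>_def)
  obtain c where c: "\<And>A B :: int set. finite A \<Longrightarrow> A \<noteq> {} \<Longrightarrow> finite B \<Longrightarrow> B \<noteq> {} \<Longrightarrow>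
    \<beta> * real (card B) \<le> real (card A) \<Longrightarrow> 2 * card A \<le> card B \<Longrightarrow>
    attains c A B (real (card A) + real (card B) - 1)"
    by (rule attains_of_card_le_half[OF \<beta>(1)]) (rule that)
  show thesis
  proof (rule that[of "3 + c"])
    fix A B :: "int set"
    assume fin: "finite A" "finite B" and ne: "A \<noteq> {}" "B \<noteq> {}"
      and ge: "\<alpha> * real (card B) \<le> real (card A)"
    consider "real (card A) \<ge> real (card B) - 1" | "2 * card A \<le> card B"
      | "card B < 2 * card A" "card A + 1 < card B" by linarith
    then show "attains (3 + c) A B (real (card A) + real (card B) - 1)"
    proof cases
      case 1
      from attains_three[OF fin ne(2) 1] show ?thesis by (rule attains_mono) (use fin in auto)
    next
      case 2
      have "\<beta> * real (card B) \<le> \<alpha> * real (card B)" using \<beta>(2) by (rule mult_right_mono) simp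
      then have "\<beta> * real (card B) \<le> real (card A)" using ge by linarith
      from c[OF fin(1) ne(1) fin(2) ne(2) this 2] show ?thesis by (rule attains_mono) (use fin in auto)
    next
      case 3
      define D where "D = card B - card A"
      have D: "0 < D" "D \<le> card A" "2 * D \<le> card B" "card B = card A + D" using 3 by (auto simp: D_def)
      obtain A0 A1 a where A: "A0 \<subseteq> A" "A1 \<subseteq> A" "card A1 = D" "card A0 = card A + 1 - D"
        "\<And>x. x \<in> A0 \<Longrightarrow> x \<le> a" "\<And>x. x \<in> A1 \<Longrightarrow> a \<le> x"
        using exists_overlapping_split[OF fin(1) D(1,2)] by metis
      have D2: "0 < 2 * D" using D by simp
      obtain B0 B1 b where B: "B0 \<subseteq> B" "B1 \<subseteq> B" "card B1 = 2 * D" "card B0 = card B + 1 - 2 * D"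
        "\<And>x. x \<in> B0 \<Longrightarrow> x \<le> b" "\<And>x. x \<in> B1 \<Longrightarrow> b \<le> x"
        using exists_overlapping_split[OF fin(2) D2 D(3)] by metis
      have f: "finite A0" "finite A1" "finite B0" "finite B1"
        using A(1,2) B(1,2) fin finite_subset by blast+
      have "A1 \<noteq> {}" "B1 \<noteq> {}" "B0 \<noteq> {}" using A(3) B(3,4) D by auto
      note nonempty = this
      have cards: "card A0 = card B0" using A(4) B(4) D by linarith
      have at0: "attains 3 A0 B0 (real (card A0) + real (card B0) - 1)"
        by (rule attains_three[OF f(1,3) nonempty(3)]) (simp add: cards)
      have at1: "attains c A1 B1 (real (card A1) + real (card B1) - 1)"
      proof (rule c[OF f(2) nonempty(1) f(4) nonempty(2)])
        have "\<beta> * real (2 * D) \<le> 1 / 2 * real (2 * D)" using \<beta>(3) by (intro mult_right_mono) auto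
        then show "\<beta> * real (card B1) \<le> real (card A1)" by (simp add: A(3) B(3))
        show "2 * card A1 \<le> card B1" by (simp add: A(3) B(3))
      qed
      have "attains (3 + c) A B
        ((real (card A0) + real (card B0) - 1) + (real (card A1) + real (card B1) - 1) - 1)"
        by (rule attains_stair[OF at0 at1 fin A(1,2) B(1,2) A(5,6) B(5,6)])
      moreover have "real (card A0) = real (card A) + 1 - real D" "real (card B0) = real (card A) + 1 - real D"
        using A(4) cards D(2) by (simp_all add: of_nat_diff)
      then have "(real (card A0) + real (card B0) - 1) + (real (card A1) + real (card B1) - 1) - 1
         = real (card A) + real (card B) - 1"
        using A(3) B(3) D(4) by simp
      ultimately show ?thesis by simp
    qed
  qed
qed

section \<open>From bounded subsets to indexed elements\<close>

lemma exists_enumeration: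
  assumes "finite F" "F \<noteq> {}" "card F \<le> c"
  shows "\<exists>b :: nat \<Rightarrow> 'a. b ` {1..c} = F"
proof -
  obtain h where h: "bij_betw h {0..<card F} F" using ex_bij_betw_nat_finite[OF assms(1)] by blast
  have c0: "card F > 0" using assms by (simp add: card_gt_0_iff)
  \<comment> \<open>Indices beyond \<open>card F\<close> repeat the element
    \<open>h 0\<close>.\<close>
  define b where "b i = h (if i \<le> card F then i - 1 else 0)" for i
  have "b ` {1..c} = h ` {0..<card F}"
  proof (intro equalityI subsetI)
    fix y assume "y \<in> b ` {1..c}"
    then show "y \<in> h ` {0..<card F}" using c0 by (auto simp: b_def)
  next
    fix y assume "y \<in> h ` {0..<card F}"
    then obtain i where "i < card F" "y = h i" by auto
    then show "y \<in> b ` {1..c}" using assms(3) by (intro image_eqI[of _ _ "Suc i"]) (auto simp: b_def)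
  qed
  then show ?thesis using h by (auto simp: bij_betw_def)
qed

theorem theorem2:
  fixes \<alpha> :: real
  assumes "\<alpha> > 0"
  shows "\<exists>c::nat. c > 0 \<and>
    (\<forall>A B :: int set.
      finite A \<longrightarrow> A \<noteq> {} \<longrightarrow> finite B \<longrightarrow> B \<noteq> {} \<longrightarrow>
      real (card A) \<ge> \<alpha> * real (card B) \<longrightarrow>
      (\<exists>b :: nat \<Rightarrow> int. (\<forall>i\<in>{1..c}. b i \<in> B) \<and>
        card (A + b ` {1..c}) \<ge> card A + card B - 1))"
proof -
  obtain c where c: "\<And>A B :: int set. finite A \<Longrightarrow> A \<noteq> {} \<Longrightarrow> finite B \<Longrightarrow> B \<noteq> {} \<Longrightarrow>
    \<alpha> * real (card B) \<le> real (card A) \<Longrightarrow> attains c A B (real (card A) + real (card B) - 1)"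
    by (rule attains_of_card_ratio[OF assms]) (rule that)
  show ?thesis
  \<comment> \<open>\<open>c + 1\<close> is positive whatever \<open>c\<close> is; the additional
    index only repeats an element.\<close>
  proof (intro exI[of _ "c + 1"] conjI allI impI)
    fix A B :: "int set"
    assume fin: "finite A" "A \<noteq> {}" "finite B" "B \<noteq> {}" and ge: "\<alpha> * real (card B) \<le> real (card A)"
    obtain F where F: "F \<subseteq> B" "card F \<le> c" "real (card A) + real (card B) - 1 \<le> real (card (A + F))"
      using c[OF fin ge] unfolding attains_def by blast
    have fF: "finite F" using F(1) fin(3) finite_subset by blast
    have "card A > 0" "card B > 0" using fin by (auto simp: card_gt_0_iff)
    then have "card (A + F) > 0" using F(3) by linarith
    then have "F \<noteq> {}" by (auto simp: set_plus_def)
    then obtain b where b: "b ` {1..c + 1} = F" using exists_enumeration[OF fF, of "c + 1"] F(2) by auto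
    have "b i \<in> B" if "i \<in> {1..c + 1}" for i using b that F(1) by blast
    moreover have "card A + card B - 1 \<le> card (A + b ` {1..c + 1})" unfolding b using F(3) by linarith
    ultimately show "\<exists>b :: nat \<Rightarrow> int. (\<forall>i\<in>{1..c + 1}. b i \<in> B) \<and>
        card A + card B - 1 \<le> card (A + b ` {1..c + 1})" by blast
  qed simp
qed

end
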